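(* Let $\mathbb{F}$ be a field of prime characteristic $p>2$, let $m$ be a positive integer, and let $\lambda\in\mathbb{F}$. Then the following statements hold: (1) If $p=3$, then $$\dim_{\mathbb{F}}H^1(\mathfrak{W}(m),V(\lambda))=\begin{cases}1 & \text{if }\lambda=0\\ m-1 & \text{if }\lambda=1\\ m+1 & \text{if }\lambda=2\\ 0 & \text{if }\lambda\ne 0,1,2.\end{cases}$$ (2) If $p>3$, then $$\dim_{\mathbb{F}}H^1(\mathfrak{W}(m),V(\lambda))=\begin{cases}1 & \text{if }\lambda=0\text{ or }\lambda=1\\ m-1 & \text{if }\lambda=p-2\\ m+1 & \text{if }\lambda=p-1\\ 0 & \text{if }\lambda\ne 0,1,p-2,p-1.\end{cases}$$
   Context: $H^1$ is ordinary (Chevalley-Eilenberg) Lie algebra cohomology. Integers are regarded as elements of $\mathbb{F}$ where appropriate. Zassenhaus algebra: let $A(m)$ be the truncated divided power algebra over $\mathbb{F}$ with basis $\{x^{(a)}\mid 0\le a\le p^m-1\}$ and product $x^{(a)}x^{(b)}=\binom{a+b}{a}x^{(a+b)}$ (zero if $a+b\ge p^m$). Let $\partial$ be the derivation with $\partial(x^{(0)})=0$ and $\partial(x^{(a)})=x^{(a-1)}$ for $1\le a\le p^m-1$. Then $W(m)=A(m)\partial\subseteq\mathrm{Der}_{\mathbb{F}}(A(m))$ is the Lie algebra with basis $e_i:=x^{(i+1)}\partial$, $-1\le i\le p^m-2$, and bracket $[e_i,e_j]=\left(\binom{i+j+1}{j}-\binom{i+j+1}{i}\right)e_{i+j}$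 if $-1\le i+j\le p^m-2$ and $[e_i,e_j]=0$ otherwise. Put $\mathfrak{b}(m):=\bigoplus_{i=0}^{p^m-2}\mathbb{F}e_i$. Restricted Zassenhaus algebra: $\mathfrak{W}(m)$ is the $p$-subalgebra of $\mathfrak{gl}(W(m))$ generated by $\mathrm{ad}(W(m))$ (with $p$-mapping the $p$-th power); it is a minimal $p$-envelope of $W(m)$. Identifying $W(m)$ with $\mathrm{ad}(W(m))$ one has $\mathfrak{W}(m)=\bigoplus_{r=1}^{m-1}\mathbb{F}e_{-1}^{[p]^r}\oplus W(m)$, where $e_{-1}^{[p]^r}=(\mathrm{ad}\,e_{-1})^{p^r}$. Generalized baby Verma modules: the element $z_{-1}:=e_{-1}^{p^m}$ is central in $U(W(m))$. Let $\mathcal{O}(W(m),\mathfrak{b}(m))$ be the unital subalgebra of $U(W(m))$ generated by $\mathfrak{b}(m)$ and $z_{-1}$. For $\lambda\in\mathbb{F}$ let $F_\lambda=\mathbb{F}1_\lambda$ be the one-dimensional module over it with $e_0\cdot 1_\lambda=\lambda 1_\lambda$, $e_i\cdot 1_\lambda=0$ for $1\le i\le p^m-2$, and $z_{-1}\cdot 1_\lambda=0$. Then $V(\lambda):=U(W(m))\otimes_{\mathcal{O}(W(m),\mathfrak{b}(m))}F_\lambda$. Action of $\mathfrak{W}(m)$: let $\hat W(m)$ be the universal $p$-envelope of $W(m)$, i.e. the restricted Lie subalgebra of $U(W(m))$ (with $p$-mapping $u\mapsto u^p$) generated by $W(m)$; every $W(m)$-module is a $\hat W(m)$-module by restriction from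 $U(W(m))$. Fix a Lie algebra homomorphism $\phi:\mathfrak{W}(m)\to\hat W(m)$ that is the identity on $W(m)$ (for instance $e_{-1}^{[p]^r}\mapsto e_{-1}^{p^r}$); every $W(m)$-module is regarded as a $\mathfrak{W}(m)$-module via $\phi$. *)

theory Defs
  imports "HOL-Algebra.Module" "HOL-Algebra.QuotRing" "HOL-Algebra.Subrings"
    "HOL-Algebra.Algebraic_Closure_Type"
begin

text \<open>
  The ground field is a type \<open>'k::field\<close>, viewed as a HOL-Algebra ring by
  \<^const>\<open>ring_of_type_algebra\<close>.  The record type \<open>('k, 'v) module\<close> is used for three
  kinds of structures over it: vector spaces (the fields \<open>mult\<close> and \<open>one\<close> are then
  irrelevant), unital associative algebras (the library locale \<open>algebra\<close> is commutative),
  and Lie algebras (\<open>mult\<close> is the bracket and \<open>one\<close> is irrelevant).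
\<close>

section \<open>Linear algebra\<close>

abbreviation scalars :: "'k::field ring" where
  "scalars \<equiv> ring_of_type_algebra"

definition lin_span :: "('k::field, 'v) module \<Rightarrow> 'v set \<Rightarrow> 'v set" where
  "lin_span M S = \<Inter>{H. submodule H scalars M \<and> S \<subseteq> H}"

definition has_dim :: "('k::field, 'v) module \<Rightarrow> nat \<Rightarrow> bool" where
  "has_dim M n \<longleftrightarrow> (\<exists>B. B \<subseteq> carrier M \<and> finite B \<and> card B = n \<and> lin_span M B = carrier M \<and>
     (\<forall>c. (\<Oplus>\<^bsub>M\<^esub>b\<in>B. c b \<odot>\<^bsub>M\<^esub> b) = \<zero>\<^bsub>M\<^esub> \<longrightarrow> (\<forall>b\<in>B. c b = 0)))"

text \<open>\<^const>\<open>FactRing\<close> lacks scalar multiplication, which is added here.\<close>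

definition quot_module :: "('k::field, 'v) module \<Rightarrow> 'v set \<Rightarrow> ('k, 'v set) module" where
  "quot_module M N = ring.extend (M Quot N)
     (module.fields (\<lambda>c Y. \<Union>x\<in>Y. N +>\<^bsub>M\<^esub> (c \<odot>\<^bsub>M\<^esub> x)))"

definition lin_maps :: "('k::field, 'v) module \<Rightarrow> ('k, 'w) module \<Rightarrow> ('v \<Rightarrow> 'w) set" where
  "lin_maps M N = {f \<in> carrier M \<rightarrow>\<^sub>E carrier N.
     (\<forall>x\<in>carrier M. \<forall>y\<in>carrier M. f (x \<oplus>\<^bsub>M\<^esub> y) = f x \<oplus>\<^bsub>N\<^esub> f y) \<and>
     (\<forall>c. \<forall>x\<in>carrier M. f (c \<odot>\<^bsub>M\<^esub> x) = c \<odot>\<^bsub>N\<^esub> f x)}"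

definition hom_space :: "('k::field, 'v) module \<Rightarrow> ('k, 'w) module \<Rightarrow> ('k, 'v \<Rightarrow> 'w) module" where
  "hom_space M N = \<lparr>carrier = lin_maps M N, monoid.mult = undefined, one = undefined,
     zero = (\<lambda>x\<in>carrier M. \<zero>\<^bsub>N\<^esub>), add = (\<lambda>f g. \<lambda>x\<in>carrier M. f x \<oplus>\<^bsub>N\<^esub> g x),
     module.smult = (\<lambda>c f. \<lambda>x\<in>carrier M. c \<odot>\<^bsub>N\<^esub> f x)\<rparr>"

definition End_alg :: "('k::field, 'v) module \<Rightarrow> ('k, 'v \<Rightarrow> 'v) module" where
  "End_alg M = (hom_space M M)\<lparr>monoid.mult := compose (carrier M), one := (\<lambda>x\<in>carrier M. x)\<rparr>"

text \<open>Finitely supported functions on \<open>Y\<close>, with basis the functions \<open>\<delta> x\<close>.\<close>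

definition \<delta> :: "'x \<Rightarrow> 'x \<Rightarrow> 'k::field" where
  "\<delta> x = (\<lambda>y. if y = x then 1 else 0)"

definition free_space :: "'x set \<Rightarrow> ('k::field, 'x \<Rightarrow> 'k) module" where
  "free_space Y = \<lparr>carrier = {f. finite {x. f x \<noteq> 0} \<and> {x. f x \<noteq> 0} \<subseteq> Y},
     monoid.mult = undefined, one = undefined, zero = (\<lambda>_. 0), add = (\<lambda>f g x. f x + g x),
     module.smult = (\<lambda>c f x. c * f x)\<rparr>"

definition base_space :: "('k::field, 'k) module" where
  "base_space = ring.extend scalars (module.fields (*))"

section \<open>Associative algebras and their modules\<close>

text \<open>The product makes words multiply by concatenation: \<open>\<delta> u \<otimes> \<delta> v = \<delta> (u @ v)\<close>.\<close>

definition free_alg :: "'x set \<Rightarrow> ('k::field, 'x list \<Rightarrow> 'k) module" where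
  "free_alg Y = (free_space (lists Y))
     \<lparr>monoid.mult := (\<lambda>f g w. \<Sum>i\<le>length w. f (take i w) * g (drop i w)), one := \<delta> []\<rparr>"

definition subalg_gen :: "('k::field, 'a) module \<Rightarrow> 'a set \<Rightarrow> 'a set" where
  "subalg_gen A S = \<Inter>{B. submodule B scalars A \<and> subring B A \<and> S \<subseteq> B}"

definition alg_reps :: "('k::field, 'a) module \<Rightarrow> ('k, 'v) module \<Rightarrow> ('a \<Rightarrow> 'v \<Rightarrow> 'v) set" where
  "alg_reps A V = lin_maps A (End_alg V) \<inter> ring_hom A (End_alg V)"

text \<open>
  For a subalgebra \<open>B\<close> of \<open>A\<close> and a left \<open>B\<close>-module \<open>(N, \<sigma>)\<close>, the tensor product of \<open>A\<close> and \<open>N\<close>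
  over \<open>B\<close> is the vector space on the symbols \<open>(a, n)\<close> modulo the usual relations.
\<close>

definition tensor_rels ::
  "('k::field, 'a) module \<Rightarrow> 'a set \<Rightarrow> ('k, 'n) module \<Rightarrow> ('a \<Rightarrow> 'n \<Rightarrow> 'n) \<Rightarrow> ('a \<times> 'n \<Rightarrow> 'k) set" where
  "tensor_rels A B N \<sigma> = (let T = free_space (carrier A \<times> carrier N) in lin_span T (
      {\<delta> (a \<oplus>\<^bsub>A\<^esub> a', n) \<ominus>\<^bsub>T\<^esub> (\<delta> (a, n) \<oplus>\<^bsub>T\<^esub> \<delta> (a', n)) | a a' n.
         a \<in> carrier A \<and> a' \<in> carrier A \<and> n \<in> carrier N}
    \<union> {\<delta> (a, n \<oplus>\<^bsub>N\<^esub> n') \<ominus>\<^bsub>T\<^esub> (\<delta> (a, n) \<oplus>\<^bsub>T\<^esub> \<delta> (a, n')) | a n n'.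
         a \<in> carrier A \<and> n \<in> carrier N \<and> n' \<in> carrier N}
    \<union> {\<delta> (c \<odot>\<^bsub>A\<^esub> a, n) \<ominus>\<^bsub>T\<^esub> (c \<odot>\<^bsub>T\<^esub> \<delta> (a, n)) | c a n. a \<in> carrier A \<and> n \<in> carrier N}
    \<union> {\<delta> (a, c \<odot>\<^bsub>N\<^esub> n) \<ominus>\<^bsub>T\<^esub> (c \<odot>\<^bsub>T\<^esub> \<delta> (a, n)) | c a n. a \<in> carrier A \<and> n \<in> carrier N}
    \<union> {\<delta> (a \<otimes>\<^bsub>A\<^esub> b, n) \<ominus>\<^bsub>T\<^esub> \<delta> (a, \<sigma> b n) | a b n.
         a \<in> carrier A \<and> b \<in> B \<and> n \<in> carrier N}))"

definition tensor_space ::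
  "('k::field, 'a) module \<Rightarrow> 'a set \<Rightarrow> ('k, 'n) module \<Rightarrow> ('a \<Rightarrow> 'n \<Rightarrow> 'n) \<Rightarrow>
     ('k, ('a \<times> 'n \<Rightarrow> 'k) set) module" where
  "tensor_space A B N \<sigma> =
     quot_module (free_space (carrier A \<times> carrier N)) (tensor_rels A B N \<sigma>)"

text \<open>The action of \<open>A\<close> determined by \<open>a (a' \<otimes> n) = (a a') \<otimes> n\<close>.\<close>

definition tensor_rep ::
  "('k::field, 'a) module \<Rightarrow> 'a set \<Rightarrow> ('k, 'n) module \<Rightarrow> ('a \<Rightarrow> 'n \<Rightarrow> 'n) \<Rightarrow>
     'a \<Rightarrow> ('a \<times> 'n \<Rightarrow> 'k) set \<Rightarrow> ('a \<times> 'n \<Rightarrow> 'k) set" where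
  "tensor_rep A B N \<sigma> = (\<lambda>a\<in>carrier A. \<lambda>Y\<in>carrier (tensor_space A B N \<sigma>).
     let T = free_space (carrier A \<times> carrier N) in
       \<Union>f\<in>Y. tensor_rels A B N \<sigma> +>\<^bsub>T\<^esub>
         (\<Oplus>\<^bsub>T\<^esub>x\<in>{x. f x \<noteq> 0}. f x \<odot>\<^bsub>T\<^esub> \<delta> (a \<otimes>\<^bsub>A\<^esub> fst x, snd x)))"

section \<open>Lie algebras\<close>

definition lie_of :: "('k::field, 'a) module \<Rightarrow> ('k, 'a) module" where
  "lie_of A = A\<lparr>monoid.mult := (\<lambda>x y. x \<otimes>\<^bsub>A\<^esub> y \<ominus>\<^bsub>A\<^esub> y \<otimes>\<^bsub>A\<^esub> x)\<rparr>"

definition ad :: "('k::field, 'l) module \<Rightarrow> 'l \<Rightarrow> 'l \<Rightarrow> 'l" where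
  "ad L x = (\<lambda>y\<in>carrier L. x \<otimes>\<^bsub>L\<^esub> y)"

definition lie_homs :: "('k::field, 'l) module \<Rightarrow> ('k, 'g) module \<Rightarrow> ('l \<Rightarrow> 'g) set" where
  "lie_homs L G = {f \<in> lin_maps L G.
     \<forall>x\<in>carrier L. \<forall>y\<in>carrier L. f (x \<otimes>\<^bsub>L\<^esub> y) = f x \<otimes>\<^bsub>G\<^esub> f y}"

text \<open>
  The \<open>p\<close>-subalgebra generated by \<open>S\<close> in the restricted Lie algebra \<open>lie_of A\<close>, whose
  \<open>p\<close>-mapping is the \<open>p\<close>-th power in \<open>A\<close>.
\<close>

definition p_subalg_gen :: "nat \<Rightarrow> ('k::field, 'a) module \<Rightarrow> 'a set \<Rightarrow> ('k, 'a) module" where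
  "p_subalg_gen p A S = (lie_of A)\<lparr>carrier := \<Inter>{H. submodule H scalars A \<and> S \<subseteq> H \<and>
     (\<forall>x\<in>H. \<forall>y\<in>H. x \<otimes>\<^bsub>lie_of A\<^esub> y \<in> H) \<and> (\<forall>x\<in>H. x [^]\<^bsub>A\<^esub> p \<in> H)}\<rparr>"

text \<open>
  The universal enveloping algebra, presented by the elements of \<open>L\<close> as generators, subject to
  linearity and to \<open>x y - y x = [x, y]\<close>; \<open>env_in\<close> is the canonical map from \<open>L\<close>.
\<close>

definition env_ideal :: "('k::field, 'l) module \<Rightarrow> ('l list \<Rightarrow> 'k) set" where
  "env_ideal L = (let T = free_alg (carrier L) in Idl\<^bsub>T\<^esub> (
      {\<delta> [x \<oplus>\<^bsub>L\<^esub> y] \<ominus>\<^bsub>T\<^esub> (\<delta> [x] \<oplus>\<^bsub>T\<^esub> \<delta> [y]) | x y. x \<in> carrier L \<and> y \<in> carrier L}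
    \<union> {\<delta> [c \<odot>\<^bsub>L\<^esub> x] \<ominus>\<^bsub>T\<^esub> (c \<odot>\<^bsub>T\<^esub> \<delta> [x]) | c x. x \<in> carrier L}
    \<union> {(\<delta> [x] \<otimes>\<^bsub>T\<^esub> \<delta> [y] \<ominus>\<^bsub>T\<^esub> \<delta> [y] \<otimes>\<^bsub>T\<^esub> \<delta> [x]) \<ominus>\<^bsub>T\<^esub> \<delta> [x \<otimes>\<^bsub>L\<^esub> y] | x y.
         x \<in> carrier L \<and> y \<in> carrier L}))"

definition env_alg :: "('k::field, 'l) module \<Rightarrow> ('k, ('l list \<Rightarrow> 'k) set) module" where
  "env_alg L = quot_module (free_alg (carrier L)) (env_ideal L)"

definition env_in :: "('k::field, 'l) module \<Rightarrow> 'l \<Rightarrow> ('l list \<Rightarrow> 'k) set" where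
  "env_in L x = env_ideal L +>\<^bsub>free_alg (carrier L) :: ('k, _) module\<^esub> \<delta> [x]"

text \<open>
  First Chevalley-Eilenberg cohomology of \<open>L\<close> with coefficients in the module \<open>(V, \<rho>)\<close>:
  the kernel of the differential on 1-cochains modulo the image of the 0-cochains \<open>V\<close>.
\<close>

definition ce_d0 :: "('k::field, 'l) module \<Rightarrow> ('k, 'v) module \<Rightarrow> ('l \<Rightarrow> 'v \<Rightarrow> 'v) \<Rightarrow> 'v \<Rightarrow> 'l \<Rightarrow> 'v"
  where "ce_d0 L V \<rho> v = (\<lambda>x\<in>carrier L. \<rho> x v)"

definition ce_d1 ::
  "('k::field, 'l) module \<Rightarrow> ('k, 'v) module \<Rightarrow> ('l \<Rightarrow> 'v \<Rightarrow> 'v) \<Rightarrow> ('l \<Rightarrow> 'v) \<Rightarrow> 'l \<Rightarrow> 'l \<Rightarrow> 'v"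
  where "ce_d1 L V \<rho> f = (\<lambda>x\<in>carrier L. \<lambda>y\<in>carrier L.
    \<rho> x (f y) \<ominus>\<^bsub>V\<^esub> \<rho> y (f x) \<ominus>\<^bsub>V\<^esub> f (x \<otimes>\<^bsub>L\<^esub> y))"

definition H1 ::
  "('k::field, 'l) module \<Rightarrow> ('k, 'v) module \<Rightarrow> ('l \<Rightarrow> 'v \<Rightarrow> 'v) \<Rightarrow> ('k, ('l \<Rightarrow> 'v) set) module"
  where "H1 L V \<rho> = quot_module
    ((hom_space L V)\<lparr>carrier := {f \<in> lin_maps L V.
       \<forall>x\<in>carrier L. \<forall>y\<in>carrier L. ce_d1 L V \<rho> f x y = \<zero>\<^bsub>V\<^esub>}\<rparr>)
    (ce_d0 L V \<rho> ` carrier V)"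

section \<open>The Zassenhaus algebra and its restricted version\<close>

text \<open>
  The truncated divided power algebra: \<open>f\<close> stands for \<open>\<Sum>a. f a x\<^sup>(\<^sup>a\<^sup>)\<close>, so that
  \<open>\<delta> a\<close> is the basis element \<open>x\<^sup>(\<^sup>a\<^sup>)\<close>.
\<close>

definition divpow :: "nat \<Rightarrow> nat \<Rightarrow> ('k::field, nat \<Rightarrow> 'k) module" where
  "divpow p m = \<lparr>carrier = {f. \<forall>a\<ge>p ^ m. f a = 0},
     monoid.mult = (\<lambda>f g n. if n < p ^ m then \<Sum>a\<le>n. of_nat (n choose a) * f a * g (n - a) else 0),
     one = \<delta> 0, zero = (\<lambda>_. 0), add = (\<lambda>f g n. f n + g n), module.smult = (\<lambda>c f n. c * f n)\<rparr>"

definition dp_deriv :: "nat \<Rightarrow> nat \<Rightarrow> (nat \<Rightarrow> 'k::field) \<Rightarrow> nat \<Rightarrow> 'k" where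
  "dp_deriv p m = (\<lambda>f\<in>carrier (divpow p m). \<lambda>a. f (Suc a))"

definition dp_vect :: "nat \<Rightarrow> nat \<Rightarrow> (nat \<Rightarrow> 'k::field) \<Rightarrow> (nat \<Rightarrow> 'k) \<Rightarrow> nat \<Rightarrow> 'k" where
  "dp_vect p m f = (\<lambda>g\<in>carrier (divpow p m). f \<otimes>\<^bsub>divpow p m\<^esub> dp_deriv p m g)"

definition zass :: "nat \<Rightarrow> nat \<Rightarrow> ('k::field, (nat \<Rightarrow> 'k) \<Rightarrow> nat \<Rightarrow> 'k) module" where
  "zass p m = (lie_of (End_alg (divpow p m)))\<lparr>carrier := dp_vect p m ` carrier (divpow p m)\<rparr>"

text \<open>The basis element \<open>e\<^sub>i\<close>, meaningful for \<open>-1 \<le> i \<le> p ^ m - 2\<close>.\<close>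

definition zass_e :: "nat \<Rightarrow> nat \<Rightarrow> int \<Rightarrow> (nat \<Rightarrow> 'k::field) \<Rightarrow> nat \<Rightarrow> 'k" where
  "zass_e p m i = dp_vect p m (\<delta> (nat (i + 1)))"

definition zass_b :: "nat \<Rightarrow> nat \<Rightarrow> ((nat \<Rightarrow> 'k::field) \<Rightarrow> nat \<Rightarrow> 'k) set" where
  "zass_b p m = lin_span (zass p m) (zass_e p m ` {0..int (p ^ m) - 2})"

definition rzass ::
  "nat \<Rightarrow> nat \<Rightarrow> ('k::field, ((nat \<Rightarrow> 'k) \<Rightarrow> nat \<Rightarrow> 'k) \<Rightarrow> (nat \<Rightarrow> 'k) \<Rightarrow> nat \<Rightarrow> 'k) module" where
  "rzass p m = p_subalg_gen p (End_alg (zass p m)) (ad (zass p m) ` carrier (zass p m))"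

type_synonym 'k zenv = "(((nat \<Rightarrow> 'k) \<Rightarrow> nat \<Rightarrow> 'k) list \<Rightarrow> 'k) set"

definition zass_hat :: "nat \<Rightarrow> nat \<Rightarrow> ('k::field, 'k zenv) module" where
  "zass_hat p m = p_subalg_gen p (env_alg (zass p m)) (env_in (zass p m) ` carrier (zass p m))"

text \<open>
  The Lie algebra homomorphisms from \<open>rzass p m\<close> to the universal \<open>p\<close>-envelope that are the
  identity on the Zassenhaus algebra; the latter is embedded by \<open>ad\<close> in the source and by the
  canonical map in the target.
\<close>

definition envelope_homs ::
  "nat \<Rightarrow> nat \<Rightarrow> ((((nat \<Rightarrow> 'k) \<Rightarrow> nat \<Rightarrow> 'k) \<Rightarrow> (nat \<Rightarrow> 'k) \<Rightarrow> nat \<Rightarrow> 'k) \<Rightarrow> 'k::field zenv) set" where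
  "envelope_homs p m = {\<phi> \<in> lie_homs (rzass p m) (zass_hat p m).
     \<forall>w\<in>carrier (zass p m). \<phi> (ad (zass p m) w) = env_in (zass p m) w}"

section \<open>Generalized baby Verma modules\<close>

definition zass_z :: "nat \<Rightarrow> nat \<Rightarrow> 'k::field zenv" where
  "zass_z p m = env_in (zass p m) (zass_e p m (-1)) [^]\<^bsub>env_alg (zass p m) :: ('k, _) module\<^esub> (p ^ m)"

definition zass_O :: "nat \<Rightarrow> nat \<Rightarrow> 'k::field zenv set" where
  "zass_O p m = subalg_gen (env_alg (zass p m)) (env_in (zass p m) ` zass_b p m \<union> {zass_z p m})"

text \<open>
  The module structure of \<open>F\<^sub>\<lambda>\<close>, where \<open>\<lambda> = lam\<close>; its underlying space is the ground field, with \<open>1\<^sub>\<lambda> = 1\<close>.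
  It is unique because its values on the generators of \<open>zass_O p m\<close> are prescribed.
\<close>

definition F_rep :: "nat \<Rightarrow> nat \<Rightarrow> 'k::field \<Rightarrow> 'k zenv \<Rightarrow> 'k \<Rightarrow> 'k" where
  "F_rep p m lam = (THE \<sigma>.
     \<sigma> \<in> alg_reps ((env_alg (zass p m))\<lparr>carrier := zass_O p m\<rparr>) base_space \<and>
     \<sigma> (env_in (zass p m) (zass_e p m 0)) 1 = lam \<and>
     (\<forall>i\<in>{1..int (p ^ m) - 2}. \<sigma> (env_in (zass p m) (zass_e p m i)) 1 = 0) \<and>
     \<sigma> (zass_z p m) 1 = 0)"

definition baby_verma :: "nat \<Rightarrow> nat \<Rightarrow> 'k::field \<Rightarrow> ('k, ('k zenv \<times> 'k \<Rightarrow> 'k) set) module" where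
  "baby_verma p m lam = tensor_space (env_alg (zass p m)) (zass_O p m) base_space (F_rep p m lam)"

definition baby_verma_rep ::
  "nat \<Rightarrow> nat \<Rightarrow> 'k::field \<Rightarrow> 'k zenv \<Rightarrow> ('k zenv \<times> 'k \<Rightarrow> 'k) set \<Rightarrow> ('k zenv \<times> 'k \<Rightarrow> 'k) set" where
  "baby_verma_rep p m lam = tensor_rep (env_alg (zass p m)) (zass_O p m) base_space (F_rep p m lam)"

end

theory Submission
  imports Defs "HOL-Algebra.Exponent"
begin

text \<open>
  \<open>V(\<lambda>)\<close> is the module of tensor densities of weight \<open>\<mu> = \<lambda> + 1\<close>: its underlying space is \<open>A(m)\<close>, the
  vector field \<open>f\<partial>\<close> acts by \<open>g \<mapsto> f g' + \<mu> f' g\<close>, and \<open>1\<^sub>\<lambda>\<close> corresponds to the top element \<open>x\<^sup>(\<^sup>N\<^sup>-\<^sup>1\<^sup>)\<close>,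
  where \<open>N = p\<^sup>m\<close>.  A cocycle of \<open>W(m)\<close> on it can be changed by a coboundary so that it vanishes on
  \<open>\<partial>\<close>, provided that one also admits the coboundary of the element \<open>x\<^sup>(\<^sup>N\<^sup>)\<close>, which lies outside of \<open>A(m)\<close>
  and is only needed for \<open>\<mu> = 0\<close>.  It then commutes with \<open>\<partial>\<close>, hence is a polynomial in \<open>\<partial>\<close>, and the
  cocycle identity on basis elements leaves only \<open>\<partial>\<close> (\<open>\<mu> = 0\<close>), \<open>\<partial>\<^sup>2\<close> (\<open>\<mu> = 1\<close>), \<open>\<partial>\<^sup>3\<close> (\<open>\<mu> = 2\<close>) and the
  powers \<open>\<partial>\<close> to the \<open>p\<^sup>r\<close> with \<open>r \<ge> 1\<close> (\<open>\<mu> = -1\<close>).  For \<open>\<mu> = -1\<close> this computes the derivations of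
  \<open>W(m)\<close>, and so identifies the restricted Zassenhaus algebra.  The values of a cocycle on its elements
  outside \<open>W(m)\<close> are determined up to invariants of \<open>W(m)\<close>, which are nonzero only for \<open>\<mu> = 0\<close> and
  account for \<open>m - 1\<close> further classes there.
\<close>

section \<open>Divided power series\<close>

text \<open>The weight is \<mu> = \<lambda> + 1 because x\<partial> multiplies x^(N-1) by N - 1 +
  \<mu> = \<mu> - 1, and the zero action of z matches \<partial>^N = 0 on \<open>A\<close>. The
  identification with V(\<lambda>) comes from two opposite bounds: the action on densities gives a
  map that kills the tensor relations, and a commutation argument in U(W(m)) shows that a tensor has
  no further freedom. The other obstacle is that \<phi> is arbitrary: \<phi>(\<partial>^q) may
  differ from \<partial>^q by something commuting with W(m). On densities of weight \<mu> the
  difference acts by a scalar that is additive in \<mu> and is 0 for \<mu> = 1, hence it is 0 in the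
  weights 0, 1, 2, -1, the only ones that can carry cohomology. In terms of \<lambda>: weight 0 is
  \<lambda> = p - 1, with the classes of \<partial> and x^(N) and m - 1 invariants; weights 1 and 2
  are \<lambda> = 0 and 1; weight -1 is \<lambda> = p - 2. For p = 3 the weights 2 and -1 coincide,
  and \<partial>^3 is itself a power \<partial>^q with q = p; this is why that prime is listed
  separately.\<close>

text \<open>
  The divided power algebra is used without truncation, and \<open>dpA N\<close> below is the subspace spanned by
  the \<open>x\<^sup>(\<^sup>a\<^sup>)\<close> with \<open>a < N\<close>.  In characteristic \<open>p\<close> the truncated product on \<open>A(m)\<close> is the restriction
  of the untruncated one: \<open>dpA (p ^ m)\<close> is the kernel of \<open>dd ^^ (p ^ m)\<close>, which is a derivation.
\<close>

typedef 'a dps = "UNIV :: (nat \<Rightarrow> 'a) set" morphisms dp_nth Dp ..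

lemma dp_nth_Dp [simp]: "dp_nth (Dp f) = f"
  by (simp add: Dp_inverse)

lemma dps_eqI: "(\<And>n. dp_nth f n = dp_nth g n) \<Longrightarrow> f = g"
  by (metis dp_nth_inverse ext)

definition dd :: "'a dps \<Rightarrow> 'a dps" where
  "dd f = Dp (\<lambda>n. dp_nth f (Suc n))"

lemma dp_nth_dd [simp]: "dp_nth (dd f) n = dp_nth f (Suc n)"
  by (simp add: dd_def)

instantiation dps :: (comm_ring_1) "{zero, one, plus, minus, uminus, times}"
begin
definition "0 = Dp (\<lambda>_. 0)"
definition "1 = Dp (\<lambda>n. if n = 0 then 1 else 0)"
definition "f + g = Dp (\<lambda>n. dp_nth f n + dp_nth g n)"
definition "f - g = Dp (\<lambda>n. dp_nth f n - dp_nth g n)"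
definition "- f = Dp (\<lambda>n. - dp_nth f n)"
definition "f * g = Dp (\<lambda>n. \<Sum>a\<le>n. of_nat (n choose a) * dp_nth f a * dp_nth g (n - a))"
instance ..
end

lemma dp_nth_simps [simp]:
  fixes f g :: "'a::comm_ring_1 dps"
  shows "dp_nth (0 :: 'a dps) n = 0"
    and "dp_nth (1 :: 'a dps) n = (if n = 0 then 1 else 0)"
    and "dp_nth (f + g) n = dp_nth f n + dp_nth g n"
    and "dp_nth (f - g) n = dp_nth f n - dp_nth g n"
    and "dp_nth (- f) n = - dp_nth f n"
  by (simp_all add: zero_dps_def one_dps_def plus_dps_def minus_dps_def uminus_dps_def)

lemma dp_nth_times:
  fixes f g :: "'a::comm_ring_1 dps"
  shows "dp_nth (f * g) n = (\<Sum>a\<le>n. of_nat (n choose a) * dp_nth f a * dp_nth g (n - a))"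
  by (simp add: times_dps_def)

lemma dp_nth_times_0 [simp]:
  fixes f g :: "'a::comm_ring_1 dps"
  shows "dp_nth (f * g) 0 = dp_nth f 0 * dp_nth g 0"
  by (simp add: dp_nth_times)

text \<open>Pascal's rule, split into its two summands, is the Leibniz rule for \<open>dd\<close>.
  It also drives the ring axioms: coefficient n + 1 of a product is the sum of coefficients n of two
  products, so commutativity and associativity follow by induction on the index.\<close>

lemma dp_nth_times_Suc:
  fixes f g :: "'a::comm_ring_1 dps"
  shows "dp_nth (f * g) (Suc n) = dp_nth (dd f * g) n + dp_nth (f * dd g) n"
proof -
  let ?F = "\<lambda>a. dp_nth f a" and ?G = "\<lambda>a. dp_nth g a"
  have "dp_nth (f * g) (Suc n) = ?F 0 * ?G (Suc n) +
      (\<Sum>a\<le>n. of_nat (Suc n choose Suc a) * ?F (Suc a) * ?G (n - a))"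
    by (simp add: dp_nth_times sum.atMost_Suc_shift del: sum.atMost_Suc binomial_Suc_Suc)
  also have "(\<Sum>a\<le>n. of_nat (Suc n choose Suc a) * ?F (Suc a) * ?G (n - a)) =
      dp_nth (dd f * g) n + (\<Sum>a\<le>n. of_nat (n choose Suc a) * ?F (Suc a) * ?G (n - a))"
    by (simp add: dp_nth_times algebra_simps sum.distrib)
  also have "(\<Sum>a\<le>n. of_nat (n choose Suc a) * ?F (Suc a) * ?G (n - a)) =
      (\<Sum>a<n. of_nat (n choose Suc a) * ?F (Suc a) * ?G (n - a))"
    by (simp add: lessThan_Suc_atMost[symmetric] binomial_eq_0)
  also have "?F 0 * ?G (Suc n) + (dp_nth (dd f * g) n + \<dots>) =
      dp_nth (dd f * g) n + (\<Sum>a<Suc n. of_nat (n choose a) * ?F a * ?G (Suc n - a))"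
    by (simp add: sum.lessThan_Suc_shift del: sum.lessThan_Suc)
  also have "(\<Sum>a<Suc n. of_nat (n choose a) * ?F a * ?G (Suc n - a)) = dp_nth (f * dd g) n"
    by (auto simp: dp_nth_times lessThan_Suc_atMost Suc_diff_le intro!: sum.cong)
  finally show ?thesis .
qed

instance dps :: (comm_ring_1) comm_ring_1
proof
  fix f g h :: "'a dps"
  have distr: "dp_nth ((f + g) * h) n = dp_nth (f * h) n + dp_nth (g * h) n" for f g h :: "'a dps" and n
    by (simp add: dp_nth_times algebra_simps sum.distrib)
  have comm: "dp_nth (f * g) n = dp_nth (g * f) n" for f g :: "'a dps" and n
  proof (induction n arbitrary: f g)
    case (Suc n)
    show ?case
      unfolding dp_nth_times_Suc using Suc[of "dd f" g] Suc[of f "dd g"] by (simp add: add.commute)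
  qed (simp add: mult.commute)
  have comm': "f * g = g * f" for f g :: "'a dps"
    by (rule dps_eqI) (rule comm)
  have distr': "(f + g) * h = f * h + g * h" for f g h :: "'a dps"
    by (rule dps_eqI) (simp add: distr)
  have dd_times: "dd (f * g) = dd f * g + f * dd g" for f g :: "'a dps"
    by (rule dps_eqI) (simp add: dp_nth_times_Suc)
  have "dp_nth ((f * g) * h) n = dp_nth (f * (g * h)) n" for n
  proof (induction n arbitrary: f g h)
    case (Suc n)
    show ?case
      unfolding dp_nth_times_Suc dd_times distr distr' comm'[of f "_ + _"] dp_nth_simps
      by (simp add: Suc comm'[of _ f])
  qed (simp add: mult.assoc)
  then show "f * g * h = f * (g * h)" by (intro dps_eqI)
  show "f * g = g * f" by (rule comm')
  show "(f + g) * h = f * h + g * h" by (rule distr')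
  have "dp_nth (1 * f) n = dp_nth f n" for n
    by (simp add: dp_nth_times if_distrib if_distribR mult.assoc sum.delta cong: if_cong)
  then show "1 * f = f" by (intro dps_eqI)
  show "f + g + h = f + (g + h)" by (rule dps_eqI) simp
  show "f + g = g + f" by (rule dps_eqI) simp
  show "0 + f = f" by (rule dps_eqI) simp
  show "- f + f = 0" by (rule dps_eqI) simp
  show "f - g = f + - g" by (rule dps_eqI) simp
  show "(0 :: 'a dps) \<noteq> 1"
  proof
    assume "(0 :: 'a dps) = 1"
    then have "dp_nth (0 :: 'a dps) 0 = dp_nth 1 0" by simp
    then show False by simp
  qed
qed

lemma dp_nth_sum [simp]: "dp_nth (\<Sum>i\<in>I. f i) n = (\<Sum>i\<in>I. dp_nth (f i :: 'a::comm_ring_1 dps) n)"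
  by (induction I rule: infinite_finite_induct) auto

lemma dd_linear [simp]:
  fixes f g :: "'a::comm_ring_1 dps"
  shows "dd (f + g) = dd f + dd g" "dd (f - g) = dd f - dd g" "dd (- f) = - dd f"
    "dd (0 :: 'a dps) = 0" "dd (1 :: 'a dps) = 0"
  by (auto intro!: dps_eqI)

lemma dd_sum [simp]: "dd (\<Sum>i\<in>I. f i) = (\<Sum>i\<in>I. dd (f i :: 'a::comm_ring_1 dps))"
  by (induction I rule: infinite_finite_induct) auto

lemma dd_times [simp]:
  fixes f g :: "'a::comm_ring_1 dps"
  shows "dd (f * g) = dd f * g + f * dd g"
  by (rule dps_eqI) (simp add: dp_nth_times_Suc)

text \<open>Constants as ring elements, so that scalar multiplication is a product in the ring and
  \<open>algebra_simps\<close> applies to it.\<close>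

definition dpC :: "'a::comm_ring_1 \<Rightarrow> 'a dps" where
  "dpC c = Dp (\<lambda>n. if n = 0 then c else 0)"

lemma dp_nth_dpC [simp]: "dp_nth (dpC c) n = (if n = 0 then c else 0)"
  by (simp add: dpC_def)

lemma dp_nth_dpC_times [simp]: "dp_nth (dpC c * f) n = c * dp_nth f n"
  by (simp add: dp_nth_times if_distrib if_distribR mult.assoc sum.delta cong: if_cong)

lemma dpC_simps [simp]:
  shows "dpC 0 = 0" "dpC 1 = 1" "dpC (a + b) = dpC a + dpC b" "dpC (a - b) = dpC a - dpC b"
    "dpC (- a) = - dpC a" "dpC (a * b) = dpC a * dpC b" "dd (dpC a) = 0"
  by (auto intro!: dps_eqI)

lemma dpC_of_nat: "dpC (of_nat n) = of_nat n"
  by (induction n) simp_all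

lemma dpC_eq_iff [simp]: "dpC a = dpC b \<longleftrightarrow> a = b"
  by (metis dp_nth_dpC)

lemma dpC_eq_0_iff [simp]: "dpC a = 0 \<longleftrightarrow> a = 0"
  using dpC_eq_iff[of a 0] by simp

definition dpX :: "nat \<Rightarrow> 'a::comm_ring_1 dps" where
  "dpX a = Dp (\<lambda>n. if n = a then 1 else 0)"

lemma dp_nth_dpX [simp]: "dp_nth (dpX a) n = (if n = a then 1 else 0)"
  by (simp add: dpX_def)

lemma dpX_0 [simp]: "dpX 0 = 1"
  by (rule dps_eqI) auto

lemma dd_dpX_Suc [simp]: "dd (dpX (Suc n)) = dpX n"
  by (auto intro!: dps_eqI)

lemma dd_dpX: "n > 0 \<Longrightarrow> dd (dpX n) = dpX (n - 1)"
  by (cases n) auto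

lemma dp_nth_dd_pow [simp]: "dp_nth ((dd ^^ k) f) n = dp_nth f (n + k)"
  by (induction k arbitrary: f n) (simp_all)

lemma dd_pow_dpX: "(dd ^^ k) (dpX n) = (if k \<le> n then dpX (n - k) else 0)"
  by (auto intro!: dps_eqI)

lemma dpX_mult: "dpX a * dpX b = dpC (of_nat ((a + b) choose a)) * (dpX (a + b) :: 'a::comm_ring_1 dps)"
proof (rule dps_eqI)
  fix n
  have "dp_nth (dpX a * dpX b :: 'a dps) n =
    (\<Sum>i\<le>n. if i = a then of_nat (n choose a) * (if n - a = b then 1 else 0) else 0)"
    unfolding dp_nth_times by (intro sum.cong) auto
  also have "\<dots> = (if a \<le> n then of_nat (n choose a) * (if n - a = b then 1 else 0) else 0)"
    by (simp add: sum.delta)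
  finally show "dp_nth (dpX a * dpX b :: 'a dps) n =
      dp_nth (dpC (of_nat ((a + b) choose a)) * dpX (a + b)) n" by auto
qed

lemma dd_pow_linear [simp]:
  fixes f g :: "'a::comm_ring_1 dps"
  shows "(dd ^^ k) (f + g) = (dd ^^ k) f + (dd ^^ k) g"
    "(dd ^^ k) (f - g) = (dd ^^ k) f - (dd ^^ k) g" "(dd ^^ k) (0 :: 'a dps) = 0"
    "(dd ^^ k) (dpC c * f) = dpC c * (dd ^^ k) f"
  by (auto intro!: dps_eqI)

lemma dd_pow_sum [simp]: "(dd ^^ k) (\<Sum>i\<in>I. f i) = (\<Sum>i\<in>I. (dd ^^ k) (f i :: 'a::comm_ring_1 dps))"
  by (induction I rule: infinite_finite_induct) auto

lemma dd_dd_pow: "dd ((dd ^^ k) f) = (dd ^^ k) (dd f)"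
  by (simp add: funpow_swap1)

text \<open>Three operators are allowed because the two factors and the product may carry different
  actions, as for densities of weights a, b and a + b; \<open>B\<close> is later the product or the
  bracket.\<close>

lemma leibniz_pow:
  fixes B :: "'b::ab_group_add \<Rightarrow> 'c::ab_group_add \<Rightarrow> 'a::comm_ring_1"
  assumes D: "\<And>x y. D (x + y) = D x + D y"
    and B1: "\<And>x y. D (B x y) = B (S x) y + B x (T y)"
  shows "(D ^^ n) (B x y) = (\<Sum>k\<le>n. of_nat (n choose k) * B ((S ^^ k) x) ((T ^^ (n - k)) y))"
proof (induction n arbitrary: x y)
  case (Suc n)
  have add: "(D ^^ n) (u + v) = (D ^^ n) u + (D ^^ n) v" for u v
    by (induction n) (simp_all add: D)
  let ?t = "\<lambda>k. B ((S ^^ k) x) ((T ^^ (Suc n - k)) y)"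
  have "(D ^^ Suc n) (B x y) = (D ^^ n) (B (S x) y) + (D ^^ n) (B x (T y))"
    by (simp add: funpow_swap1 B1 add)
  also have "(D ^^ n) (B (S x) y) = (\<Sum>k\<le>n. of_nat (n choose k) * ?t (Suc k))"
    unfolding Suc by (simp add: funpow_swap1)
  also have "(D ^^ n) (B x (T y)) = (\<Sum>k\<le>n. of_nat (n choose k) * ?t k)"
    unfolding Suc by (intro sum.cong) (auto simp: Suc_diff_le funpow_swap1)
  also have "\<dots> = (\<Sum>k\<le>Suc n. of_nat (n choose k) * ?t k)"
    by (simp add: binomial_eq_0)
  also have "\<dots> = ?t 0 + (\<Sum>k\<le>n. of_nat (n choose Suc k) * ?t (Suc k))"
    by (simp add: sum.atMost_Suc_shift del: sum.atMost_Suc)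
  also have "(\<Sum>k\<le>n. of_nat (n choose k) * ?t (Suc k)) + \<dots> = 
     ?t 0 + (\<Sum>k\<le>n. of_nat (Suc n choose Suc k) * ?t (Suc k))"
    by (simp add: sum.distrib algebra_simps)
  also have "\<dots> = (\<Sum>k\<le>Suc n. of_nat (Suc n choose k) * ?t k)"
    by (simp add: sum.atMost_Suc_shift del: sum.atMost_Suc)
  finally show ?case .
qed simp

text \<open>The inner binomial coefficients (p choose k) are divisible by p, so only the two extreme
  terms survive: p-th powers of derivations are derivations.\<close>

lemma leibniz_pow_char:
  fixes B :: "'b::ab_group_add \<Rightarrow> 'c::ab_group_add \<Rightarrow> 'a::comm_ring_1"
  assumes p: "prime p" "of_nat p = (0 :: 'a)"
    and D: "\<And>x y. D (x + y) = D x + D y"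
    and B1: "\<And>x y. D (B x y) = B (S x) y + B x (T y)"
  shows "(D ^^ p) (B x y) = B ((S ^^ p) x) y + B x ((T ^^ p) y)"
proof -
  let ?t = "\<lambda>k. of_nat (p choose k) * B ((S ^^ k) x) ((T ^^ (p - k)) y)"
  have "?t k = 0" if "k \<in> {..p} - {0, p}" for k
  proof -
    have "p dvd (p choose k)" using that p(1) by (intro dvd_choose_prime) auto
    then obtain q where "(p choose k) = p * q" by (elim dvdE)
    then show ?thesis using p(2) by simp
  qed
  moreover have "p > 0" using p(1) by (rule prime_gt_0_nat)
  ultimately have "sum ?t {..p} = sum ?t {0, p}"
    by (intro sum.mono_neutral_right) auto
  then show ?thesis
    using leibniz_pow[of D B S T, OF D B1, of p x y] \<open>p > 0\<close> by (simp add: add.commute)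
qed

lemma of_nat_dps_char: "of_nat CHAR('a) = (0 :: 'a::comm_ring_1 dps)"
  by (metis dpC_of_nat dpC_simps(1) of_nat_CHAR)

lemma dd_pow_prime_pow_times:
  fixes f g :: "'a::comm_ring_1 dps"
  assumes "prime p" "CHAR('a) = p"
  shows "(dd ^^ (p ^ r)) (f * g) = (dd ^^ (p ^ r)) f * g + f * (dd ^^ (p ^ r)) g"
proof (induction r arbitrary: f g)
  case (Suc r)
  have pw: "(dd ^^ (p ^ Suc r)) = ((dd :: 'a dps \<Rightarrow> _) ^^ (p ^ r)) ^^ p"
    by (simp only: funpow_mult power_Suc2)
  have ch: "of_nat p = (0 :: 'a dps)"
    using of_nat_dps_char[where 'a='a] assms by simp
  have "(((dd :: 'a dps \<Rightarrow> _) ^^ (p ^ r)) ^^ p) (f * g) =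
      ((dd ^^ (p ^ r)) ^^ p) f * g + f * ((dd ^^ (p ^ r)) ^^ p) g"
    by (rule leibniz_pow_char[where B = "(*)", OF assms(1) ch]) (rule dd_pow_linear Suc.IH)+
  then show ?case by (simp only: pw)
qed simp

definition dpA :: "nat \<Rightarrow> 'a::comm_ring_1 dps set" where
  "dpA N = {f. \<forall>a\<ge>N. dp_nth f a = 0}"

lemma dpA_iff: "f \<in> dpA N \<longleftrightarrow> (dd ^^ N) f = 0"
proof
  assume 0: "(dd ^^ N) f = 0"
  have "dp_nth f a = 0" if "a \<ge> N" for a
  proof -
    have "dp_nth ((dd ^^ N) f) (a - N) = 0" using 0 by simp
    then show ?thesis using that by simp
  qed
  then show "f \<in> dpA N" by (simp add: dpA_def)
next
  assume "f \<in> dpA N"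
  then show "(dd ^^ N) f = 0" by (intro dps_eqI) (simp add: dpA_def)
qed

lemma dpA_simps [simp]:
  "0 \<in> dpA N" "f \<in> dpA N \<Longrightarrow> g \<in> dpA N \<Longrightarrow> f + g \<in> dpA N"
  "f \<in> dpA N \<Longrightarrow> g \<in> dpA N \<Longrightarrow> f - g \<in> dpA N"
  "f \<in> dpA N \<Longrightarrow> - f \<in> dpA N" "f \<in> dpA N \<Longrightarrow> dpC c * f \<in> dpA N"
  "f \<in> dpA N \<Longrightarrow> dd f \<in> dpA N" "f \<in> dpA N \<Longrightarrow> (dd ^^ k) f \<in> dpA N"
  "n < N \<Longrightarrow> dpX n \<in> dpA N" "0 < N \<Longrightarrow> 1 \<in> dpA N" "0 < N \<Longrightarrow> dpC c \<in> dpA N"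
  by (auto simp: dpA_def)

lemma dpA_sum: "(\<And>i. i \<in> I \<Longrightarrow> f i \<in> dpA N) \<Longrightarrow> (\<Sum>i\<in>I. f i) \<in> dpA N"
  by (induction I rule: infinite_finite_induct) auto

lemma dpA_expand:
  assumes "f \<in> dpA N"
  shows "f = (\<Sum>b<N. dpC (dp_nth f b) * dpX b)"
proof (rule dps_eqI)
  fix n
  have "dp_nth (\<Sum>b<N. dpC (dp_nth f b) * dpX b) n = (\<Sum>b<N. if n = b then dp_nth f b else 0)"
    unfolding dp_nth_sum by (intro sum.cong) simp_all
  also have "\<dots> = dp_nth f n" using assms by (auto simp: dpA_def)
  finally show "dp_nth f n = dp_nth (\<Sum>b<N. dpC (dp_nth f b) * dpX b) n" by simp
qed

lemma dpA_times:
  fixes f g :: "'a::comm_ring_1 dps"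
  assumes "prime p" "CHAR('a) = p" "f \<in> dpA (p ^ m)" "g \<in> dpA (p ^ m)"
  shows "f * g \<in> dpA (p ^ m)"
  using assms by (simp add: dpA_iff dd_pow_prime_pow_times)

text \<open>The top coefficient is the only obstruction to integration inside \<open>dpA N\<close>,
  since x^(N-1) integrates to x^(N).\<close>

lemma dpA_antideriv:
  assumes "y \<in> dpA N" "dp_nth y (N - 1) = 0" "N > 0"
  obtains v where "v \<in> dpA N" "dd v = y"
proof
  show "Dp (\<lambda>n. case n of 0 \<Rightarrow> 0 | Suc k \<Rightarrow> dp_nth y k) \<in> dpA N"
    unfolding dpA_def
  proof (clarsimp split: nat.splits)
    fix k assume "N \<le> Suc k"
    then consider "N \<le> k" | "k = N - 1" by linarith
    then show "dp_nth y k = 0" using assms by cases (auto simp: dpA_def)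
  qed
  show "dd (Dp (\<lambda>n. case n of 0 \<Rightarrow> 0 | Suc k \<Rightarrow> dp_nth y k)) = y"
    by (rule dps_eqI) simp
qed

lemma dd_eq_0: "dd f = 0 \<Longrightarrow> f = dpC (dp_nth f 0)"
proof (rule dps_eqI)
  fix n assume "dd f = 0"
  then have "dp_nth (dd f) k = 0" for k by simp
  then show "dp_nth f n = dp_nth (dpC (dp_nth f 0)) n" by (cases n) auto
qed

section \<open>Cocycles of the Zassenhaus algebra in tensor density modules\<close>

definition br :: "'a::comm_ring_1 dps \<Rightarrow> 'a dps \<Rightarrow> 'a dps" where
  "br f g = f * dd g - dd f * g"

text \<open>The Lie derivative of g (dx)^\<mu> along f\<partial>: functions for \<mu> = 0,
  differential forms for \<mu> = 1, the adjoint module for \<mu> = -1.\<close>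

definition dact :: "'a::comm_ring_1 \<Rightarrow> 'a dps \<Rightarrow> 'a dps \<Rightarrow> 'a dps" where
  "dact \<mu> f g = f * dd g + dpC \<mu> * dd f * g"

lemma dact_br: "dact \<mu> (br f g) h = dact \<mu> f (dact \<mu> g h) - dact \<mu> g (dact \<mu> f h)"
  by (simp add: dact_def br_def algebra_simps)

lemma dact_linear:
  "dact \<mu> f (g + h) = dact \<mu> f g + dact \<mu> f h" "dact \<mu> f (g - h) = dact \<mu> f g - dact \<mu> f h"
  "dact \<mu> (f + g) h = dact \<mu> f h + dact \<mu> g h" "dact \<mu> (f - g) h = dact \<mu> f h - dact \<mu> g h"
  "dact \<mu> f (dpC c * g) = dpC c * dact \<mu> f g" "dact \<mu> (dpC c * f) g = dpC c * dact \<mu> f g"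
  "dact \<mu> f 0 = 0" "dact \<mu> 0 f = 0" "dact \<mu> 1 f = dd f"
  by (simp_all add: dact_def algebra_simps)

lemma dact_neg_1: "dact (-1) f g = br f g"
  by (simp add: dact_def br_def)

text \<open>By hypothesis all (k choose i) with 1 \<le> i < k are congruent to k. If k = p^r q with
  r \<ge> 1, q > 1 and p not dividing q, then (k choose p^r) is prime to p, although k is not. If p
  does not divide k and k \<ge> 4, the value at i = 2 gives k congruent to 3, and then 4 (k choose
  4) = (k - 3) (k choose 3) makes 4k vanish modulo the odd prime p.\<close>

lemma binomials_all_equal:
  assumes p: "prime p" "CHAR('k::field) = p" "p > 2" and k: "k \<ge> 2"
    and eq: "\<And>i. 2 \<le> i \<Longrightarrow> i < k \<Longrightarrow> (of_nat (k choose i) :: 'k) = of_nat (k choose (i - 1))"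
  shows "k = 2 \<or> k = 3 \<or> (\<exists>r\<ge>1. k = p ^ r)"
proof -
  have zero_iff: "(of_nat n :: 'k) = 0 \<longleftrightarrow> p dvd n" for n
    using p by (simp add: of_nat_eq_0_iff_char_dvd)
  have all: "(of_nat (k choose i) :: 'k) = of_nat k" if "1 \<le> i" "i < k" for i
    using that
  proof (induction i rule: nat_induct_at_least)
    case (Suc n)
    then show ?case using eq[of "Suc n"] by simp
  qed simp
  show ?thesis
  proof (cases "p dvd k")
    case True
    obtain q where q: "k = p ^ multiplicity p k * q" "\<not> p dvd q"
      using k p(1) multiplicity_decompose'[of k p] by (metis not_prime_unit not_numeral_le_zero)
    define r where "r = multiplicity p k"
    have r: "r \<ge> 1" using True q r_def
      by (metis One_nat_def Suc_leI mult_1 neq0_conv power_0)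
    show ?thesis
    proof (cases "q = 1")
      case False
      have q0: "q > 1" using q(1) k False by (cases q) auto
      have "multiplicity p (k choose p ^ r) = multiplicity p q"
        using const_p_fac[of q p r] p(1) q q0 r_def by simp
      also have "\<dots> = 0" using q(2) by (rule not_dvd_imp_multiplicity_0)
      finally have m0: "multiplicity p (k choose p ^ r) = 0" .
      have pr: "p ^ r > 0" using p(1) prime_gt_0_nat by simp
      have lt: "p ^ r < k" using q(1) q0 r_def pr by (metis mult.right_neutral nat_mult_less_cancel1)
      have "(of_nat (k choose p ^ r) :: 'k) = of_nat k"
        using all[of "p ^ r"] pr lt by simp
      then have "p dvd (k choose p ^ r)" using True zero_iff by metis
      moreover have "(k choose p ^ r) > 0" using lt by simp
      ultimately show ?thesis using m0 p(1)
        by (metis multiplicity_eq_zero_iff not_prime_unit less_numeral_extra(3))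
    qed (use q r r_def in auto)
  next
    case False
    have k0: "(of_nat k :: 'k) \<noteq> 0" using False zero_iff by simp
    have two: "(2 :: 'k) \<noteq> 0" using zero_iff[of 2] p(3) by (auto dest: dvd_imp_le)
    show ?thesis
    proof (rule ccontr)
      assume neg: "\<not> ?thesis"
      then have k4: "k \<ge> 4" using k by auto
      have "2 * (k choose 2) = k * (k - 1)"
        by (cases k) (auto simp: choose_two)
      then have "(of_nat (2 * (k choose 2)) :: 'k) = of_nat (k * (k - 1))" by simp
      then have "(2 :: 'k) * of_nat k = of_nat k * of_nat (k - 1)"
        using all[of 2] k4 by simp
      then have k1: "(of_nat (k - 1) :: 'k) = 2" using k0 by simp
      then have k3: "(of_nat (k - 3) :: 'k) = 0"
      proof -
        have "k - 1 = (k - 3) + 2" using k4 by simp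
        then have "(of_nat (k - 1) :: 'k) = of_nat (k - 3) + 2" by (metis of_nat_add of_nat_numeral)
        then show ?thesis using k1 by simp
      qed
      show False
      \<comment> \<open>The common value is only known for i < k, so i = 4 is available only when k
        > 4; for k = 4 already k - 3 = 1 is absurd.\<close>
      proof (cases "k = 4")
        case True
        then have "p dvd 1" using k3 zero_iff[of 1] by simp
        then show False using p(1) by simp
      next
        case False
        then have "(of_nat (k choose 4) :: 'k) = of_nat k" using all[of 4] k4 by simp
        moreover have "4 * (k choose 4) = (k - 3) * (k choose 3)"
          using binomial_absorption[of 3 k] binomial_absorb_comp[of k 3]
          by (simp add: Suc_numeral)
        then have "(of_nat (4 * (k choose 4)) :: 'k) = of_nat (k - 3) * of_nat (k choose 3)" by simp
        ultimately have "(4 :: 'k) * of_nat k = 0" using k3 by simp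
        then have "(2 :: 'k) * 2 * of_nat k = 0" by simp
        then show False using two k0 by (metis mult_eq_0_iff)
      qed
    qed
  qed
qed

text \<open>\<open>ty\<close> carries nothing but the type of the ground field; it lets the
  characteristic be a locale assumption although p and m do not mention \<open>'k\<close>.\<close>

locale zass_ctx =
  fixes p m :: nat and ty :: "'k::field itself"
  assumes prime_p: "prime p" and char_p: "CHAR('k) = p" and p_gt_2: "p > 2" and m_pos: "m > 0"
begin

abbreviation N :: nat where "N \<equiv> p ^ m"
abbreviation A :: "'k dps set" where "A \<equiv> dpA N"

lemma N_ge_3: "N \<ge> 3"
proof -
  have "p ^ 1 \<le> p ^ m" using m_pos p_gt_2 by (intro power_increasing) auto
  then show ?thesis using p_gt_2 by simp
qed

lemma N_facts [simp]: "0 < p" "p \<noteq> 0" "0 < m" "0 < N" "Suc 0 < N" "N \<ge> 1" "2 < N"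
  "\<not> N \<le> Suc 0" "\<not> N \<le> N - Suc 0"
  using N_ge_3 m_pos p_gt_2 by (simp_all del: zero_less_power_eq neq0_conv)

lemma p_pow_gt_1: "r \<ge> 1 \<Longrightarrow> p ^ r > 1"
proof -
  assume "r \<ge> 1"
  then have "p ^ 1 \<le> p ^ r" using p_gt_2 by (intro power_increasing) auto
  then show ?thesis using p_gt_2 by simp
qed

lemma of_nat_eq_0: "(of_nat n :: 'k) = 0 \<longleftrightarrow> p dvd n"
  using char_p by (simp add: of_nat_eq_0_iff_char_dvd)

lemma A_times [simp]: "f \<in> A \<Longrightarrow> g \<in> A \<Longrightarrow> f * g \<in> A"
  using dpA_times[OF prime_p char_p] .

lemma A_br [simp]: "f \<in> A \<Longrightarrow> g \<in> A \<Longrightarrow> br f g \<in> A"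
  by (simp add: br_def)

lemma A_dact [simp]: "f \<in> A \<Longrightarrow> g \<in> A \<Longrightarrow> dact \<mu> f g \<in> A"
  by (simp add: dact_def mult.assoc)

lemma A_1 [simp]: "1 \<in> A" "dpX (Suc 0) \<in> A" "dpX (N - Suc 0) \<in> A" "dpC c \<in> A"
  by (auto simp: dpA_def)

text \<open>
  The pairs for which the operator \<open>dd ^^ k\<close> is a cocycle that is not a coboundary in weight \<open>\<mu>\<close>.
\<close>

definition special :: "'k \<Rightarrow> nat \<Rightarrow> bool" where
  "special \<mu> k \<longleftrightarrow> (k = 1 \<and> \<mu> = 0) \<or> (k = 2 \<and> \<mu> = 1) \<or> (k = 3 \<and> \<mu> = 2) \<or>
     (\<exists>r\<ge>1. k = p ^ r \<and> \<mu> = -1)"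

lemma of_nat_N_minus_1: "(of_nat (N - Suc 0) :: 'k) = -1"
proof -
  have "(of_nat (Suc (N - Suc 0)) :: 'k) = 0" using m_pos by (simp only: of_nat_eq_0) simp
  then have "1 + (of_nat (N - Suc 0) :: 'k) = 0" by (simp only: of_nat_Suc)
  then show ?thesis by (simp add: eq_neg_iff_add_eq_0 add.commute)
qed

text \<open>
  The element \<open>dpX N\<close> is not in \<open>A\<close>, but for \<open>\<mu> = 0\<close> its coboundary takes values in \<open>A\<close>.
\<close>

theorem cocycle_classification:
  fixes \<psi> :: "'k dps \<Rightarrow> 'k dps" and \<mu> :: 'k
  assumes closed: "\<And>f. f \<in> A \<Longrightarrow> \<psi> f \<in> A"
    and add: "\<And>f g. f \<in> A \<Longrightarrow> g \<in> A \<Longrightarrow> \<psi> (f + g) = \<psi> f + \<psi> g"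
    and scal: "\<And>c f. f \<in> A \<Longrightarrow> \<psi> (dpC c * f) = dpC c * \<psi> f"
    and coc: "\<And>f g. f \<in> A \<Longrightarrow> g \<in> A \<Longrightarrow> \<psi> (br f g) = dact \<mu> f (\<psi> g) - dact \<mu> g (\<psi> f)"
  obtains u c a where "u \<in> A" "\<mu> * c = 0" "a 0 = 0"
    "\<And>k. k < N \<Longrightarrow> a k \<noteq> 0 \<Longrightarrow> k \<noteq> 1 \<Longrightarrow> special \<mu> k"
    "\<And>f. f \<in> A \<Longrightarrow> \<psi> f = dact \<mu> f (u + dpC c * dpX N) + (\<Sum>k<N. dpC (a k) * (dd ^^ k) f)"
proof -
  \<comment> \<open>\<open>c\<close> is the obstruction to writing \<psi>(\<partial>) as a
    derivative inside \<open>A\<close>; subtracting c x^(N-1) removes it, and \<open>U\<close>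
    restores it through x^(N).\<close>
  define c where "c = dp_nth (\<psi> 1) (N - 1)"
  obtain u where u: "u \<in> A" "dd u = \<psi> 1 - dpC c * dpX (N - 1)"
  proof (rule dpA_antideriv)
    show "\<psi> 1 - dpC c * dpX (N - 1) \<in> A" by (simp add: closed)
    show "dp_nth (\<psi> 1 - dpC c * dpX (N - 1)) (N - 1) = 0" by (simp add: c_def)
  qed auto
  have ddN: "dd (dpX N :: 'k dps) = dpX (N - 1)" by (simp add: dd_dpX)
  define U where "U = u + dpC c * dpX N"
  have ddU: "dd U = \<psi> 1" by (simp add: U_def u ddN)
  define \<chi> where "\<chi> f = \<psi> f - dact \<mu> f U" for f
  have chi_coc: "\<chi> (br f g) = dact \<mu> f (\<chi> g) - dact \<mu> g (\<chi> f)" if "f \<in> A" "g \<in> A" for f g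
    using that by (simp add: \<chi>_def coc dact_linear dact_br)
  have chi_1: "\<chi> 1 = 0" by (simp add: \<chi>_def dact_linear ddU)
  have chi_dd: "\<chi> (dd g) = dd (\<chi> g)" if "g \<in> A" for g
    using chi_coc[OF A_1(1) that] chi_1 by (simp add: dact_linear br_def)
  \<comment> \<open>\<chi> commutes with \<open>dd\<close> and kills 1, so \<chi>(x) is constant and
    has no coefficient at N. The contributions of \<psi> and of u at N vanish because they lie in
    \<open>A\<close>; what remains is c \<mu>, since x x^(N-1) = N x^(N) = 0.\<close>
  have mu_c: "\<mu> * c = 0"
  proof -
    have "dp_nth (dd (\<chi> (dpX (Suc 0)))) (N - 1) = 0"
      using chi_dd[of "dpX (Suc 0)"] chi_1 by simp
    then have "dp_nth (\<chi> (dpX (Suc 0))) N = 0" by simp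
    moreover have "dp_nth (\<psi> (dpX (Suc 0))) N = 0" "dp_nth (dact \<mu> (dpX (Suc 0)) u) N = 0"
      using closed[of "dpX (Suc 0)"] A_dact[of "dpX (Suc 0)" u \<mu>] u(1) by (simp_all add: dpA_def)
    ultimately have "c * dp_nth (dact \<mu> (dpX (Suc 0)) (dpX N)) N = 0"
      by (simp add: \<chi>_def U_def dact_linear)
    moreover have "dpX (Suc 0) * dpX (N - 1) = (0 :: 'k dps)"
    proof -
      have "(of_nat ((Suc 0 + (N - 1)) choose Suc 0) :: 'k) = of_nat N" by simp
      also have "\<dots> = 0" using m_pos by (simp only: of_nat_eq_0) simp
      finally show ?thesis by (simp only: dpX_mult dpC_simps mult_zero_left)
    qed
    then have "dact \<mu> (dpX (Suc 0)) (dpX N) = dpC \<mu> * (dpX N :: 'k dps)"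
      by (simp add: dact_def ddN)
    ultimately show ?thesis by (simp add: mult.commute)
  qed
  have chi_add: "\<chi> (f + g) = \<chi> f + \<chi> g" if "f \<in> A" "g \<in> A" for f g
    using that by (simp add: \<chi>_def add dact_linear)
  have chi_scal: "\<chi> (dpC c * f) = dpC c * \<chi> f" if "f \<in> A" for c f
    using that by (simp add: \<chi>_def scal dact_linear right_diff_distrib)
  have chi_0: "\<chi> 0 = 0" using chi_scal[of 0 0] by simp
  have chi_closed: "\<chi> f \<in> A" if "f \<in> A" for f
  proof (cases "c = 0")
    case True
    then show ?thesis using that u closed by (simp add: \<chi>_def U_def)
  next
    case False
    then have "\<mu> = 0" using mu_c by simp
    then have "\<chi> f = \<psi> f - dact \<mu> f u - dpC c * (f * dpX (N - 1))"
      by (simp add: \<chi>_def U_def dact_linear) (simp add: dact_def ddN)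
    then show ?thesis using that u closed by simp
  qed
  \<comment> \<open>A linear map commuting with \<open>dd\<close> is determined by the constant
    terms of its values: coefficient n of \<chi>(f) is the constant term of \<chi> at the n-th
    derivative of f. Hence \<chi> is a polynomial in \<open>dd\<close> with coefficients
    \<open>a k\<close>.\<close>
  define a where "a k = dp_nth (\<chi> (dpX k)) 0" for k
  have chi_sum: "\<chi> (\<Sum>i\<in>I. f i) = (\<Sum>i\<in>I. \<chi> (f i))" if "\<And>i. i \<in> I \<Longrightarrow> f i \<in> A" for I :: "nat set" and f
    using that
  proof (induction I rule: infinite_finite_induct)
    case (insert x F)
    then show ?case by (simp add: chi_add dpA_sum)
  qed (auto simp: chi_0)
  have ev: "dp_nth (\<chi> h) 0 = (\<Sum>k<N. dp_nth h k * a k)" if "h \<in> A" for h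
  proof -
    have "\<chi> h = \<chi> (\<Sum>b<N. dpC (dp_nth h b) * dpX b)" using dpA_expand[OF that] by simp
    also have "\<dots> = (\<Sum>b<N. dpC (dp_nth h b) * \<chi> (dpX b))"
      by (subst chi_sum) (auto simp: chi_scal)
    finally show ?thesis by (simp add: a_def)
  qed
  have chi_dd_pow: "\<chi> ((dd ^^ n) f) = (dd ^^ n) (\<chi> f)" if "f \<in> A" for f n
    using that by (induction n) (auto simp: chi_dd)
  have chi_eq: "\<chi> f = (\<Sum>k<N. dpC (a k) * (dd ^^ k) f)" if "f \<in> A" for f
  proof (rule dps_eqI)
    fix n
    have "dp_nth (\<chi> f) n = dp_nth ((dd ^^ n) (\<chi> f)) 0" by simp
    also have "\<dots> = dp_nth (\<chi> ((dd ^^ n) f)) 0" using that by (simp only: chi_dd_pow)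
    also have "\<dots> = (\<Sum>k<N. dp_nth f (n + k) * a k)" using that by (simp add: ev add.commute)
    also have "\<dots> = dp_nth (\<Sum>k<N. dpC (a k) * (dd ^^ k) f) n"
      by (simp add: mult.commute)
    finally show "dp_nth (\<chi> f) n = dp_nth (\<Sum>k<N. dpC (a k) * (dd ^^ k) f) n" .
  qed
  have a0: "a 0 = 0" by (simp add: a_def chi_1)
  \<comment> \<open>Constant terms in the cocycle identity for x^(i) and x^(j): on the right x^(i)
    acts on the constant term only when i = 1, through the summand \<mu> f' g.\<close>
  have rel: "a (i + j - 1) * (of_nat ((i + j - 1) choose i) - of_nat ((i + j - 1) choose (i - 1))) =
      \<mu> * (if i = 1 then a j else 0) - \<mu> * (if j = 1 then a i else 0)"
    if ij: "i \<ge> 1" "j \<ge> 1" "i + j - 1 < N" for i j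
  proof -
    have ijN: "i < N" "j < N" using ij by auto
    obtain i' j' where i': "i = Suc i'" "j = Suc j'" using ij by (metis One_nat_def Suc_le_D)
    have "br (dpX i) (dpX j) = dpC (of_nat ((i + j - 1) choose i) - of_nat ((i + j - 1) choose (i - 1))) *
        (dpX (i + j - 1) :: 'k dps)"
      using binomial_symmetric[of j' "Suc (i' + j')"] unfolding br_def i'
      by (simp add: dpX_mult algebra_simps Suc_diff_le del: binomial_Suc_Suc)
    then have *: "dp_nth (\<chi> (br (dpX i) (dpX j))) 0 =
        a (i + j - 1) * (of_nat ((i + j - 1) choose i) - of_nat ((i + j - 1) choose (i - 1)))"
      using ij by (simp only: chi_scal dpA_simps a_def dp_nth_dpC_times) (simp only: mult.commute)
    have "dp_nth (\<chi> (br (dpX i) (dpX j))) 0 =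
        \<mu> * (if i = 1 then a j else 0) - \<mu> * (if j = 1 then a i else 0)"
      using ijN ij by (subst chi_coc) (auto simp: dact_def a_def i' split: if_splits)
    then show ?thesis using * by simp
  qed
  show ?thesis
  proof (rule that[of u c a, OF u(1) mu_c a0])
    fix k assume k: "k < N" "a k \<noteq> 0" "k \<noteq> 1"
    have k2: "k \<ge> 2" using k a0 by (cases k) auto
    \<comment> \<open>The pair (1, k) is the action of the Euler field x\<partial>; it ties the
      weight to the order of the operator.\<close>
    have "a k * (of_nat k - 1) = \<mu> * a k" using rel[of 1 k] k k2 by simp
    then have mu: "\<mu> = of_nat k - 1" using k(2) by (simp add: mult.commute)
    have "k = 2 \<or> k = 3 \<or> (\<exists>r\<ge>1. k = p ^ r)"
    proof (rule binomials_all_equal[OF prime_p char_p p_gt_2 k2])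
      fix i assume i: "2 \<le> i" "i < k"
      \<comment> \<open>The partner k + 1 - i is chosen so that the bracket is a multiple of x^(k);
        both indices differ from 1, so the right-hand side of \<open>rel\<close> vanishes.\<close>
      have *: "i + (k + 1 - i) - 1 = k" using i by simp
      show "(of_nat (k choose i) :: 'k) = of_nat (k choose (i - 1))"
      proof -
        have "i \<noteq> 1" "k + 1 - i \<noteq> 1" "i \<ge> 1" "k + 1 - i \<ge> 1" using i by auto
        then have "a k * (of_nat (k choose i) - of_nat (k choose (i - 1))) = 0"
          using rel[of i "k + 1 - i", unfolded *] k(1) by simp
        then show ?thesis using k(2) by simp
      qed
    qed
    moreover have "\<mu> = -1" if "r \<ge> 1" "k = p ^ r" for r
    proof -
      have "(of_nat k :: 'k) = 0" using that by (simp add: of_nat_eq_0)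
      then show ?thesis using mu by simp
    qed
    ultimately show "special \<mu> k" using mu unfolding special_def by auto
  next
    fix f assume "f \<in> A"
    then show "\<psi> f = dact \<mu> f (u + dpC c * dpX N) + (\<Sum>k<N. dpC (a k) * (dd ^^ k) f)"
      using chi_eq[of f] by (simp add: \<chi>_def U_def algebra_simps)
  qed
qed

end

section \<open>Vector spaces\<close>

abbreviation vs :: "('k::field, 'v) module \<Rightarrow> bool" where
  "vs M \<equiv> module scalars M"

lemma scalars_simps [simp]:
  "carrier (scalars :: 'k::field ring) = UNIV" "\<one>\<^bsub>scalars :: 'k ring\<^esub> = 1" "\<zero>\<^bsub>scalars :: 'k ring\<^esub> = 0"
  "a \<oplus>\<^bsub>scalars :: 'k ring\<^esub> b = a + b" "a \<otimes>\<^bsub>scalars :: 'k ring\<^esub> b = a * b"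
  by (simp_all add: ring_of_type_algebra_def)

lemma vsI:
  fixes M :: "('k::field, 'v) module"
  assumes "\<And>x y. x \<in> carrier M \<Longrightarrow> y \<in> carrier M \<Longrightarrow> x \<oplus>\<^bsub>M\<^esub> y \<in> carrier M"
    and "\<zero>\<^bsub>M\<^esub> \<in> carrier M"
    and "\<And>c x. x \<in> carrier M \<Longrightarrow> c \<odot>\<^bsub>M\<^esub> x \<in> carrier M"
    and "\<And>x y z. x \<in> carrier M \<Longrightarrow> y \<in> carrier M \<Longrightarrow> z \<in> carrier M \<Longrightarrow>
           (x \<oplus>\<^bsub>M\<^esub> y) \<oplus>\<^bsub>M\<^esub> z = x \<oplus>\<^bsub>M\<^esub> (y \<oplus>\<^bsub>M\<^esub> z)"
    and "\<And>x y. x \<in> carrier M \<Longrightarrow> y \<in> carrier M \<Longrightarrow> x \<oplus>\<^bsub>M\<^esub> y = y \<oplus>\<^bsub>M\<^esub> x"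
    and "\<And>x. x \<in> carrier M \<Longrightarrow> \<zero>\<^bsub>M\<^esub> \<oplus>\<^bsub>M\<^esub> x = x"
    and "\<And>x. x \<in> carrier M \<Longrightarrow> 0 \<odot>\<^bsub>M\<^esub> x = \<zero>\<^bsub>M\<^esub>"
    and "\<And>a b x. x \<in> carrier M \<Longrightarrow> (a + b) \<odot>\<^bsub>M\<^esub> x = a \<odot>\<^bsub>M\<^esub> x \<oplus>\<^bsub>M\<^esub> b \<odot>\<^bsub>M\<^esub> x"
    and "\<And>a x y. x \<in> carrier M \<Longrightarrow> y \<in> carrier M \<Longrightarrow> a \<odot>\<^bsub>M\<^esub> (x \<oplus>\<^bsub>M\<^esub> y) = a \<odot>\<^bsub>M\<^esub> x \<oplus>\<^bsub>M\<^esub> a \<odot>\<^bsub>M\<^esub> y"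
    and "\<And>a b x. x \<in> carrier M \<Longrightarrow> (a * b) \<odot>\<^bsub>M\<^esub> x = a \<odot>\<^bsub>M\<^esub> (b \<odot>\<^bsub>M\<^esub> x)"
    and "\<And>x. x \<in> carrier M \<Longrightarrow> 1 \<odot>\<^bsub>M\<^esub> x = x"
  shows "vs M"
proof (rule moduleI)
  show "cring (scalars :: 'k ring)" by (rule cring_from_type_algebra)
  show "abelian_group M"
  proof (rule abelian_groupI)
    fix x assume x: "x \<in> carrier M"
    have "(-1) \<odot>\<^bsub>M\<^esub> x \<oplus>\<^bsub>M\<^esub> x = (-1) \<odot>\<^bsub>M\<^esub> x \<oplus>\<^bsub>M\<^esub> 1 \<odot>\<^bsub>M\<^esub> x"
      using x assms by simp
    also have "\<dots> = (-1 + 1) \<odot>\<^bsub>M\<^esub> x"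
      using x assms(8)[of x "-1" 1] by simp
    also have "\<dots> = \<zero>\<^bsub>M\<^esub>" using x assms by simp
    finally show "\<exists>y\<in>carrier M. y \<oplus>\<^bsub>M\<^esub> x = \<zero>\<^bsub>M\<^esub>" using x assms by blast
  qed (use assms in auto)
qed (use assms in auto)

lemma vs_zero_closed: "vs (M :: ('k::field, 'v) module) \<Longrightarrow> \<zero>\<^bsub>M\<^esub> \<in> carrier M"
  by (simp add: abelian_monoid.zero_closed abelian_group.axioms(1) module.axioms(2))

lemma vs_simps1:
  assumes "vs (M :: ('k::field, 'v) module)" and "x \<in> carrier M"
  shows vs_smult: "c \<odot>\<^bsub>M\<^esub> x \<in> carrier M"
    and vs_l_zero: "\<zero>\<^bsub>M\<^esub> \<oplus>\<^bsub>M\<^esub> x = x" and vs_r_zero: "x \<oplus>\<^bsub>M\<^esub> \<zero>\<^bsub>M\<^esub> = x"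
    and vs_0: "0 \<odot>\<^bsub>M\<^esub> x = \<zero>\<^bsub>M\<^esub>" and vs_1: "1 \<odot>\<^bsub>M\<^esub> x = x"
    and vs_assoc1: "(a * b) \<odot>\<^bsub>M\<^esub> x = a \<odot>\<^bsub>M\<^esub> (b \<odot>\<^bsub>M\<^esub> x)"
    and vs_l_distr: "(a + b) \<odot>\<^bsub>M\<^esub> x = a \<odot>\<^bsub>M\<^esub> x \<oplus>\<^bsub>M\<^esub> b \<odot>\<^bsub>M\<^esub> x"
    and vs_uminus: "\<ominus>\<^bsub>M\<^esub> x = (-1) \<odot>\<^bsub>M\<^esub> x"
proof -
  interpret module scalars M by fact
  show "c \<odot>\<^bsub>M\<^esub> x \<in> carrier M" "\<zero>\<^bsub>M\<^esub> \<oplus>\<^bsub>M\<^esub> x = x" "x \<oplus>\<^bsub>M\<^esub> \<zero>\<^bsub>M\<^esub> = x"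
    using assms by (simp_all add: M.add.m_comm)
  show "0 \<odot>\<^bsub>M\<^esub> x = \<zero>\<^bsub>M\<^esub>" "1 \<odot>\<^bsub>M\<^esub> x = x"
    using assms smult_l_null[of x] smult_one[of x] by simp_all
  show "(a * b) \<odot>\<^bsub>M\<^esub> x = a \<odot>\<^bsub>M\<^esub> (b \<odot>\<^bsub>M\<^esub> x)"
    "(a + b) \<odot>\<^bsub>M\<^esub> x = a \<odot>\<^bsub>M\<^esub> x \<oplus>\<^bsub>M\<^esub> b \<odot>\<^bsub>M\<^esub> x"
    using assms smult_assoc1[of a b x] smult_l_distr[of a b x] by simp_all
  have "(-1) \<odot>\<^bsub>M\<^esub> x \<oplus>\<^bsub>M\<^esub> x = (-1 + 1) \<odot>\<^bsub>M\<^esub> x"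
    using assms smult_l_distr[of "-1" 1 x] smult_one[of x] by simp
  also have "\<dots> = \<zero>\<^bsub>M\<^esub>" using assms smult_l_null[of x] by simp
  finally show "\<ominus>\<^bsub>M\<^esub> x = (-1) \<odot>\<^bsub>M\<^esub> x"
    using assms by (intro M.minus_equality) (use smult_closed[of "-1" x] in auto)
qed

lemma vs_smult_zero: "vs (M :: ('k::field, 'v) module) \<Longrightarrow> c \<odot>\<^bsub>M\<^esub> \<zero>\<^bsub>M\<^esub> = \<zero>\<^bsub>M\<^esub>"
  by (simp add: module.smult_r_null)

lemma vs_simps2:
  assumes "vs (M :: ('k::field, 'v) module)" and "x \<in> carrier M" "y \<in> carrier M"
  shows vs_add: "x \<oplus>\<^bsub>M\<^esub> y \<in> carrier M"
    and vs_r_distr: "c \<odot>\<^bsub>M\<^esub> (x \<oplus>\<^bsub>M\<^esub> y) = c \<odot>\<^bsub>M\<^esub> x \<oplus>\<^bsub>M\<^esub> c \<odot>\<^bsub>M\<^esub> y"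
    and vs_comm: "x \<oplus>\<^bsub>M\<^esub> y = y \<oplus>\<^bsub>M\<^esub> x"
    and vs_minus: "x \<ominus>\<^bsub>M\<^esub> y = x \<oplus>\<^bsub>M\<^esub> (-1) \<odot>\<^bsub>M\<^esub> y"
    and vs_minus_closed: "x \<ominus>\<^bsub>M\<^esub> y \<in> carrier M"
    and vs_minus_eq_zero: "x \<ominus>\<^bsub>M\<^esub> y = \<zero>\<^bsub>M\<^esub> \<longleftrightarrow> x = y"
proof -
  interpret module scalars M by fact
  show "x \<oplus>\<^bsub>M\<^esub> y \<in> carrier M" "x \<oplus>\<^bsub>M\<^esub> y = y \<oplus>\<^bsub>M\<^esub> x" "x \<ominus>\<^bsub>M\<^esub> y \<in> carrier M"
    "x \<ominus>\<^bsub>M\<^esub> y = \<zero>\<^bsub>M\<^esub> \<longleftrightarrow> x = y"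
    using assms M.add.m_comm[of x y] by (auto simp: M.minus_eq M.r_neg M.minus_equality M.add.inv_equality)
       (metis M.add.inv_closed M.add.inv_equality M.add.inv_inv)
  show "c \<odot>\<^bsub>M\<^esub> (x \<oplus>\<^bsub>M\<^esub> y) = c \<odot>\<^bsub>M\<^esub> x \<oplus>\<^bsub>M\<^esub> c \<odot>\<^bsub>M\<^esub> y"
    using assms smult_r_distr[of c x y] by simp
  show "x \<ominus>\<^bsub>M\<^esub> y = x \<oplus>\<^bsub>M\<^esub> (-1) \<odot>\<^bsub>M\<^esub> y"
    using vs_uminus[OF assms(1,3)] by (simp add: a_minus_def)
qed

lemma vs_assoc:
  assumes "vs (M :: ('k::field, 'v) module)" "x \<in> carrier M" "y \<in> carrier M" "z \<in> carrier M"
  shows "(x \<oplus>\<^bsub>M\<^esub> y) \<oplus>\<^bsub>M\<^esub> z = x \<oplus>\<^bsub>M\<^esub> (y \<oplus>\<^bsub>M\<^esub> z)"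
proof -
  interpret module scalars M by fact
  show ?thesis using assms by (simp add: M.add.m_assoc)
qed

lemma submodule_iff:
  assumes "vs (M :: ('k::field, 'v) module)"
  shows "submodule H scalars M \<longleftrightarrow> H \<subseteq> carrier M \<and> \<zero>\<^bsub>M\<^esub> \<in> H \<and> (\<forall>x\<in>H. \<forall>y\<in>H. x \<oplus>\<^bsub>M\<^esub> y \<in> H) \<and>
    (\<forall>c. \<forall>x\<in>H. c \<odot>\<^bsub>M\<^esub> x \<in> H)" (is "_ \<longleftrightarrow> ?R")
proof -
  interpret module scalars M by fact
  show ?thesis
  proof
    assume s: "submodule H scalars M"
    then interpret submodule H scalars M .
    show ?R using subset one_closed m_closed smult_closed by auto
  next
    assume r: ?R
    have "\<ominus>\<^bsub>M\<^esub> x \<in> H" if "x \<in> H" for x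
      using that r vs_uminus[OF assms, of x] by auto
    then show "submodule H scalars M"
      using r by (intro submoduleI) auto
  qed
qed

lemma submoduleD:
  assumes "submodule H scalars M" "vs (M :: ('k::field, 'v) module)"
  shows "H \<subseteq> carrier M" "\<zero>\<^bsub>M\<^esub> \<in> H" "x \<in> H \<Longrightarrow> y \<in> H \<Longrightarrow> x \<oplus>\<^bsub>M\<^esub> y \<in> H" "x \<in> H \<Longrightarrow> c \<odot>\<^bsub>M\<^esub> x \<in> H"
    "x \<in> H \<Longrightarrow> y \<in> H \<Longrightarrow> x \<ominus>\<^bsub>M\<^esub> y \<in> H"
proof -
  show 1: "H \<subseteq> carrier M" "\<zero>\<^bsub>M\<^esub> \<in> H" "x \<in> H \<Longrightarrow> y \<in> H \<Longrightarrow> x \<oplus>\<^bsub>M\<^esub> y \<in> H" "x \<in> H \<Longrightarrow> c \<odot>\<^bsub>M\<^esub> x \<in> H" for x y c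
    using assms by (auto simp: submodule_iff)
  assume "x \<in> H" "y \<in> H"
  then show "x \<ominus>\<^bsub>M\<^esub> y \<in> H"
    using 1 by (subst vs_minus[OF assms(2)]) auto
qed

lemma lin_span_submodule:
  assumes "vs (M :: ('k::field, 'v) module)" "S \<subseteq> carrier M"
  shows "submodule (lin_span M S) scalars M" "S \<subseteq> lin_span M S"
proof -
  have c: "submodule (carrier M) scalars M"
    using assms(1) by (auto simp: submodule_iff vs_add vs_smult vs_zero_closed)
  show "S \<subseteq> lin_span M S" by (auto simp: lin_span_def)
  show "submodule (lin_span M S) scalars M"
    unfolding submodule_iff[OF assms(1)] lin_span_def
    using c assms by (auto simp: submoduleD submoduleD(1)[THEN subsetD])
qed

lemma lin_span_minimal: "submodule H scalars M \<Longrightarrow> S \<subseteq> H \<Longrightarrow> lin_span M S \<subseteq> H"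
  by (auto simp: lin_span_def)

text \<open>Serves the spaces whose elements are encodings \<open>w x\<close> of divided power
  series: the vector space axioms are transported from \<open>'k dps\<close>.\<close>

lemma vs_image:
  fixes M :: "('k::field, 'v) module" and w :: "'k dps \<Rightarrow> 'v"
  assumes car: "carrier M = w ` S" and S: "0 \<in> S" "\<And>x y. x \<in> S \<Longrightarrow> y \<in> S \<Longrightarrow> x + y \<in> S"
      "\<And>c x. x \<in> S \<Longrightarrow> dpC c * x \<in> S"
    and z: "\<zero>\<^bsub>M\<^esub> = w 0" and a: "\<And>x y. x \<in> S \<Longrightarrow> y \<in> S \<Longrightarrow> w x \<oplus>\<^bsub>M\<^esub> w y = w (x + y)"
    and s: "\<And>c x. x \<in> S \<Longrightarrow> c \<odot>\<^bsub>M\<^esub> w x = w (dpC c * x)"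
  shows "vs M"
  by (rule vsI) (auto simp: car z a s S distrib_left distrib_right mult.assoc add_ac)

locale vs_quot =
  fixes M :: "('k::field, 'v) module" and R :: "'v set"
  assumes vsM: "vs M" and subR: "submodule R scalars M"
begin

abbreviation cs where "cs x \<equiv> R +>\<^bsub>M\<^esub> x"

lemma R_sub: "R \<subseteq> carrier M" using submoduleD[OF subR vsM] by blast

lemma additive_R: "abelian_subgroup R M"
proof (rule abelian_subgroupI3)
  show "additive_subgroup R M"
    using subR by (intro additive_subgroup.intro) (simp add: submodule_def)
  show "abelian_group M" using vsM by (rule module.axioms)
qed

lemma cs_mem_iff: "y \<in> carrier M \<Longrightarrow> x \<in> cs y \<longleftrightarrow> x \<in> carrier M \<and> cs x = cs y"
proof -
  assume y: "y \<in> carrier M"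
  interpret abelian_subgroup R M by (rule additive_R)
  show ?thesis
  proof
    assume x: "x \<in> cs y"
    then have "x \<in> carrier M" using y a_r_coset_subset_G R_sub by blast
    moreover have "cs y = cs x" using a_repr_independence[OF x y] a_subgroup by simp
    ultimately show "x \<in> carrier M \<and> cs x = cs y" by simp
  next
    assume "x \<in> carrier M \<and> cs x = cs y"
    then show "x \<in> cs y" using a_rcos_self by metis
  qed
qed

lemma cs_eq_iff:
  assumes "x \<in> carrier M" "y \<in> carrier M" shows "cs x = cs y \<longleftrightarrow> x \<ominus>\<^bsub>M\<^esub> y \<in> R"
proof -
  interpret abelian_subgroup R M by (rule additive_R)
  show ?thesis
    using assms cs_mem_iff[of y x] a_rcos_module[of y x] by (simp add: a_minus_def)
qed

lemma cs_self: "x \<in> carrier M \<Longrightarrow> x \<in> cs x"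
  by (simp add: cs_mem_iff)

lemma quot_carrier: "carrier (quot_module M R) = cs ` carrier M"
  by (auto simp: quot_module_def FactRing_def A_RCOSETS_def' ring.extend_def module.fields_def)

lemma quot_zero: "\<zero>\<^bsub>quot_module M R\<^esub> = cs \<zero>\<^bsub>M\<^esub>"
proof -
  interpret abelian_subgroup R M by (rule additive_R)
  have "cs \<zero>\<^bsub>M\<^esub> = R"
    using a_coset_join2[of "\<zero>\<^bsub>M\<^esub>"] a_subgroup by simp
  then show ?thesis by (simp add: quot_module_def FactRing_def ring.extend_def module.fields_def)
qed

lemma quot_add: 
  assumes "x \<in> carrier M" "y \<in> carrier M" shows "cs x \<oplus>\<^bsub>quot_module M R\<^esub> cs y = cs (x \<oplus>\<^bsub>M\<^esub> y)"
proof -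
  interpret abelian_subgroup R M by (rule additive_R)
  show ?thesis using assms a_rcos_sum
    by (simp add: quot_module_def FactRing_def ring.extend_def module.fields_def)
qed

lemma quot_smult: 
  assumes "x \<in> carrier M" shows "c \<odot>\<^bsub>quot_module M R\<^esub> cs x = cs (c \<odot>\<^bsub>M\<^esub> x)"
proof -
  have "cs (c \<odot>\<^bsub>M\<^esub> y) = cs (c \<odot>\<^bsub>M\<^esub> x)" if "y \<in> cs x" for y
  proof -
    have y: "y \<in> carrier M" "y \<ominus>\<^bsub>M\<^esub> x \<in> R" using that assms by (auto simp: cs_mem_iff cs_eq_iff)
    then have "c \<odot>\<^bsub>M\<^esub> (y \<ominus>\<^bsub>M\<^esub> x) \<in> R" using submoduleD[OF subR vsM] by auto
    moreover have "c \<odot>\<^bsub>M\<^esub> (y \<ominus>\<^bsub>M\<^esub> x) = c \<odot>\<^bsub>M\<^esub> y \<ominus>\<^bsub>M\<^esub> c \<odot>\<^bsub>M\<^esub> x"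
      using y assms vsM by (simp add: vs_minus vs_smult vs_r_distr vs_assoc1[symmetric])
    ultimately show ?thesis using y assms vsM by (simp add: cs_eq_iff vs_smult)
  qed
  then have "(\<Union>y\<in>cs x. cs (c \<odot>\<^bsub>M\<^esub> y)) = (\<Union>y\<in>cs x. cs (c \<odot>\<^bsub>M\<^esub> x))"
    by (intro SUP_cong refl)
  also have "\<dots> = cs (c \<odot>\<^bsub>M\<^esub> x)"
    using cs_self[OF assms] by blast
  finally show ?thesis
    by (simp add: quot_module_def FactRing_def ring.extend_def module.fields_def)
qed

lemma quot_vs: "vs (quot_module M R)"
proof (rule vsI)
  fix S T assume "S \<in> carrier (quot_module M R)" "T \<in> carrier (quot_module M R)"
  then show "S \<oplus>\<^bsub>quot_module M R\<^esub> T = T \<oplus>\<^bsub>quot_module M R\<^esub> S"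
    by (auto simp only: quot_carrier quot_add image_iff vs_comm[OF vsM])
qed (auto simp: quot_carrier quot_add quot_smult quot_zero vsM vs_add vs_smult vs_zero_closed vs_assoc
       vs_0 vs_1 vs_l_distr vs_r_distr vs_assoc1 vs_l_zero)

end

text \<open>
  Dual bases avoid explicit linear combinations: the functionals \<open>\<kappa> i\<close> separate points and are dual to
  the vectors \<open>z i\<close>.
\<close>

lemma has_dimI:
  fixes M :: "('k::field, 'v) module" and \<kappa> :: "'i \<Rightarrow> 'v \<Rightarrow> 'k"
  assumes vsM: "vs M" and fin: "finite I" and z: "\<And>i. i \<in> I \<Longrightarrow> z i \<in> carrier M"
    and add: "\<And>i x y. i \<in> I \<Longrightarrow> x \<in> carrier M \<Longrightarrow> y \<in> carrier M \<Longrightarrow> \<kappa> i (x \<oplus>\<^bsub>M\<^esub> y) = \<kappa> i x + \<kappa> i y"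
    and smult: "\<And>i c x. i \<in> I \<Longrightarrow> x \<in> carrier M \<Longrightarrow> \<kappa> i (c \<odot>\<^bsub>M\<^esub> x) = c * \<kappa> i x"
    and dual: "\<And>i j. i \<in> I \<Longrightarrow> j \<in> I \<Longrightarrow> \<kappa> i (z j) = (if i = j then 1 else 0)"
    and inj: "\<And>x. x \<in> carrier M \<Longrightarrow> (\<And>i. i \<in> I \<Longrightarrow> \<kappa> i x = 0) \<Longrightarrow> x = \<zero>\<^bsub>M\<^esub>"
  shows "has_dim M (card I)"
proof -
  interpret module scalars M by fact
  have inj_z: "inj_on z I"
  proof (rule inj_onI)
    fix i j assume "i \<in> I" "j \<in> I" "z i = z j"
    then have "(if i = j then 1 else 0 :: 'k) = 1" using dual[of i j] dual[of i i] by simp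
    then show "i = j" by (simp split: if_splits)
  qed
  have k0: "\<kappa> i \<zero>\<^bsub>M\<^esub> = 0" if "i \<in> I" for i
    using smult[of i "\<zero>\<^bsub>M\<^esub>" 0] that smult_r_null[of 0] by simp
  have ksum: "\<kappa> i (\<Oplus>\<^bsub>M\<^esub>b\<in>B. c b \<odot>\<^bsub>M\<^esub> b) = (\<Sum>b\<in>B. c b * \<kappa> i b)"
    if "i \<in> I" "finite B" "B \<subseteq> carrier M" for i c B
    using that(2,3)
  proof (induction B rule: finite_induct)
    case (insert b B)
    have "(\<lambda>b. c b \<odot>\<^bsub>M\<^esub> b) \<in> B \<rightarrow> carrier M" using insert by (auto intro: vs_smult[OF vsM])
    then show ?case using insert that(1) vsM
      by (simp add: add smult vs_smult M.finsum_closed)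
  qed (use k0 that in simp)
  have kz: "\<kappa> i (\<Oplus>\<^bsub>M\<^esub>b\<in>z ` I. c b \<odot>\<^bsub>M\<^esub> b) = c (z i)" if "i \<in> I" for i c
  proof -
    have "\<kappa> i (\<Oplus>\<^bsub>M\<^esub>b\<in>z ` I. c b \<odot>\<^bsub>M\<^esub> b) = (\<Sum>j\<in>I. c (z j) * \<kappa> i (z j))"
      using that z fin by (subst ksum) (auto simp: sum.reindex[OF inj_z])
    also have "\<dots> = (\<Sum>j\<in>I. if j = i then c (z i) else 0)"
      using that by (intro sum.cong) (auto simp: dual)
    finally show ?thesis using that fin by simp
  qed
  have zI: "z ` I \<subseteq> carrier M" using z by auto
  note span = lin_span_submodule[OF vsM zI]
  have "x \<in> lin_span M (z ` I)" if x: "x \<in> carrier M" for x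
  proof -
    \<comment> \<open>\<open>y\<close> is the combination of the vectors \<open>z i\<close> with the
      coordinates of x, so that the difference of x and \<open>y\<close> has all coordinates
      0.\<close>
    define y where "y = (\<Oplus>\<^bsub>M\<^esub>b\<in>z ` I. \<kappa> (the_inv_into I z b) x \<odot>\<^bsub>M\<^esub> b)"
    have yc: "y \<in> carrier M"
      unfolding y_def using zI by (intro M.finsum_closed) (auto intro: vs_smult[OF vsM])
    have "\<kappa> i y = \<kappa> i x" if "i \<in> I" for i
      unfolding y_def using that kz[OF that] inj_z by (simp add: the_inv_into_f_f)
    moreover have "\<kappa> i (x \<oplus>\<^bsub>M\<^esub> (-1) \<odot>\<^bsub>M\<^esub> y) = \<kappa> i x - \<kappa> i y" if "i \<in> I" for i
      using that x yc vsM by (simp add: add smult vs_smult)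
    ultimately have "x \<ominus>\<^bsub>M\<^esub> y = \<zero>\<^bsub>M\<^esub>"
      using x yc vsM by (intro inj) (auto simp: vs_minus vs_add vs_smult)
    then have "x = y" using x yc vsM by (simp add: vs_minus_eq_zero)
    have "(\<Oplus>\<^bsub>M\<^esub>b\<in>B. c b \<odot>\<^bsub>M\<^esub> b) \<in> lin_span M (z ` I)" if "finite B" "B \<subseteq> z ` I" for B c
      using that
    proof (induction B rule: finite_induct)
      case (insert b B)
      have "B \<subseteq> carrier M" using insert zI by auto
      then have "(\<lambda>b. c b \<odot>\<^bsub>M\<^esub> b) \<in> B \<rightarrow> carrier M" by (auto intro!: vs_smult[OF vsM])
      moreover have "b \<in> carrier M" "b \<in> lin_span M (z ` I)" using insert zI span by auto
      ultimately show ?case using insert vsM submoduleD[OF span(1) vsM]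
        by (simp add: vs_smult)
    qed (use submoduleD[OF span(1) vsM] in simp)
    then have "y \<in> lin_span M (z ` I)" unfolding y_def using fin by simp
    then show ?thesis using \<open>x = y\<close> by simp
  qed
  moreover have "lin_span M (z ` I) \<subseteq> carrier M" using submoduleD[OF span(1) vsM] by simp
  ultimately have "lin_span M (z ` I) = carrier M" by auto
  moreover have "\<forall>b\<in>z ` I. c b = 0" if "(\<Oplus>\<^bsub>M\<^esub>b\<in>z ` I. c b \<odot>\<^bsub>M\<^esub> b) = \<zero>\<^bsub>M\<^esub>" for c
    using kz[of _ c] that k0 by auto
  ultimately show ?thesis
    unfolding has_dim_def using zI fin card_image[OF inj_z] by blast
qed

section \<open>Linear maps and endomorphism algebras\<close>

lemma lin_maps_iff:
  "f \<in> lin_maps M N \<longleftrightarrow> f \<in> carrier M \<rightarrow>\<^sub>E carrier N \<and>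
     (\<forall>x\<in>carrier M. \<forall>y\<in>carrier M. f (x \<oplus>\<^bsub>M\<^esub> y) = f x \<oplus>\<^bsub>N\<^esub> f y) \<and>
     (\<forall>c. \<forall>x\<in>carrier M. f (c \<odot>\<^bsub>M\<^esub> x) = c \<odot>\<^bsub>N\<^esub> f x)"
  by (simp add: lin_maps_def)

lemma lin_mapsD:
  assumes "f \<in> lin_maps M N"
  shows "x \<in> carrier M \<Longrightarrow> f x \<in> carrier N"
    "x \<in> carrier M \<Longrightarrow> y \<in> carrier M \<Longrightarrow> f (x \<oplus>\<^bsub>M\<^esub> y) = f x \<oplus>\<^bsub>N\<^esub> f y"
    "x \<in> carrier M \<Longrightarrow> f (c \<odot>\<^bsub>M\<^esub> x) = c \<odot>\<^bsub>N\<^esub> f x" "f \<in> extensional (carrier M)"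
  using assms by (auto simp: lin_maps_def PiE_def)

lemma hom_space_simps [simp]:
  "carrier (hom_space M N) = lin_maps M N" "\<zero>\<^bsub>hom_space M N\<^esub> = (\<lambda>x\<in>carrier M. \<zero>\<^bsub>N\<^esub>)"
  "f \<oplus>\<^bsub>hom_space M N\<^esub> g = (\<lambda>x\<in>carrier M. f x \<oplus>\<^bsub>N\<^esub> g x)"
  "c \<odot>\<^bsub>hom_space M N\<^esub> f = (\<lambda>x\<in>carrier M. c \<odot>\<^bsub>N\<^esub> f x)"
  by (simp_all add: hom_space_def)

lemma End_alg_simps [simp]:
  "carrier (End_alg M) = lin_maps M M" "\<zero>\<^bsub>End_alg M\<^esub> = (\<lambda>x\<in>carrier M. \<zero>\<^bsub>M\<^esub>)"
  "f \<oplus>\<^bsub>End_alg M\<^esub> g = (\<lambda>x\<in>carrier M. f x \<oplus>\<^bsub>M\<^esub> g x)"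
  "c \<odot>\<^bsub>End_alg M\<^esub> f = (\<lambda>x\<in>carrier M. c \<odot>\<^bsub>M\<^esub> f x)"
  "f \<otimes>\<^bsub>End_alg M\<^esub> g = compose (carrier M) f g" "\<one>\<^bsub>End_alg M\<^esub> = (\<lambda>x\<in>carrier M. x)"
  by (simp_all add: End_alg_def)

lemma vs_4_comm:
  assumes "vs (N :: ('k::field, 'v) module)" "a \<in> carrier N" "b \<in> carrier N" "c \<in> carrier N" "d \<in> carrier N"
  shows "(a \<oplus>\<^bsub>N\<^esub> b) \<oplus>\<^bsub>N\<^esub> (c \<oplus>\<^bsub>N\<^esub> d) = (a \<oplus>\<^bsub>N\<^esub> c) \<oplus>\<^bsub>N\<^esub> (b \<oplus>\<^bsub>N\<^esub> d)"
proof -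
  interpret module scalars N by fact
  show ?thesis using assms by (simp add: M.add.m_ac)
qed

lemma hom_space_vs:
  assumes M: "\<And>x y. x \<in> carrier M \<Longrightarrow> y \<in> carrier M \<Longrightarrow> x \<oplus>\<^bsub>M\<^esub> y \<in> carrier M"
    "\<And>c x. x \<in> carrier M \<Longrightarrow> c \<odot>\<^bsub>M\<^esub> x \<in> carrier (M :: ('k::field, 'v) module)"
    and N: "vs (N :: ('k, 'w) module)"
  shows "vs (hom_space M N)"
proof -
  note N' = vs_add[OF N] vs_smult[OF N] vs_zero_closed[OF N]
  have sm: "c \<odot>\<^bsub>N\<^esub> (d \<odot>\<^bsub>N\<^esub> x) = d \<odot>\<^bsub>N\<^esub> (c \<odot>\<^bsub>N\<^esub> x)" if "x \<in> carrier N" for c d x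
    using that by (metis vs_assoc1[OF N] mult.commute)
  show ?thesis
  proof (rule vsI)
    fix f g assume fg: "f \<in> carrier (hom_space M N)" "g \<in> carrier (hom_space M N)"
    then have f: "\<And>x. x \<in> carrier M \<Longrightarrow> f x \<in> carrier N" and g: "\<And>x. x \<in> carrier M \<Longrightarrow> g x \<in> carrier N"
      by (auto dest: lin_mapsD)
    show "f \<oplus>\<^bsub>hom_space M N\<^esub> g = g \<oplus>\<^bsub>hom_space M N\<^esub> f"
      using f g by (auto simp: vs_comm[OF N] intro!: restrict_ext)
    show "f \<oplus>\<^bsub>hom_space M N\<^esub> g \<in> carrier (hom_space M N)"
      using fg f g by (auto simp: lin_maps_iff N' M vs_r_distr[OF N] vs_4_comm[OF N])
    show "c \<odot>\<^bsub>hom_space M N\<^esub> (f \<oplus>\<^bsub>hom_space M N\<^esub> g) =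
        c \<odot>\<^bsub>hom_space M N\<^esub> f \<oplus>\<^bsub>hom_space M N\<^esub> c \<odot>\<^bsub>hom_space M N\<^esub> g" for c
      using f g by (auto simp: vs_r_distr[OF N] intro!: restrict_ext)
    fix h assume "h \<in> carrier (hom_space M N)"
    then have h: "\<And>x. x \<in> carrier M \<Longrightarrow> h x \<in> carrier N" by (auto dest: lin_mapsD)
    show "f \<oplus>\<^bsub>hom_space M N\<^esub> g \<oplus>\<^bsub>hom_space M N\<^esub> h = f \<oplus>\<^bsub>hom_space M N\<^esub> (g \<oplus>\<^bsub>hom_space M N\<^esub> h)"
      using f g h by (auto simp: vs_assoc[OF N] intro!: restrict_ext)
  next
    fix f assume fc: "f \<in> carrier (hom_space M N)"
    then have f: "\<And>x. x \<in> carrier M \<Longrightarrow> f x \<in> carrier N" and fe: "f = restrict f (carrier M)"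
      by (auto simp: lin_maps_iff PiE_def extensional_restrict)
    show "c \<odot>\<^bsub>hom_space M N\<^esub> f \<in> carrier (hom_space M N)" for c
      using fc f by (auto simp: lin_maps_iff N' M vs_r_distr[OF N] intro: sm)
    show "\<zero>\<^bsub>hom_space M N\<^esub> \<oplus>\<^bsub>hom_space M N\<^esub> f = f"
      using f by (subst (2) fe) (auto simp: vs_l_zero[OF N] intro!: restrict_ext)
    show "1 \<odot>\<^bsub>hom_space M N\<^esub> f = f"
      using f by (subst (2) fe) (auto simp: vs_1[OF N] intro!: restrict_ext)
    show "0 \<odot>\<^bsub>hom_space M N\<^esub> f = \<zero>\<^bsub>hom_space M N\<^esub>"
      using f by (auto simp: vs_0[OF N] intro!: restrict_ext)
    show "(a + b) \<odot>\<^bsub>hom_space M N\<^esub> f = a \<odot>\<^bsub>hom_space M N\<^esub> f \<oplus>\<^bsub>hom_space M N\<^esub> b \<odot>\<^bsub>hom_space M N\<^esub> f" for a b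
      using f by (auto simp: vs_l_distr[OF N] intro!: restrict_ext)
    show "(a * b) \<odot>\<^bsub>hom_space M N\<^esub> f = a \<odot>\<^bsub>hom_space M N\<^esub> (b \<odot>\<^bsub>hom_space M N\<^esub> f)" for a b
      using f by (auto simp: vs_assoc1[OF N] intro!: restrict_ext)
  next
    show "\<zero>\<^bsub>hom_space M N\<^esub> \<in> carrier (hom_space M N)"
      by (auto simp: lin_maps_iff N' M vs_l_zero[OF N] vs_smult_zero[OF N])
  qed
qed

lemma End_alg_vs: "vs (M :: ('k::field, 'v) module) \<Longrightarrow> vs (End_alg M)"
proof -
  assume M: "vs M"
  have h: "vs (hom_space M M)" by (rule hom_space_vs) (auto intro: vs_add[OF M] vs_smult[OF M] M)
  show ?thesis
    by (rule vsI, insert vs_simps1[OF h] vs_simps2[OF h] vs_assoc[OF h] vs_zero_closed[OF h]) (simp_all del: restrict_apply)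
qed

section \<open>Free algebras and enveloping algebras\<close>

lemma free_space_simps [simp]:
  "f \<in> carrier (free_space Y) \<longleftrightarrow> finite {x. f x \<noteq> 0} \<and> {x. f x \<noteq> 0} \<subseteq> Y"
  "\<zero>\<^bsub>free_space Y\<^esub> = (\<lambda>_. 0)" "f \<oplus>\<^bsub>free_space Y\<^esub> g = (\<lambda>x. f x + g x)"
  "c \<odot>\<^bsub>free_space Y\<^esub> f = (\<lambda>x. c * f x)"
  by (simp_all add: free_space_def)

lemma free_space_add_closed:
  assumes "finite {x. f x \<noteq> (0 :: 'k::field)}" "finite {x. g x \<noteq> 0}"
  shows "finite {x. f x + g x \<noteq> 0}"
proof -
  have "{x. f x + g x \<noteq> 0} \<subseteq> {x. f x \<noteq> 0} \<union> {x. g x \<noteq> 0}" by auto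
  then show ?thesis using assms finite_subset by blast
qed

lemma free_space_smult_closed:
  assumes "finite {x. f x \<noteq> (0 :: 'k::field)}"
  shows "finite {x. c * f x \<noteq> 0}" "finite {x. c \<noteq> 0 \<and> f x \<noteq> 0}"
proof -
  have "{x. c * f x \<noteq> 0} \<subseteq> {x. f x \<noteq> 0}" by auto
  then show 1: "finite {x. c * f x \<noteq> 0}" using assms finite_subset by blast
  then show "finite {x. c \<noteq> 0 \<and> f x \<noteq> 0}" by simp
qed

lemma free_space_vs: "vs (free_space Y :: ('k::field, 'x \<Rightarrow> 'k) module)"
proof (rule vsI)
  fix f g assume "f \<in> carrier (free_space Y :: ('k, 'x \<Rightarrow> 'k) module)"
    "g \<in> carrier (free_space Y :: ('k, 'x \<Rightarrow> 'k) module)"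
  then show "f \<oplus>\<^bsub>free_space Y\<^esub> g \<in> carrier (free_space Y)"
    by (auto simp: free_space_add_closed) (metis (mono_tags, lifting) add_cancel_right_left mem_Collect_eq subsetD)
qed (auto simp: free_space_smult_closed algebra_simps)

lemma delta_closed: "x \<in> Y \<Longrightarrow> \<delta> x \<in> carrier (free_space Y)"
  by (auto simp: \<delta>_def)

lemma free_space_induct [consumes 1, case_names zero add]:
  assumes f: "f \<in> carrier (free_space Y)" and 0: "P (\<lambda>_. 0)"
    and step: "\<And>f c x. f \<in> carrier (free_space Y) \<Longrightarrow> x \<in> Y \<Longrightarrow> P f \<Longrightarrow> P (\<lambda>y. f y + c * \<delta> x y)"
  shows "P f"
proof -
  have "\<forall>f. {x. f x \<noteq> 0} = S \<longrightarrow> S \<subseteq> Y \<longrightarrow> P f" if "finite S" for S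
    using that
  proof (induction S rule: finite_induct)
    case empty
    show ?case
    proof (intro allI impI)
      fix f :: "'a \<Rightarrow> 'b" assume "{x. f x \<noteq> 0} = {}"
      then have "f = (\<lambda>_. 0)" by auto
      then show "P f" using 0 by (simp only:)
    qed
  next
    case (insert x S)
    show ?case
    proof (intro allI impI)
      fix f :: "'a \<Rightarrow> 'b" assume f: "{x. f x \<noteq> 0} = insert x S" "insert x S \<subseteq> Y"
      define g where "g = (\<lambda>y. if y = x then 0 else f y)"
      have g: "{x. g x \<noteq> 0} = S" using f(1) insert.hyps unfolding g_def by auto
      then have "P g" using insert f by auto
      moreover have "g \<in> carrier (free_space Y)" using g f insert.hyps by auto
      ultimately have "P (\<lambda>y. g y + f x * \<delta> x y)" using step f(2) by blast
      moreover have "(\<lambda>y. g y + f x * \<delta> x y) = f" by (auto simp: g_def \<delta>_def)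
      ultimately show "P f" by simp
    qed
  qed
  then show ?thesis using f by auto
qed

text \<open>Linear extension of \<open>h\<close> from basis symbols to formal combinations.\<close>

definition lext :: "('x \<Rightarrow> 'k::field dps) \<Rightarrow> ('x \<Rightarrow> 'k) \<Rightarrow> 'k dps" where
  "lext h F = (\<Sum>x | F x \<noteq> 0. dpC (F x) * h x)"

lemma lext_superset: "finite S \<Longrightarrow> {x. F x \<noteq> 0} \<subseteq> S \<Longrightarrow> lext h F = (\<Sum>x\<in>S. dpC (F x) * h x)"
  unfolding lext_def by (rule sum.mono_neutral_left) auto

lemma lext_add:
  assumes "finite {x. F x \<noteq> 0}" "finite {x. G x \<noteq> 0}"
  shows "lext h (\<lambda>x. F x + G x) = lext h F + lext h G"
proof -
  let ?S = "{x. F x \<noteq> 0} \<union> {x. G x \<noteq> 0}"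
  have "lext h (\<lambda>x. F x + G x) = (\<Sum>x\<in>?S. dpC (F x + G x) * h x)"
    using assms by (intro lext_superset) auto
  moreover have "lext h F = (\<Sum>x\<in>?S. dpC (F x) * h x)" "lext h G = (\<Sum>x\<in>?S. dpC (G x) * h x)"
    using assms by (auto intro!: lext_superset)
  ultimately show ?thesis by (simp add: sum.distrib distrib_right)
qed

lemma lext_smult:
  assumes "finite {x. F x \<noteq> 0}"
  shows "lext h (\<lambda>x. c * F x) = dpC c * lext h F"
proof -
  have "lext h (\<lambda>x. c * F x) = (\<Sum>x\<in>{x. F x \<noteq> 0}. dpC (c * F x) * h x)"
    using assms by (intro lext_superset) auto
  then show ?thesis by (simp add: lext_def sum_distrib_left mult.assoc)
qed

lemma lext_0 [simp]: "lext h (\<lambda>_. 0) = 0"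
  by (simp add: lext_def)

lemma lext_delta [simp]: "lext h (\<delta> x) = h x"
proof -
  have "lext h (\<delta> x) = (\<Sum>y\<in>{x}. dpC (\<delta> x y) * h y)" by (rule lext_superset) (auto simp: \<delta>_def)
  then show ?thesis by (simp add: \<delta>_def)
qed

lemma lext_fun_add: "lext (\<lambda>x. h x + k x) F = lext h F + lext k F"
  by (simp add: lext_def sum.distrib distrib_left)

lemma lext_fun_smult: "lext (\<lambda>x. dpC c * h x) F = dpC c * lext h F"
  by (simp add: lext_def sum_distrib_left mult.left_commute)

definition conv :: "('x list \<Rightarrow> 'k::field) \<Rightarrow> ('x list \<Rightarrow> 'k) \<Rightarrow> 'x list \<Rightarrow> 'k" where
  "conv f g = (\<lambda>w. \<Sum>i\<le>length w. f (take i w) * g (drop i w))"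

lemma free_alg_simps [simp]:
  "f \<in> carrier (free_alg Y) \<longleftrightarrow> f \<in> carrier (free_space (lists Y))"
  "\<zero>\<^bsub>free_alg Y\<^esub> = (\<lambda>_. 0)" "f \<oplus>\<^bsub>free_alg Y\<^esub> g = (\<lambda>x. f x + g x)"
  "c \<odot>\<^bsub>free_alg Y\<^esub> f = (\<lambda>x. c * f x)" "\<one>\<^bsub>free_alg Y\<^esub> = \<delta> []"
  "f \<otimes>\<^bsub>free_alg Y\<^esub> g = conv f g"
  by (simp_all add: free_alg_def conv_def)

lemma conv_Nil [simp]: "conv f g [] = f [] * g []"
  by (simp add: conv_def)

text \<open>Splitting off the first letter gives a recursion in which only the left factor changes;
  this is why associativity and the right unit law are inductions on the word with the left factor
  arbitrary.\<close>

lemma conv_Cons [simp]: "conv f g (a # w) = f [] * g (a # w) + conv (\<lambda>w. f (a # w)) g w"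
  by (simp add: conv_def sum.atMost_Suc_shift del: sum.atMost_Suc)

lemma conv_bilinear:
  "conv (\<lambda>x. f x + f' x) g = (\<lambda>x. conv f g x + conv f' g x)"
  "conv f (\<lambda>x. g x + g' x) = (\<lambda>x. conv f g x + conv f g' x)"
  "conv (\<lambda>x. c * f x) g = (\<lambda>x. c * conv f g x)"
  "conv f (\<lambda>x. c * g x) = (\<lambda>x. c * conv f g x)"
  "conv (\<lambda>_. 0) g = (\<lambda>_. 0)" "conv f (\<lambda>_. 0) = (\<lambda>_. 0)"
  by (auto simp: conv_def algebra_simps sum.distrib sum_distrib_left)

lemma conv_assoc: "conv (conv f g) h = conv f (conv g h)"
proof
  fix w show "conv (conv f g) h w = conv f (conv g h) w"
    by (induction w arbitrary: f) (simp_all add: conv_bilinear algebra_simps)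
qed

lemma conv_delta_Nil_left:
  fixes g :: "'x list \<Rightarrow> 'k::field"
  shows "conv (\<delta> []) g = g"
proof
  fix w have "(\<lambda>w. \<delta> [] (a # w)) = (\<lambda>_. 0 :: 'k)" for a :: 'x by (auto simp: \<delta>_def)
  then show "conv (\<delta> []) g w = g w" by (cases w) (simp_all add: conv_bilinear, simp_all add: \<delta>_def)
qed

lemma conv_delta_Nil_right: "conv f (\<delta> []) = f"
proof
  fix w show "conv f (\<delta> []) w = f w"
    by (induction w arbitrary: f) (simp_all, simp_all add: \<delta>_def)
qed

lemma conv_delta:
  fixes u v :: "'x list"
  shows "conv (\<delta> u) (\<delta> v) = (\<delta> (u @ v) :: 'x list \<Rightarrow> 'k::field)"
proof (induction u)
  case Nil
  then show ?case by (simp add: conv_delta_Nil_left)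
next
  case (Cons a u)
  show ?case
  proof
    fix w
    show "conv (\<delta> (a # u)) (\<delta> v) w = (\<delta> ((a # u) @ v) w :: 'k)"
    proof (cases w)
      case Nil
      then show ?thesis by (simp add: \<delta>_def)
    next
      case w: (Cons b w')
      have "(\<lambda>w. \<delta> (a # u) (b # w)) = (if a = b then \<delta> u else (\<lambda>_. 0 :: 'k))"
        by (auto simp: \<delta>_def)
      moreover have "\<delta> (a # u @ v) (b # w') = (if a = b then \<delta> (u @ v) w' else (0 :: 'k))"
        by (auto simp: \<delta>_def)
      moreover have "\<delta> (a # u) [] = (0 :: 'k)" by (simp add: \<delta>_def)
      ultimately show ?thesis using w Cons.IH by (auto simp: conv_bilinear)
    qed
  qed
qed

lemma conv_closed:
  assumes "f \<in> carrier (free_space (lists Y))" "g \<in> carrier (free_space (lists Y))"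
  shows "conv f g \<in> carrier (free_space (lists Y))"
proof -
  let ?S = "(\<lambda>(u, v). u @ v) ` ({x. f x \<noteq> 0} \<times> {x. g x \<noteq> 0})"
  have "{w. conv f g w \<noteq> 0} \<subseteq> ?S"
  proof
    fix w assume "w \<in> {w. conv f g w \<noteq> 0}"
    then obtain i where i: "f (take i w) * g (drop i w) \<noteq> 0"
      unfolding conv_def by (auto elim: sum.not_neutral_contains_not_neutral)
    then have "(take i w, drop i w) \<in> {x. f x \<noteq> 0} \<times> {x. g x \<noteq> 0}" by simp
    then show "w \<in> ?S" by (metis (no_types, lifting) append_take_drop_id case_prod_conv image_eqI)
  qed
  moreover have "finite ?S" using assms by auto
  moreover have "?S \<subseteq> lists Y" using assms by (force simp: subset_iff in_lists_conv_set)
  ultimately show ?thesis using finite_subset by (simp, blast)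
qed

lemma free_alg_vs: "vs (free_alg Y :: ('k::field, 'x list \<Rightarrow> 'k) module)"
  by (rule vsI, insert vs_simps1[OF free_space_vs] vs_simps2[OF free_space_vs] 
       vs_assoc[OF free_space_vs] vs_zero_closed[OF free_space_vs])
     (simp_all only: free_alg_simps free_space_simps(2-4), (simp add: algebra_simps)+)

lemma free_alg_ring: "ring (free_alg Y :: ('k::field, 'x list \<Rightarrow> 'k) module)"
proof (rule ringI)
  show "abelian_group (free_alg Y :: ('k, 'x list \<Rightarrow> 'k) module)"
    using free_alg_vs by (rule module.axioms)
  show "Group.monoid (free_alg Y :: ('k, 'x list \<Rightarrow> 'k) module)"
    by (rule monoidI)
      (auto simp only: free_alg_simps conv_assoc conv_delta_Nil_left conv_delta_Nil_right
        intro: conv_closed delta_closed)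
qed (simp_all add: conv_bilinear)

locale lie_env =
  fixes L :: "('k::field, 'l) module"
  assumes vsL: "vs L" and brk: "\<And>x y. x \<in> carrier L \<Longrightarrow> y \<in> carrier L \<Longrightarrow> x \<otimes>\<^bsub>L\<^esub> y \<in> carrier L"
begin

abbreviation T :: "('k, 'l list \<Rightarrow> 'k) module" where "T \<equiv> free_alg (carrier L)"
abbreviation U where "U \<equiv> env_alg L"
abbreviation J where "J \<equiv> env_ideal L"

definition env_rels :: "('l list \<Rightarrow> 'k) set" where
  "env_rels = {\<delta> [x \<oplus>\<^bsub>L\<^esub> y] \<ominus>\<^bsub>T\<^esub> (\<delta> [x] \<oplus>\<^bsub>T\<^esub> \<delta> [y]) | x y. x \<in> carrier L \<and> y \<in> carrier L}
    \<union> {\<delta> [c \<odot>\<^bsub>L\<^esub> x] \<ominus>\<^bsub>T\<^esub> (c \<odot>\<^bsub>T\<^esub> \<delta> [x]) | c x. x \<in> carrier L}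
    \<union> {(\<delta> [x] \<otimes>\<^bsub>T\<^esub> \<delta> [y] \<ominus>\<^bsub>T\<^esub> \<delta> [y] \<otimes>\<^bsub>T\<^esub> \<delta> [x]) \<ominus>\<^bsub>T\<^esub> \<delta> [x \<otimes>\<^bsub>L\<^esub> y] | x y.
         x \<in> carrier L \<and> y \<in> carrier L}"

lemma env_ideal_eq: "J = Idl\<^bsub>T\<^esub> env_rels"
  by (simp only: env_ideal_def env_rels_def Let_def)

lemma delta_T: "w \<in> lists (carrier L) \<Longrightarrow> \<delta> w \<in> carrier T"
  using delta_closed[of w "lists (carrier L)"] by (simp del: free_space_simps)

lemma T_mult_closed: "F \<in> carrier T \<Longrightarrow> G \<in> carrier T \<Longrightarrow> F \<otimes>\<^bsub>T\<^esub> G \<in> carrier T"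
  using conv_closed by (simp del: free_space_simps)

lemma env_rels_subset: "env_rels \<subseteq> carrier T"
  unfolding env_rels_def
  by (auto intro!: vs_minus_closed[OF free_alg_vs] vs_add[OF free_alg_vs] vs_smult[OF free_alg_vs]
      delta_T T_mult_closed vs_add[OF vsL] vs_smult[OF vsL] brk simp del: free_space_simps free_alg_simps)

lemma J_ideal: "ideal J T"
  unfolding env_ideal_eq by (rule ring.genideal_ideal[OF free_alg_ring env_rels_subset])

lemma J_submodule: "submodule J scalars T"
proof -
  interpret ideal J T by (rule J_ideal)
  have "c \<odot>\<^bsub>T\<^esub> F \<in> J" if "F \<in> J" for c F
  proof -
    \<comment> \<open>A ring ideal is closed under scalars because multiplication by c is left
      multiplication by c times the empty word.\<close>
    have "c \<odot>\<^bsub>T\<^esub> \<delta> [] \<in> carrier T" by (intro vs_smult[OF free_alg_vs] delta_T) simp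
    then have "(c \<odot>\<^bsub>T\<^esub> \<delta> []) \<otimes>\<^bsub>T\<^esub> F \<in> J" using that I_l_closed by blast
    then show ?thesis by (simp add: conv_bilinear conv_delta_Nil_left)
  qed
  moreover have "J \<subseteq> carrier T" using a_subset .
  moreover have "\<zero>\<^bsub>T\<^esub> \<in> J" "\<And>x y. x \<in> J \<Longrightarrow> y \<in> J \<Longrightarrow> x \<oplus>\<^bsub>T\<^esub> y \<in> J"
    using additive_subgroup.zero_closed additive_subgroup.a_closed is_additive_subgroup by blast+
  ultimately show ?thesis unfolding submodule_iff[OF free_alg_vs] by blast
qed

sublocale q: vs_quot T J
  by (intro vs_quot.intro free_alg_vs J_submodule)

abbreviation ecs where "ecs F \<equiv> J +>\<^bsub>T\<^esub> F"

lemma U_quot: "U = quot_module T J" by (simp add: env_alg_def)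

lemma U_vs: "vs U" unfolding U_quot by (rule q.quot_vs)

lemma U_carrier: "carrier U = ecs ` carrier T" unfolding U_quot by (rule q.quot_carrier)

lemma U_mult: "F \<in> carrier T \<Longrightarrow> G \<in> carrier T \<Longrightarrow> ecs F \<otimes>\<^bsub>U\<^esub> ecs G = ecs (F \<otimes>\<^bsub>T\<^esub> G)"
  using ideal.rcoset_mult_add[OF J_ideal]
  by (simp add: env_alg_def quot_module_def FactRing_def ring.extend_def module.fields_def)

lemma U_one: "\<one>\<^bsub>U\<^esub> = ecs (\<delta> [])"
  by (simp add: env_alg_def quot_module_def FactRing_def ring.extend_def module.fields_def)

lemma U_add: "F \<in> carrier T \<Longrightarrow> G \<in> carrier T \<Longrightarrow> ecs F \<oplus>\<^bsub>U\<^esub> ecs G = ecs (F \<oplus>\<^bsub>T\<^esub> G)"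
  unfolding U_quot by (rule q.quot_add)

lemma U_smult: "F \<in> carrier T \<Longrightarrow> c \<odot>\<^bsub>U\<^esub> ecs F = ecs (c \<odot>\<^bsub>T\<^esub> F)"
  unfolding U_quot by (rule q.quot_smult)

lemma U_mult_closed: "u \<in> carrier U \<Longrightarrow> v \<in> carrier U \<Longrightarrow> u \<otimes>\<^bsub>U\<^esub> v \<in> carrier U"
  by (auto simp only: U_carrier U_mult intro: T_mult_closed)

lemma U_one_closed: "\<one>\<^bsub>U\<^esub> \<in> carrier U"
  unfolding U_one U_carrier by (intro imageI delta_T) simp

lemma U_cases:
  assumes "u \<in> carrier U" obtains F where "F \<in> carrier T" "u = ecs F"
  using assms by (auto simp only: U_carrier)

lemma U_assoc: 
  assumes "u \<in> carrier U" "v \<in> carrier U" "w \<in> carrier U"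
  shows "(u \<otimes>\<^bsub>U\<^esub> v) \<otimes>\<^bsub>U\<^esub> w = u \<otimes>\<^bsub>U\<^esub> (v \<otimes>\<^bsub>U\<^esub> w)"
proof -
  obtain F G H where *: "F \<in> carrier T" "u = ecs F" "G \<in> carrier T" "v = ecs G" "H \<in> carrier T" "w = ecs H"
    using assms by (metis U_cases)
  have "(F \<otimes>\<^bsub>T\<^esub> G) \<otimes>\<^bsub>T\<^esub> H = F \<otimes>\<^bsub>T\<^esub> (G \<otimes>\<^bsub>T\<^esub> H)" by (simp add: conv_assoc)
  then show ?thesis using * by (simp only: U_mult T_mult_closed)
qed

lemma U_one_mult: 
  assumes "u \<in> carrier U"
  shows "\<one>\<^bsub>U\<^esub> \<otimes>\<^bsub>U\<^esub> u = u" "u \<otimes>\<^bsub>U\<^esub> \<one>\<^bsub>U\<^esub> = u"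
proof -
  obtain F where *: "F \<in> carrier T" "u = ecs F" using assms by (rule U_cases)
  have "\<delta> [] \<in> carrier T" by (rule delta_T) simp
  moreover have "\<delta> [] \<otimes>\<^bsub>T\<^esub> F = F" "F \<otimes>\<^bsub>T\<^esub> \<delta> [] = F" by (simp_all add: conv_delta_Nil_left conv_delta_Nil_right)
  ultimately show "\<one>\<^bsub>U\<^esub> \<otimes>\<^bsub>U\<^esub> u = u" "u \<otimes>\<^bsub>U\<^esub> \<one>\<^bsub>U\<^esub> = u"
    using *(1) unfolding U_one *(2) by (simp_all only: U_mult)
qed

lemma U_distr:
  assumes "u \<in> carrier U" "v \<in> carrier U" "w \<in> carrier U"
  shows "u \<otimes>\<^bsub>U\<^esub> (v \<oplus>\<^bsub>U\<^esub> w) = u \<otimes>\<^bsub>U\<^esub> v \<oplus>\<^bsub>U\<^esub> u \<otimes>\<^bsub>U\<^esub> w"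
    "(v \<oplus>\<^bsub>U\<^esub> w) \<otimes>\<^bsub>U\<^esub> u = v \<otimes>\<^bsub>U\<^esub> u \<oplus>\<^bsub>U\<^esub> w \<otimes>\<^bsub>U\<^esub> u"
    "u \<otimes>\<^bsub>U\<^esub> (c \<odot>\<^bsub>U\<^esub> v) = c \<odot>\<^bsub>U\<^esub> (u \<otimes>\<^bsub>U\<^esub> v)" "(c \<odot>\<^bsub>U\<^esub> v) \<otimes>\<^bsub>U\<^esub> u = c \<odot>\<^bsub>U\<^esub> (v \<otimes>\<^bsub>U\<^esub> u)"
proof -
  obtain F G H where *: "F \<in> carrier T" "u = ecs F" "G \<in> carrier T" "v = ecs G" "H \<in> carrier T" "w = ecs H"
    using assms by (metis U_cases)
  have "F \<otimes>\<^bsub>T\<^esub> (G \<oplus>\<^bsub>T\<^esub> H) = F \<otimes>\<^bsub>T\<^esub> G \<oplus>\<^bsub>T\<^esub> F \<otimes>\<^bsub>T\<^esub> H"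
    "(G \<oplus>\<^bsub>T\<^esub> H) \<otimes>\<^bsub>T\<^esub> F = G \<otimes>\<^bsub>T\<^esub> F \<oplus>\<^bsub>T\<^esub> H \<otimes>\<^bsub>T\<^esub> F"
    "F \<otimes>\<^bsub>T\<^esub> (c \<odot>\<^bsub>T\<^esub> G) = c \<odot>\<^bsub>T\<^esub> (F \<otimes>\<^bsub>T\<^esub> G)" "(c \<odot>\<^bsub>T\<^esub> G) \<otimes>\<^bsub>T\<^esub> F = c \<odot>\<^bsub>T\<^esub> (G \<otimes>\<^bsub>T\<^esub> F)"
    by (simp_all add: conv_bilinear)
  then show "u \<otimes>\<^bsub>U\<^esub> (v \<oplus>\<^bsub>U\<^esub> w) = u \<otimes>\<^bsub>U\<^esub> v \<oplus>\<^bsub>U\<^esub> u \<otimes>\<^bsub>U\<^esub> w"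
    "(v \<oplus>\<^bsub>U\<^esub> w) \<otimes>\<^bsub>U\<^esub> u = v \<otimes>\<^bsub>U\<^esub> u \<oplus>\<^bsub>U\<^esub> w \<otimes>\<^bsub>U\<^esub> u"
    "u \<otimes>\<^bsub>U\<^esub> (c \<odot>\<^bsub>U\<^esub> v) = c \<odot>\<^bsub>U\<^esub> (u \<otimes>\<^bsub>U\<^esub> v)" "(c \<odot>\<^bsub>U\<^esub> v) \<otimes>\<^bsub>U\<^esub> u = c \<odot>\<^bsub>U\<^esub> (v \<otimes>\<^bsub>U\<^esub> u)"
    using *(1,3,5) unfolding *(2,4,6)
    by (simp_all only: U_mult U_add U_smult T_mult_closed vs_add[OF free_alg_vs] vs_smult[OF free_alg_vs])
qed

lemma env_in_eq: "env_in L x = ecs (\<delta> [x])"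
  by (simp add: env_in_def)

lemma env_in_closed: "x \<in> carrier L \<Longrightarrow> env_in L x \<in> carrier U"
  unfolding env_in_eq U_carrier by (intro imageI delta_T) simp

lemma rel_J: "F \<in> env_rels \<Longrightarrow> F \<in> J"
  using env_rels_subset ring.genideal_self[OF free_alg_ring, of env_rels "carrier L"] unfolding env_ideal_eq by auto

lemma env_in_add:
  assumes "x \<in> carrier L" "y \<in> carrier L"
  shows "env_in L (x \<oplus>\<^bsub>L\<^esub> y) = env_in L x \<oplus>\<^bsub>U\<^esub> env_in L y"
proof -
  have d: "\<delta> [x] \<in> carrier T" "\<delta> [y] \<in> carrier T" "\<delta> [x \<oplus>\<^bsub>L\<^esub> y] \<in> carrier T" 
    using assms vs_add[OF vsL] by (auto intro!: delta_T simp del: free_alg_simps)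
  have "\<delta> [x \<oplus>\<^bsub>L\<^esub> y] \<ominus>\<^bsub>T\<^esub> (\<delta> [x] \<oplus>\<^bsub>T\<^esub> \<delta> [y]) \<in> J"
    using assms by (intro rel_J) (unfold env_rels_def, blast)
  then show ?thesis using d
    by (simp only: env_in_eq U_add q.cs_eq_iff vs_add[OF free_alg_vs])
qed

lemma env_in_smult:
  assumes "x \<in> carrier L"
  shows "env_in L (c \<odot>\<^bsub>L\<^esub> x) = c \<odot>\<^bsub>U\<^esub> env_in L x"
proof -
  have d: "\<delta> [x] \<in> carrier T" "\<delta> [c \<odot>\<^bsub>L\<^esub> x] \<in> carrier T" 
    using assms vs_smult[OF vsL] by (auto intro!: delta_T simp del: free_alg_simps)
  have "\<delta> [c \<odot>\<^bsub>L\<^esub> x] \<ominus>\<^bsub>T\<^esub> (c \<odot>\<^bsub>T\<^esub> \<delta> [x]) \<in> J"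
    using assms by (intro rel_J) (unfold env_rels_def, blast)
  then show ?thesis using d
    by (simp only: env_in_eq U_smult q.cs_eq_iff vs_smult[OF free_alg_vs])
qed

lemma env_in_bracket:
  assumes "x \<in> carrier L" "y \<in> carrier L"
  shows "env_in L (x \<otimes>\<^bsub>L\<^esub> y) = env_in L x \<otimes>\<^bsub>U\<^esub> env_in L y \<oplus>\<^bsub>U\<^esub> (-1) \<odot>\<^bsub>U\<^esub> (env_in L y \<otimes>\<^bsub>U\<^esub> env_in L x)"
proof -
  have d: "\<delta> [x] \<in> carrier T" "\<delta> [y] \<in> carrier T" "\<delta> [x \<otimes>\<^bsub>L\<^esub> y] \<in> carrier T" 
    using assms brk by (auto intro!: delta_T simp del: free_alg_simps)
  note m = T_mult_closed[OF d(1,2)] T_mult_closed[OF d(2,1)]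
  have "(\<delta> [x] \<otimes>\<^bsub>T\<^esub> \<delta> [y] \<ominus>\<^bsub>T\<^esub> \<delta> [y] \<otimes>\<^bsub>T\<^esub> \<delta> [x]) \<ominus>\<^bsub>T\<^esub> \<delta> [x \<otimes>\<^bsub>L\<^esub> y] \<in> J"
    using assms by (intro rel_J) (unfold env_rels_def, blast)
  then have "ecs (\<delta> [x \<otimes>\<^bsub>L\<^esub> y]) = ecs (\<delta> [x] \<otimes>\<^bsub>T\<^esub> \<delta> [y] \<ominus>\<^bsub>T\<^esub> \<delta> [y] \<otimes>\<^bsub>T\<^esub> \<delta> [x])"
    using d m by (subst eq_commute) (simp only: q.cs_eq_iff vs_minus_closed[OF free_alg_vs])
  then show ?thesis using d m
    by (simp only: env_in_eq U_mult U_smult U_add vs_minus[OF free_alg_vs] vs_smult[OF free_alg_vs])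
qed

text \<open>Classes of words span the enveloping algebra, and words grow by left multiplication with
  a letter. This is the form suited to left modules, where the step is the action of one Lie algebra
  element.\<close>

lemma env_induct [consumes 1, case_names one add smult mult]:
  assumes u: "u \<in> carrier U" and "P \<one>\<^bsub>U\<^esub>"
    and "\<And>u v. u \<in> carrier U \<Longrightarrow> v \<in> carrier U \<Longrightarrow> P u \<Longrightarrow> P v \<Longrightarrow> P (u \<oplus>\<^bsub>U\<^esub> v)"
    and "\<And>c u. u \<in> carrier U \<Longrightarrow> P u \<Longrightarrow> P (c \<odot>\<^bsub>U\<^esub> u)"
    and "\<And>x u. x \<in> carrier L \<Longrightarrow> u \<in> carrier U \<Longrightarrow> P u \<Longrightarrow> P (env_in L x \<otimes>\<^bsub>U\<^esub> u)"
  shows "P u"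
proof -
  have word: "P (ecs (\<delta> w))" if "w \<in> lists (carrier L)" for w
    using that
  proof (induction w rule: lists.induct)
    case Nil
    then show ?case using assms(2) by (simp add: U_one)
  next
    case (Cons x w)
    have d: "\<delta> [x] \<in> carrier T" "\<delta> w \<in> carrier T" using Cons by (auto intro!: delta_T simp del: free_alg_simps)
    have "P (env_in L x \<otimes>\<^bsub>U\<^esub> ecs (\<delta> w))" using Cons d by (intro assms(5)) (auto simp only: U_carrier)
    then show ?case using d by (simp only: env_in_eq U_mult) (simp add: conv_delta)
  qed
  obtain F where F: "F \<in> carrier T" "u = ecs F" using u by (auto simp only: U_carrier)
  have "F \<in> carrier (free_space (lists (carrier L)))" using F(1) by simp
  then have "P (ecs F)"
  proof (induction F rule: free_space_induct)
    case zero
    have "P (0 \<odot>\<^bsub>U\<^esub> \<one>\<^bsub>U\<^esub>)" using assms(2,4) U_one_closed by blast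
    moreover have "0 \<odot>\<^bsub>U\<^esub> \<one>\<^bsub>U\<^esub> = ecs (0 \<odot>\<^bsub>T\<^esub> \<delta> [])"
      unfolding U_one by (rule U_smult) (rule delta_T, simp)
    ultimately show ?case by simp
  next
    case (add F c w)
    have d: "F \<in> carrier T" "\<delta> w \<in> carrier T" using add delta_T by (simp_all del: free_space_simps)
    then have "P (ecs F \<oplus>\<^bsub>U\<^esub> (c \<odot>\<^bsub>U\<^esub> ecs (\<delta> w)))"
      using add word by (intro assms(3,4) vs_smult[OF U_vs]) (auto simp only: U_carrier)
    then show ?case using d 
      by (simp only: U_add U_smult vs_smult[OF free_alg_vs]) simp
  qed
  then show ?thesis using F by simp
qed

end

section \<open>Action of the enveloping algebra on divided power series\<close>

definition word_act :: "('l \<Rightarrow> 'k::field dps \<Rightarrow> 'k dps) \<Rightarrow> 'l list \<Rightarrow> 'k dps \<Rightarrow> 'k dps" where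
  "word_act \<rho> w g = foldr \<rho> w g"

definition free_act :: "('l \<Rightarrow> 'k::field dps \<Rightarrow> 'k dps) \<Rightarrow> ('l list \<Rightarrow> 'k) \<Rightarrow> 'k dps \<Rightarrow> 'k dps" where
  "free_act \<rho> F g = lext (\<lambda>w. word_act \<rho> w g) F"

text \<open>A class acts through a chosen representative in the free algebra;
  \<open>ract_ecs\<close> shows independence of the choice.\<close>

definition env_act :: "('k, 'l) module \<Rightarrow> ('l \<Rightarrow> 'k::field dps \<Rightarrow> 'k dps) \<Rightarrow> ('l list \<Rightarrow> 'k) set \<Rightarrow> 'k dps \<Rightarrow> 'k dps" where
  "env_act L \<rho> u g = free_act \<rho> (SOME F. F \<in> carrier (free_alg (carrier L) :: ('k, _) module) \<and> u = env_ideal L +>\<^bsub>free_alg (carrier L) :: ('k, _) module\<^esub> F) g"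

text \<open>The representation space is all of \<open>'k dps\<close>; that \<open>A\<close> is
  stable under the actions of interest is a separate fact, so no closedness conditions enter
  here.\<close>

locale lie_rep = lie_env L for L :: "('k::field, 'l) module" +
  fixes \<rho> :: "'l \<Rightarrow> 'k dps \<Rightarrow> 'k dps"
  assumes rho_add: "\<And>x g h. x \<in> carrier L \<Longrightarrow> \<rho> x (g + h) = \<rho> x g + \<rho> x h"
    and rho_smult: "\<And>x c g. x \<in> carrier L \<Longrightarrow> \<rho> x (dpC c * g) = dpC c * \<rho> x g"
    and rho_L_add: "\<And>x y g. x \<in> carrier L \<Longrightarrow> y \<in> carrier L \<Longrightarrow> \<rho> (x \<oplus>\<^bsub>L\<^esub> y) g = \<rho> x g + \<rho> y g"
    and rho_L_smult: "\<And>x c g. x \<in> carrier L \<Longrightarrow> \<rho> (c \<odot>\<^bsub>L\<^esub> x) g = dpC c * \<rho> x g"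
    and rho_bracket: "\<And>x y g. x \<in> carrier L \<Longrightarrow> y \<in> carrier L \<Longrightarrow>
          \<rho> (x \<otimes>\<^bsub>L\<^esub> y) g = \<rho> x (\<rho> y g) - \<rho> y (\<rho> x g)"
begin

lemma word_act_add: "w \<in> lists (carrier L) \<Longrightarrow> word_act \<rho> w (g + h) = word_act \<rho> w g + word_act \<rho> w h"
  unfolding word_act_def by (induction w rule: lists.induct) (auto simp: rho_add)

lemma word_act_smult: "w \<in> lists (carrier L) \<Longrightarrow> word_act \<rho> w (dpC c * g) = dpC c * word_act \<rho> w g"
  unfolding word_act_def by (induction w rule: lists.induct) (auto simp: rho_smult)

lemma word_act_0: "w \<in> lists (carrier L) \<Longrightarrow> word_act \<rho> w 0 = 0"
  using word_act_smult[of w 0 0] by simp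

lemma free_act_add:
  assumes "F \<in> carrier T" "G \<in> carrier T"
  shows "free_act \<rho> (F \<oplus>\<^bsub>T\<^esub> G) g = free_act \<rho> F g + free_act \<rho> G g"
  using assms by (simp add: free_act_def lext_add)

lemma free_act_smult:
  assumes "F \<in> carrier T"
  shows "free_act \<rho> (c \<odot>\<^bsub>T\<^esub> F) g = dpC c * free_act \<rho> F g"
  using assms by (simp add: free_act_def lext_smult)

lemmas free_act_F = free_act_add free_act_smult

lemma free_act_minus:
  assumes "F \<in> carrier T" "G \<in> carrier T"
  shows "free_act \<rho> (F \<ominus>\<^bsub>T\<^esub> G) g = free_act \<rho> F g - free_act \<rho> G g"
proof -
  have "free_act \<rho> (F \<ominus>\<^bsub>T\<^esub> G) g = free_act \<rho> F g + dpC (-1) * free_act \<rho> G g"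
    using assms by (simp only: free_act_F vs_minus[OF free_alg_vs] vs_smult[OF free_alg_vs])
  then show ?thesis by simp
qed

lemma free_act_g:
  assumes F: "F \<in> carrier T"
  shows "free_act \<rho> F (g + h) = free_act \<rho> F g + free_act \<rho> F h"
    and "free_act \<rho> F (dpC c * g) = dpC c * free_act \<rho> F g"
proof -
  have w: "w \<in> lists (carrier L)" if "F w \<noteq> 0" for w using F that by (simp add: subset_iff)
  have "lext (\<lambda>w. word_act \<rho> w (g + h)) F = lext (\<lambda>w. word_act \<rho> w g + word_act \<rho> w h) F"
    unfolding lext_def by (intro sum.cong refl) (use w in \<open>simp add: word_act_add\<close>)
  then show "free_act \<rho> F (g + h) = free_act \<rho> F g + free_act \<rho> F h"
    by (simp add: free_act_def lext_fun_add)
  have "lext (\<lambda>w. word_act \<rho> w (dpC c * g)) F = lext (\<lambda>w. dpC c * word_act \<rho> w g) F"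
    unfolding lext_def by (intro sum.cong refl) (use w in \<open>simp add: word_act_smult\<close>)
  then show "free_act \<rho> F (dpC c * g) = dpC c * free_act \<rho> F g"
    by (simp add: free_act_def lext_fun_smult)
qed

lemma free_act_delta [simp]: "free_act \<rho> (\<delta> w) g = word_act \<rho> w g"
  by (simp add: free_act_def)

lemma free_act_zero [simp]: "free_act \<rho> (\<lambda>_. 0) g = 0"
  by (simp add: free_act_def)

lemma free_act_mult:
  assumes F: "F \<in> carrier T" and G: "G \<in> carrier T"
  shows "free_act \<rho> (F \<otimes>\<^bsub>T\<^esub> G) g = free_act \<rho> F (free_act \<rho> G g)"
proof -
  have d: "free_act \<rho> (\<delta> u \<otimes>\<^bsub>T\<^esub> G) g = free_act \<rho> (\<delta> u) (free_act \<rho> G g)" if u: "u \<in> lists (carrier L)" for u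
  proof -
    have "G \<in> carrier (free_space (lists (carrier L)))" using G by simp
    then show ?thesis
    proof (induction G rule: free_space_induct)
      case zero
      show ?case using u by (simp add: conv_bilinear word_act_0)
    next
      case (add G c v)
      have c: "G \<in> carrier T" "\<delta> v \<in> carrier T" "\<delta> u \<in> carrier T" using add u delta_T by (simp_all del: free_space_simps)
      have "free_act \<rho> (\<delta> u \<otimes>\<^bsub>T\<^esub> (G \<oplus>\<^bsub>T\<^esub> c \<odot>\<^bsub>T\<^esub> \<delta> v)) g =
          free_act \<rho> ((\<delta> u \<otimes>\<^bsub>T\<^esub> G) \<oplus>\<^bsub>T\<^esub> (c \<odot>\<^bsub>T\<^esub> (\<delta> u \<otimes>\<^bsub>T\<^esub> \<delta> v))) g"
        by (simp add: conv_bilinear)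
      also have "\<dots> = free_act \<rho> (\<delta> u \<otimes>\<^bsub>T\<^esub> G) g + dpC c * free_act \<rho> (\<delta> u \<otimes>\<^bsub>T\<^esub> \<delta> v) g"
        using c by (simp only: free_act_F T_mult_closed vs_smult[OF free_alg_vs])
      also have "free_act \<rho> (\<delta> u \<otimes>\<^bsub>T\<^esub> \<delta> v) g = free_act \<rho> (\<delta> u) (free_act \<rho> (\<delta> v) g)"
        by (simp add: conv_delta) (simp add: word_act_def)
      also have "free_act \<rho> (\<delta> u \<otimes>\<^bsub>T\<^esub> G) g = free_act \<rho> (\<delta> u) (free_act \<rho> G g)" by (rule add)
      also have "free_act \<rho> (\<delta> u) (free_act \<rho> G g) + dpC c * free_act \<rho> (\<delta> u) (free_act \<rho> (\<delta> v) g) =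
         free_act \<rho> (\<delta> u) (free_act \<rho> (G \<oplus>\<^bsub>T\<^esub> c \<odot>\<^bsub>T\<^esub> \<delta> v) g)"
        using c by (simp only: free_act_F free_act_g vs_smult[OF free_alg_vs])
      finally show ?case by simp
    qed
  qed
  have "F \<in> carrier (free_space (lists (carrier L)))" using F by simp
  then show ?thesis
  proof (induction F rule: free_space_induct)
    case (add F c u)
    have c: "F \<in> carrier T" "\<delta> u \<in> carrier T" using add delta_T by (simp_all del: free_space_simps)
    have "free_act \<rho> ((F \<oplus>\<^bsub>T\<^esub> c \<odot>\<^bsub>T\<^esub> \<delta> u) \<otimes>\<^bsub>T\<^esub> G) g =
        free_act \<rho> ((F \<otimes>\<^bsub>T\<^esub> G) \<oplus>\<^bsub>T\<^esub> (c \<odot>\<^bsub>T\<^esub> (\<delta> u \<otimes>\<^bsub>T\<^esub> G))) g"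
      by (simp add: conv_bilinear)
    also have "\<dots> = free_act \<rho> (F \<otimes>\<^bsub>T\<^esub> G) g + dpC c * free_act \<rho> (\<delta> u \<otimes>\<^bsub>T\<^esub> G) g"
      using c G by (simp only: free_act_F T_mult_closed vs_smult[OF free_alg_vs])
    also have "\<dots> = free_act \<rho> F (free_act \<rho> G g) + dpC c * free_act \<rho> (\<delta> u) (free_act \<rho> G g)"
      using add d by (simp only:)
    also have "\<dots> = free_act \<rho> (F \<oplus>\<^bsub>T\<^esub> c \<odot>\<^bsub>T\<^esub> \<delta> u) (free_act \<rho> G g)"
      using c by (simp only: free_act_F vs_smult[OF free_alg_vs])
    finally show ?case by simp
  qed (simp add: conv_bilinear)
qed

lemma free_act_0: "F \<in> carrier T \<Longrightarrow> free_act \<rho> F 0 = 0"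
  using free_act_g(2)[of F 0 0] by simp

text \<open>The elements of the free algebra that act as zero form a two-sided ideal, and it
  contains the defining relations.\<close>

lemma free_act_J: "F \<in> J \<Longrightarrow> free_act \<rho> F g = 0"
proof -
  let ?K = "{F \<in> carrier T. \<forall>g. free_act \<rho> F g = 0}"
  have "ideal ?K T"
  proof (rule idealI)
    show "ring T" by (rule free_alg_ring)
    have sm: "submodule ?K scalars T"
      unfolding submodule_iff[OF free_alg_vs]
      using vs_add[OF free_alg_vs] vs_smult[OF free_alg_vs] vs_zero_closed[OF free_alg_vs]
      by (auto simp only: free_act_F mem_Collect_eq) (auto simp: conv_bilinear)
    then show "subgroup ?K (add_monoid T)" by (simp only: submodule_def)
    fix F G assume "F \<in> ?K" "G \<in> carrier T"
    then show "G \<otimes>\<^bsub>T\<^esub> F \<in> ?K" "F \<otimes>\<^bsub>T\<^esub> G \<in> ?K"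
      by (auto simp only: mem_Collect_eq free_act_mult free_act_0 T_mult_closed)
  qed
  moreover have "env_rels \<subseteq> ?K"
  proof
    fix F assume F: "F \<in> env_rels"
    then have "F \<in> carrier T" using env_rels_subset by blast
    moreover have "free_act \<rho> F g = 0" for g
      using F unfolding env_rels_def
      by (elim UnE CollectE exE conjE)
        (simp_all only: free_act_minus free_act_F free_act_mult delta_T T_mult_closed lists.intros
          vs_add[OF free_alg_vs] vs_smult[OF free_alg_vs] vs_add[OF vsL] vs_smult[OF vsL] brk
          vs_minus_closed[OF free_alg_vs] free_act_delta,
         simp_all add: word_act_def rho_L_add rho_L_smult rho_bracket)
    ultimately show "F \<in> ?K" by blast
  qed
  ultimately have "J \<subseteq> ?K" unfolding env_ideal_eq genideal_def by blast
  then show "F \<in> J \<Longrightarrow> free_act \<rho> F g = 0" by auto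
qed

abbreviation ract where "ract \<equiv> env_act L \<rho>"

lemma ract_ecs: "F \<in> carrier T \<Longrightarrow> ract (ecs F) g = free_act \<rho> F g"
proof -
  assume F: "F \<in> carrier T"
  define G where "G = (SOME G. G \<in> carrier T \<and> ecs F = ecs G)"
  have G: "G \<in> carrier T" "ecs F = ecs G"
    using someI[of "\<lambda>G. G \<in> carrier T \<and> ecs F = ecs G" F] F unfolding G_def by blast+
  then have "F \<ominus>\<^bsub>T\<^esub> G \<in> J" using F by (simp only: q.cs_eq_iff)
  then have "free_act \<rho> F g = free_act \<rho> G g"
    using free_act_J[of "F \<ominus>\<^bsub>T\<^esub> G" g] free_act_minus[OF F G(1)] by simp
  then show ?thesis by (simp only: env_act_def G_def)
qed

lemma ract_simps:
  assumes "u \<in> carrier U" "v \<in> carrier U"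
  shows ract_add: "ract (u \<oplus>\<^bsub>U\<^esub> v) g = ract u g + ract v g"
    and ract_mult: "ract (u \<otimes>\<^bsub>U\<^esub> v) g = ract u (ract v g)"
    and ract_smult: "ract (c \<odot>\<^bsub>U\<^esub> u) g = dpC c * ract u g"
    and ract_g_add: "ract u (g + h) = ract u g + ract u h"
    and ract_g_smult: "ract u (dpC c * g) = dpC c * ract u g"
proof -
  obtain F G where *: "F \<in> carrier T" "u = ecs F" "G \<in> carrier T" "v = ecs G"
    using assms by (metis U_cases)
  show "ract (u \<oplus>\<^bsub>U\<^esub> v) g = ract u g + ract v g" "ract (u \<otimes>\<^bsub>U\<^esub> v) g = ract u (ract v g)"
    "ract (c \<odot>\<^bsub>U\<^esub> u) g = dpC c * ract u g" "ract u (g + h) = ract u g + ract u h"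
    "ract u (dpC c * g) = dpC c * ract u g"
    using *(1,3) unfolding *(2,4)
    by (simp_all only: U_mult U_add U_smult ract_ecs free_act_F free_act_g free_act_mult T_mult_closed
       vs_add[OF free_alg_vs] vs_smult[OF free_alg_vs])
qed

lemma ract_one: "ract \<one>\<^bsub>U\<^esub> g = g"
proof -
  have "\<delta> [] \<in> carrier T" by (rule delta_T) simp
  then show ?thesis unfolding U_one by (simp only: ract_ecs free_act_delta) (simp add: word_act_def)
qed

lemma ract_in: "x \<in> carrier L \<Longrightarrow> ract (env_in L x) g = \<rho> x g"
proof -
  assume "x \<in> carrier L"
  then have "\<delta> [x] \<in> carrier T" by (intro delta_T) simp
  then show ?thesis unfolding env_in_eq by (simp only: ract_ecs free_act_delta) (simp add: word_act_def)
qed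

end

section \<open>The Zassenhaus algebra\<close>

lemma nat_pow_0' [simp]: "x [^]\<^bsub>G\<^esub> (0::nat) = \<one>\<^bsub>G\<^esub>"
  and nat_pow_Suc' [simp]: "x [^]\<^bsub>G\<^esub> (Suc n) = x [^]\<^bsub>G\<^esub> n \<otimes>\<^bsub>G\<^esub> x"
  by (simp_all add: nat_pow_def)

lemma br_simps:
  "br f (g + h) = br f g + br f h" "br (f + g) h = br f h + br g h"
  "br f (dpC c * g) = dpC c * br f g" "br (dpC c * f) g = dpC c * br f g"
  "br f (- g) = - br f g" "br (- f) g = - br f g"
  "br f (g - h) = br f g - br f h" "br (f - g) h = br f h - br g h"
  "br f 0 = 0" "br 0 f = 0" "br 1 f = dd f"
  by (simp_all add: br_def algebra_simps)

lemma br_commute: "br f g = - br g f"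
  by (simp add: br_def algebra_simps)

lemma br_jacobi: "br f (br g h) = br (br f g) h + br g (br f h)"
  by (simp add: br_def algebra_simps)

lemma divpow_mem: "f \<in> carrier (divpow p m) \<longleftrightarrow> (\<forall>a\<ge>p ^ m. f a = 0)"
  by (simp add: divpow_def)

lemma divpow_simps:
  "\<zero>\<^bsub>divpow p m\<^esub> = (\<lambda>_. 0)" "f \<oplus>\<^bsub>divpow p m\<^esub> g = (\<lambda>n. f n + g n)"
  "c \<odot>\<^bsub>divpow p m\<^esub> f = (\<lambda>n. c * f n)"
  by (simp_all add: divpow_def)

definition wv :: "nat \<Rightarrow> nat \<Rightarrow> 'k::field dps \<Rightarrow> (nat \<Rightarrow> 'k) \<Rightarrow> nat \<Rightarrow> 'k" where
  "wv p m f = dp_vect p m (dp_nth f)"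

text \<open>The coefficient function of a vector field f\<partial> is its value on the coordinate
  x^(1).\<close>

definition winv :: "((nat \<Rightarrow> 'k::field) \<Rightarrow> nat \<Rightarrow> 'k) \<Rightarrow> 'k dps" where
  "winv y = Dp (y (dp_nth (dpX (Suc 0))))"

text \<open>The exponent r = 0 is left out because \<partial> already lies in W(m), and r \<ge> m
  because \<partial>^N vanishes on \<open>A\<close>.\<close>

definition rdd :: "nat \<Rightarrow> nat \<Rightarrow> (nat \<Rightarrow> 'k::field) \<Rightarrow> 'k dps \<Rightarrow> 'k dps" where
  "rdd p m c g = (\<Sum>r\<in>{1..<m}. dpC (c r) * (dd ^^ (p ^ r)) g)"

definition kop :: "nat \<Rightarrow> nat \<Rightarrow> (nat \<Rightarrow> 'k::field) \<Rightarrow> 'k dps \<Rightarrow> 'k dps \<Rightarrow> 'k dps" where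
  "kop p m c f g = rdd p m c g + br f g"

text \<open>
  \<open>kap p m c f\<close> is the derivation of \<open>W(m)\<close> induced by the bracket with the vector field \<open>f\<partial>\<close> plus the
  sum of the \<open>c r \<partial>\<^sup>q\<close> with \<open>q = p ^ r\<close> and \<open>1 \<le> r < m\<close>; only these values of \<open>c\<close> matter.
\<close>

definition kap :: "nat \<Rightarrow> nat \<Rightarrow> (nat \<Rightarrow> 'k::field) \<Rightarrow> 'k dps \<Rightarrow> ((nat \<Rightarrow> 'k) \<Rightarrow> nat \<Rightarrow> 'k) \<Rightarrow> (nat \<Rightarrow> 'k) \<Rightarrow> nat \<Rightarrow> 'k" where
  "kap p m c f = (\<lambda>y\<in>carrier (zass p m). wv p m (kop p m c f (winv y)))"

lemma rdd_linear:
  "rdd p m c (g + h) = rdd p m c g + rdd p m c h" "rdd p m c (g - h) = rdd p m c g - rdd p m c h"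
  "rdd p m c (dpC a * g) = dpC a * rdd p m c g" "rdd p m (\<lambda>_. 0) g = 0" "rdd p m c 0 = 0"
  "rdd p m (\<lambda>r. c r + d r) g = rdd p m c g + rdd p m d g"
  "rdd p m (\<lambda>r. a * c r) g = dpC a * rdd p m c g"
  "rdd p m c (dd g) = dd (rdd p m c g)"
  by (simp_all add: rdd_def sum.distrib sum_subtractf sum_distrib_left dd_dd_pow distrib_left distrib_right
      right_diff_distrib mult.left_commute mult.assoc)

lemma dd_pow_commute: "(dd ^^ i) ((dd ^^ j) g) = (dd ^^ j) ((dd ^^ i) g)"
  by (rule dps_eqI) (simp add: add_ac)

lemma rdd_commute: "rdd p m c (rdd p m d g) = rdd p m d (rdd p m c g)"
proof -
  have "rdd p m c (rdd p m d g) = (\<Sum>r\<in>{1..<m}. \<Sum>s\<in>{1..<m}. dpC (c r) * (dpC (d s) * (dd ^^ (p ^ r)) ((dd ^^ (p ^ s)) g)))"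
    by (simp add: rdd_def sum_distrib_left)
  also have "\<dots> = (\<Sum>s\<in>{1..<m}. \<Sum>r\<in>{1..<m}. dpC (d s) * (dpC (c r) * (dd ^^ (p ^ s)) ((dd ^^ (p ^ r)) g)))"
    by (subst sum.swap) (simp add: dd_pow_commute[of "p ^ _" "p ^ _"] mult.left_commute)
  also have "\<dots> = rdd p m d (rdd p m c g)"
    by (simp add: rdd_def sum_distrib_left)
  finally show ?thesis .
qed

lemma kop_linear:
  "kop p m c f (g + h) = kop p m c f g + kop p m c f h"
  "kop p m c f (dpC a * g) = dpC a * kop p m c f g"
  "kop p m (\<lambda>r. c r + d r) (f + g) h = kop p m c f h + kop p m d g h"
  "kop p m (\<lambda>r. a * c r) (dpC a * f) h = dpC a * kop p m c f h"
  "kop p m (\<lambda>_. 0) f g = br f g" "kop p m (\<lambda>_. 0) 0 g = 0" "kop p m c 0 g = rdd p m c g"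
  by (simp_all add: kop_def rdd_linear br_simps distrib_left add_ac)

context zass_ctx
begin

abbreviation DP :: "('k, nat \<Rightarrow> 'k) module" where "DP \<equiv> divpow p m"
abbreviation W :: "('k, (nat \<Rightarrow> 'k) \<Rightarrow> nat \<Rightarrow> 'k) module" where "W \<equiv> zass p m"
abbreviation RD :: "(nat \<Rightarrow> 'k) \<Rightarrow> 'k dps \<Rightarrow> 'k dps" where "RD \<equiv> rdd p m"
abbreviation KO :: "(nat \<Rightarrow> 'k) \<Rightarrow> 'k dps \<Rightarrow> 'k dps \<Rightarrow> 'k dps" where "KO \<equiv> kop p m"
abbreviation KA where "KA \<equiv> kap p m :: (nat \<Rightarrow> 'k) \<Rightarrow> _"
abbreviation V :: "'k dps \<Rightarrow> (nat \<Rightarrow> 'k) \<Rightarrow> nat \<Rightarrow> 'k" where "V \<equiv> wv p m"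

lemma RD_times: "RD c (f * g) = RD c f * g + f * RD c g"
  by (simp add: rdd_def dd_pow_prime_pow_times[OF prime_p char_p] sum_distrib_left sum_distrib_right
      sum.distrib algebra_simps)

lemma RD_br: "RD c (br f g) = br (RD c f) g + br f (RD c g)"
  by (simp add: br_def rdd_linear RD_times)

lemma RD_1 [simp]: "RD c 1 = 0" "RD c (dpC a) = 0" "RD c (dpX (Suc 0)) = 0"
proof -
  have "(dd ^^ (p ^ r)) (dpC a) = 0" "(dd ^^ (p ^ r)) (dpX (Suc 0) :: 'k dps) = 0" if "r \<ge> 1" for r and a :: 'k
  proof -
    have "p ^ r > 1" using that by (rule p_pow_gt_1)
    then show "(dd ^^ (p ^ r)) (dpC a) = 0" "(dd ^^ (p ^ r)) (dpX (Suc 0) :: 'k dps) = 0"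
      by (auto intro!: dps_eqI)
  qed
  then show a: "RD c (dpC a) = 0" "RD c (dpX (Suc 0)) = 0" for a by (auto simp: rdd_def intro!: sum.neutral)
  show "RD c 1 = 0" using a(1)[of 1] by simp
qed

lemma RD_dact: "RD c (dact \<mu> f g) = dact \<mu> (RD c f) g + dact \<mu> f (RD c g)"
  by (simp add: dact_def rdd_linear RD_times distrib_left distrib_right add_ac mult.assoc)

lemma A_RD [simp]: "g \<in> A \<Longrightarrow> RD c g \<in> A"
  by (auto simp: rdd_def intro!: dpA_sum)

lemma A_KO [simp]: "f \<in> A \<Longrightarrow> g \<in> A \<Longrightarrow> KO c f g \<in> A"
  by (simp add: kop_def)

lemma KO_br: "KO c f (br g h) = br (KO c f g) h + br g (KO c f h)"
  by (simp add: kop_def RD_br br_simps br_jacobi[of f g h])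

text \<open>The powers of \<partial> commute with each other and act on vector fields by
  derivations, so a commutator has no component outside W(m). This makes W(m) an ideal containing
  all brackets.\<close>

lemma KO_commutator:
  "KO c f (KO d g h) - KO d g (KO c f h) = KO (\<lambda>_. 0) (RD c g - RD d f + br f g) h"
  by (simp add: kop_def rdd_linear RD_br br_simps rdd_commute[of p m c d] br_jacobi[of f g h] algebra_simps)

lemma DP_carrier: "carrier DP = dp_nth ` A"
proof -
  have "f \<in> dp_nth ` A" if "f \<in> carrier DP" for f
    using that by (intro image_eqI[of _ _ "Dp f"]) (auto simp: divpow_mem dpA_def)
  then show ?thesis by (auto simp: divpow_mem dpA_def)
qed

lemma DP_nth: "f \<in> A \<Longrightarrow> dp_nth f \<in> carrier DP"
  by (simp add: DP_carrier)

lemma DP_vs: "vs DP"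
  by (rule vs_image[where w = dp_nth and S = A]) (auto simp: DP_carrier divpow_simps)

text \<open>In degrees at least N the truncated product is 0 by definition, and the untruncated one
  because \<open>A\<close> is closed under products.\<close>

lemma DP_mult:
  assumes "f \<in> A" "g \<in> A" shows "dp_nth f \<otimes>\<^bsub>DP\<^esub> dp_nth g = dp_nth (f * g)"
proof
  fix n
  have "f * g \<in> A" using assms by simp
  then have "n \<ge> N \<Longrightarrow> dp_nth (f * g) n = 0" by (simp add: dpA_def)
  then show "(dp_nth f \<otimes>\<^bsub>DP\<^esub> dp_nth g) n = dp_nth (f * g) n"
    by (simp add: divpow_def dp_nth_times)
qed

lemma wv_apply: "f \<in> A \<Longrightarrow> h \<in> A \<Longrightarrow> V f (dp_nth h) = dp_nth (f * dd h)"
proof -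
  assume f: "f \<in> A" "h \<in> A"
  have "dp_deriv p m (dp_nth h) = dp_nth (dd h)"
    using f by (auto simp: dp_deriv_def DP_nth)
  then show ?thesis using f by (simp add: wv_def dp_vect_def DP_nth DP_mult)
qed

lemma wv_ext: "V f \<in> extensional (carrier DP)"
  by (simp add: wv_def dp_vect_def)

lemma DP_ext: "x \<in> extensional (carrier DP) \<Longrightarrow> y \<in> extensional (carrier DP) \<Longrightarrow>
    (\<And>h. h \<in> A \<Longrightarrow> x (dp_nth h) = y (dp_nth h)) \<Longrightarrow> x = y"
  by (rule extensionalityI[of _ "carrier DP"]) (auto simp: DP_carrier)

lemma winv_wv [simp]: "f \<in> A \<Longrightarrow> winv (V f) = f"
  by (simp add: winv_def wv_apply dp_nth_inverse)

lemma wv_inj: "f \<in> A \<Longrightarrow> g \<in> A \<Longrightarrow> V f = V g \<longleftrightarrow> f = g"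
  by (metis winv_wv)

lemma wv_lin: "f \<in> A \<Longrightarrow> V f \<in> lin_maps DP DP"
proof -
  assume f: "f \<in> A"
  have *: "(\<lambda>n. dp_nth g n + dp_nth h n) = dp_nth (g + h)" "(\<lambda>n. c * dp_nth g n) = dp_nth (dpC c * g)" for g h :: "'k dps" and c
    by auto
  show ?thesis unfolding lin_maps_iff PiE_def
    using f wv_ext by (auto simp: DP_carrier wv_apply divpow_simps * distrib_left mult.left_commute)
qed

lemma W_carrier: "carrier W = V ` A"
  by (simp add: zass_def DP_carrier image_image wv_def)

lemma W_V [simp]: "f \<in> A \<Longrightarrow> V f \<in> carrier W"
  by (simp add: W_carrier)

lemma W_zero: "\<zero>\<^bsub>W\<^esub> = V 0"
proof -
  have "(\<lambda>x\<in>carrier DP. \<zero>\<^bsub>DP\<^esub>) = V 0"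
    by (rule DP_ext) (auto simp: wv_ext wv_apply divpow_simps DP_nth)
  then show ?thesis by (simp add: zass_def lie_of_def)
qed

lemma W_add: "f \<in> A \<Longrightarrow> g \<in> A \<Longrightarrow> V f \<oplus>\<^bsub>W\<^esub> V g = V (f + g)"
  unfolding zass_def lie_of_def
  by (simp, rule DP_ext) (auto simp: wv_ext wv_apply divpow_simps DP_nth distrib_right)

lemma W_smult: "f \<in> A \<Longrightarrow> c \<odot>\<^bsub>W\<^esub> V f = V (dpC c * f)"
  unfolding zass_def lie_of_def
  by (simp, rule DP_ext) (auto simp: wv_ext wv_apply divpow_simps DP_nth mult.assoc)

lemma compose_lin:
  assumes "vs (M :: ('k, 'v) module)" and f: "f \<in> lin_maps M M" and g: "g \<in> lin_maps M M"
  shows "compose (carrier M) f g \<in> lin_maps M M"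
  unfolding lin_maps_iff PiE_def
  using assms(1) by (auto simp: compose_def lin_mapsD[OF f] lin_mapsD[OF g] vs_add vs_smult)

lemma End_bracket:
  assumes "vs (M :: ('k, 'v) module)" "f \<in> lin_maps M M" "g \<in> lin_maps M M"
  shows "f \<otimes>\<^bsub>lie_of (End_alg M)\<^esub> g = (\<lambda>x\<in>carrier M. f (g x) \<oplus>\<^bsub>M\<^esub> (-1) \<odot>\<^bsub>M\<^esub> g (f x))"
proof -
  note c = compose_lin[OF assms(1,2,3)] compose_lin[OF assms(1,3,2)]
  have "f \<otimes>\<^bsub>lie_of (End_alg M)\<^esub> g = f \<otimes>\<^bsub>End_alg M\<^esub> g \<ominus>\<^bsub>End_alg M\<^esub> g \<otimes>\<^bsub>End_alg M\<^esub> f"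
    by (simp add: lie_of_def)
  also have "\<dots> = f \<otimes>\<^bsub>End_alg M\<^esub> g \<oplus>\<^bsub>End_alg M\<^esub> (-1) \<odot>\<^bsub>End_alg M\<^esub> (g \<otimes>\<^bsub>End_alg M\<^esub> f)"
    using c by (intro vs_minus[OF End_alg_vs[OF assms(1)]]) simp_all
  finally show ?thesis by (auto simp: compose_def intro!: restrict_ext)
qed

lemma W_mult: assumes "f \<in> A" "g \<in> A" shows "V f \<otimes>\<^bsub>W\<^esub> V g = V (br f g)"
proof -
  have "V f \<otimes>\<^bsub>W\<^esub> V g = (\<lambda>x\<in>carrier DP. V f (V g x) \<oplus>\<^bsub>DP\<^esub> (-1) \<odot>\<^bsub>DP\<^esub> V g (V f x))"
    using assms End_bracket[OF DP_vs wv_lin wv_lin] by (simp add: zass_def)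
  also have "\<dots> = V (br f g)"
    using assms by (intro DP_ext) (auto simp: wv_ext wv_apply divpow_simps DP_nth br_def algebra_simps)
  finally show ?thesis .
qed

lemma W_vs: "vs W"
  by (rule vs_image[where w = V and S = A]) (auto simp: W_carrier W_zero W_add W_smult)

sublocale W: lie_env W
  by (intro lie_env.intro W_vs) (auto simp: W_carrier W_mult)

lemma W_rep: "lie_rep W (\<lambda>y g. dact \<mu> (winv y) g)"
  by (intro lie_rep.intro W.lie_env_axioms lie_rep_axioms.intro)
     (auto simp: W_carrier W_add W_smult W_mult dact_linear dact_br)

lemma zass_e_eq: "zass_e p m i = V (dpX (nat (i + 1)))"
proof -
  have "\<delta> n = dp_nth (dpX n :: 'k dps)" for n by (auto simp: \<delta>_def)
  then show ?thesis by (simp add: zass_e_def wv_def)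
qed

section \<open>The restricted Zassenhaus algebra\<close>

lemma W_ext: "x \<in> extensional (carrier W) \<Longrightarrow> y \<in> extensional (carrier W) \<Longrightarrow>
    (\<And>h. h \<in> A \<Longrightarrow> x (V h) = y (V h)) \<Longrightarrow> x = y"
  by (rule extensionalityI[of _ "carrier W"]) (auto simp: W_carrier)

lemma KA_apply [simp]: "g \<in> A \<Longrightarrow> KA c f (V g) = V (KO c f g)"
  by (simp add: kap_def)

lemma KA_ext [simp]: "KA c f \<in> extensional (carrier W)"
  by (simp add: kap_def)

lemma KA_lin: "f \<in> A \<Longrightarrow> KA c f \<in> lin_maps W W"
  unfolding lin_maps_iff PiE_def using KA_ext[of c f]
  by (auto simp: W_carrier W_add W_smult kop_linear)

lemma ad_eq: "f \<in> A \<Longrightarrow> ad W (V f) = KA (\<lambda>_. 0) f"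
  by (rule W_ext) (auto simp: ad_def W_mult kop_linear)

lemma KA_add: "f \<in> A \<Longrightarrow> g \<in> A \<Longrightarrow> KA c f \<oplus>\<^bsub>End_alg W\<^esub> KA d g = KA (\<lambda>r. c r + d r) (f + g)"
  by (simp, rule W_ext) (auto simp: W_add kop_linear)

lemma KA_smult: "f \<in> A \<Longrightarrow> a \<odot>\<^bsub>End_alg W\<^esub> KA c f = KA (\<lambda>r. a * c r) (dpC a * f)"
  by (simp, rule W_ext) (auto simp: W_smult kop_linear)

lemma KA_zero: "\<zero>\<^bsub>End_alg W\<^esub> = KA (\<lambda>_. 0) 0"
  by (simp, rule W_ext) (auto simp: W_zero kop_linear br_simps)

lemma KA_bracket:
  assumes "f \<in> A" "g \<in> A"
  shows "KA c f \<otimes>\<^bsub>lie_of (End_alg W)\<^esub> KA d g = KA (\<lambda>_. 0) (RD c g - RD d f + br f g)"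
  unfolding End_bracket[OF W_vs KA_lin[OF assms(1)] KA_lin[OF assms(2)]]
  using assms by (intro W_ext) (auto simp: W_add W_smult KO_commutator[symmetric])

lemma End_pow_ext: "x \<in> extensional (carrier M) \<Longrightarrow> x [^]\<^bsub>End_alg M\<^esub> (n::nat) \<in> extensional (carrier M)"
  by (cases n) (auto simp: compose_def)

lemma End_pow_apply:
  assumes "\<And>g. g \<in> A \<Longrightarrow> x (V g) = V (F g)" "\<And>g. g \<in> A \<Longrightarrow> F g \<in> A"
  shows "g \<in> A \<Longrightarrow> (x [^]\<^bsub>End_alg W\<^esub> n) (V g) = V ((F ^^ n) g)"
  by (induction n arbitrary: g) (auto simp: compose_def assms funpow_swap1)

text \<open>In weight -1 the exponents other than 1 are powers of p: -1 differs from 0 and 1 as p is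
  odd, and the exponent 3 needs 2 = -1, that is p = 3, when 3 is a power of p as well.\<close>

lemma special_sum:
  fixes a :: "nat \<Rightarrow> 'k"
  assumes a0: "a 0 = 0" and sp: "\<And>k. k < N \<Longrightarrow> a k \<noteq> 0 \<Longrightarrow> k \<noteq> 1 \<Longrightarrow> special (-1) k"
  shows "(\<Sum>k<N. dpC (a k) * (dd ^^ k) f) = dpC (a 1) * dd f + RD (\<lambda>r. a (p ^ r)) f"
proof -
  let ?t = "\<lambda>k. dpC (a k) * (dd ^^ k) f"
  let ?P = "(\<lambda>r. p ^ r) ` {1..<m}"
  have lt: "p ^ r < N \<longleftrightarrow> r < m" for r using p_gt_2 by simp
  have pw: "k \<in> ?P" if "k < N" "a k \<noteq> 0" "k \<noteq> 1" for k
  proof -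
    have two: "(2::'k) \<noteq> 0" using of_nat_eq_0[of 2] p_gt_2 by (auto dest: dvd_imp_le)
    have n1: "(-1 :: 'k) \<noteq> 0" "(-1 :: 'k) \<noteq> 1" using two by auto
    have "\<exists>r\<ge>1. k = p ^ r"
      using sp[OF that] unfolding special_def
    proof (elim disjE conjE)
      assume k: "k = 3" "- 1 = (2 :: 'k)"
      then have "(3 :: 'k) = 0" by (simp add: eq_neg_iff_add_eq_0[symmetric] neg_eq_iff_add_eq_0)
      then have "p dvd 3" using of_nat_eq_0[of 3] by simp
      then have "p \<le> 3" by (auto dest: dvd_imp_le)
      then have "p = 3" using p_gt_2 by simp
      then show ?thesis using k by (intro exI[of _ 1]) simp
    qed (use n1 in auto)
    then show ?thesis using that(1) lt by auto
  qed
  have "?P \<subseteq> {..<N}"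
    by (rule image_subsetI) (simp only: lessThan_iff lt, simp)
  moreover have "1 \<in> {..<N}" using N_ge_3 unfolding lessThan_iff by linarith
  ultimately have sub: "insert 1 ?P \<subseteq> {..<N}" by blast
  have zero: "\<forall>k\<in>{..<N} - insert 1 ?P. ?t k = 0"
  proof
    fix k assume "k \<in> {..<N} - insert 1 ?P"
    then have "a k = 0" using pw[of k] by blast
    then show "?t k = 0" by simp
  qed
  have "(\<Sum>k<N. ?t k) = (\<Sum>k\<in>insert 1 ?P. ?t k)"
    by (rule sum.mono_neutral_right[OF _ sub zero]) simp
  also have "\<dots> = ?t 1 + (\<Sum>k\<in>?P. ?t k)"
  proof (subst sum.insert)
    have "1 \<noteq> p ^ r" if "r \<in> {1..<m}" for r using p_pow_gt_1[of r] that by simp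
    then show "1 \<notin> ?P" by blast
  qed simp_all
  also have "(\<Sum>k\<in>?P. ?t k) = RD (\<lambda>r. a (p ^ r)) f"
    unfolding rdd_def using p_gt_2 by (subst sum.reindex) (auto intro!: inj_onI)
  finally show ?thesis by simp
qed

text \<open>
  The \<open>p\<close>-th power of a derivation of \<open>W(m)\<close> is a derivation, that is, a cocycle in weight \<open>-1\<close>.
\<close>

lemma KO_p_power:
  assumes f: "f \<in> A"
  obtains d h where "h \<in> A" "\<And>g. g \<in> A \<Longrightarrow> (KO c f ^^ p) g = KO d h g"
proof -
  let ?P = "KO c f ^^ p"
  have add: "(KO c f ^^ n) (g + h) = (KO c f ^^ n) g + (KO c f ^^ n) h"
    and scal: "(KO c f ^^ n) (dpC a * g) = dpC a * (KO c f ^^ n) g"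
    and cl: "g \<in> A \<Longrightarrow> (KO c f ^^ n) g \<in> A" for n g h a
    by (induction n) (auto simp: kop_linear f)
  have ch: "of_nat p = (0 :: 'k dps)"
    using of_nat_dps_char[where 'a='k] char_p by simp
  have der: "?P (br g h) = br (?P g) h + br g (?P h)" for g h
    by (rule leibniz_pow_char[where B = br, OF prime_p ch]) (simp_all add: kop_linear KO_br)
  have coc: "?P (br g h) = dact (-1) g (?P h) - dact (-1) h (?P g)" for g h
    unfolding der dact_neg_1 using br_commute[of h "?P g"] by simp
  obtain u e a where *: "u \<in> A" "(-1) * e = (0 :: 'k)" "a 0 = 0"
    "\<And>k. k < N \<Longrightarrow> a k \<noteq> 0 \<Longrightarrow> k \<noteq> 1 \<Longrightarrow> special (-1) k"
    "\<And>g. g \<in> A \<Longrightarrow> ?P g = dact (-1) g (u + dpC e * dpX N) + (\<Sum>k<N. dpC (a k) * (dd ^^ k) g)"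
    using cocycle_classification[of ?P "-1"] cl add scal coc by blast
  \<comment> \<open>Here \<open>e\<close> is 0, so x^(N) does not occur. The coboundary of u is the
    bracket with -u, and the order-one term is the bracket with the constant field
    \<open>a 1\<close> times \<partial>; together they give the vector field
    \<open>dpC (a 1) - u\<close>.\<close>
  show ?thesis
  proof (rule that[of "dpC (a 1) - u" "\<lambda>r. a (p ^ r)"])
    show "dpC (a 1) - u \<in> A" using *(1) by simp
    fix g assume "g \<in> A"
    then have "?P g = br g u + (dpC (a 1) * dd g + RD (\<lambda>r. a (p ^ r)) g)"
      using *(2,5) special_sum[of a, OF *(3,4)] by (simp add: dact_neg_1)
    also have "\<dots> = KO (\<lambda>r. a (p ^ r)) (dpC (a 1) - u) g"
      by (simp add: kop_def br_def algebra_simps)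
    finally show "?P g = KO (\<lambda>r. a (p ^ r)) (dpC (a 1) - u) g" .
  qed
qed

text \<open>The operator \<partial>^q with q = p ^ r on W(m), for every r, so that the family is
  exactly the sequence of iterated p-th powers of \<open>KR 0\<close>, which is ad
  \<partial>.\<close>

definition KR :: "nat \<Rightarrow> ((nat \<Rightarrow> 'k) \<Rightarrow> nat \<Rightarrow> 'k) \<Rightarrow> (nat \<Rightarrow> 'k) \<Rightarrow> nat \<Rightarrow> 'k" where
  "KR r = (\<lambda>y\<in>carrier W. V ((dd ^^ (p ^ r)) (winv y)))"

lemma KR_Suc: "KR (Suc r) = KR r [^]\<^bsub>End_alg W\<^esub> p"
proof (rule W_ext)
  fix h assume "h \<in> A"
  then show "KR (Suc r) (V h) = (KR r [^]\<^bsub>End_alg W\<^esub> p) (V h)"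
    using End_pow_apply[of "KR r" "dd ^^ (p ^ r)" h p]
    by (simp add: KR_def funpow_mult mult.commute)
qed (auto simp: KR_def intro!: End_pow_ext)

lemma KR_eq_KA: "r \<ge> 1 \<Longrightarrow> r < m \<Longrightarrow> KR r = KA (\<lambda>s. if s = r then 1 else 0) 0"
proof -
  assume r: "r \<ge> 1" "r < m"
  have "RD (\<lambda>s. if s = r then 1 else 0) g = (\<Sum>s\<in>{1..<m}. if s = r then (dd ^^ (p ^ r)) g else 0)" for g
    unfolding rdd_def by (intro sum.cong) auto
  then have "RD (\<lambda>s. if s = r then 1 else 0) g = (dd ^^ (p ^ r)) g" for g
    using r by simp
  then show ?thesis by (intro W_ext) (auto simp: KR_def kop_linear)
qed

text \<open>The set on the right is itself a p-subalgebra, closed under p-th powers by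
  \<open>KO_p_power\<close>. Conversely a p-subalgebra containing ad W(m) contains the iterated p-th
  powers of ad \<partial>, hence all combinations.\<close>

theorem rzass_carrier: "carrier (rzass p m) = {KA c f | c f. f \<in> A}"
proof -
  let ?E = "End_alg W" and ?R = "{KA c f | c f. f \<in> A}"
  let ?C = "\<lambda>H. submodule H scalars ?E \<and> ad W ` carrier W \<subseteq> H \<and>
    (\<forall>x\<in>H. \<forall>y\<in>H. x \<otimes>\<^bsub>lie_of ?E\<^esub> y \<in> H) \<and> (\<forall>x\<in>H. x [^]\<^bsub>?E\<^esub> p \<in> H)"
  have E: "vs ?E" by (rule End_alg_vs[OF W_vs])
  have car: "carrier (rzass p m) = \<Inter>{H. ?C H}"
    by (simp add: rzass_def p_subalg_gen_def)
  have RC: "?C ?R"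
  proof (intro conjI)
    show "submodule ?R scalars ?E"
      unfolding submodule_iff[OF E] KA_zero
    proof (intro conjI ballI allI)
      show "?R \<subseteq> carrier ?E" using KA_lin by auto
      show "KA (\<lambda>_. 0) 0 \<in> ?R" using dpA_simps(1) by blast
    next
      fix x y assume "x \<in> ?R" "y \<in> ?R"
      then obtain c f d g where "x = KA c f" "y = KA d g" "f \<in> A" "g \<in> A" by blast
      then show "x \<oplus>\<^bsub>?E\<^esub> y \<in> ?R" using KA_add[of f g c d] dpA_simps(2)[of f N g] by blast
    next
      fix a x assume "x \<in> ?R"
      then obtain c f where "x = KA c f" "f \<in> A" by blast
      then show "a \<odot>\<^bsub>?E\<^esub> x \<in> ?R" using KA_smult[of f a c] dpA_simps(5)[of f N a] by blast
    qed
    show "ad W ` carrier W \<subseteq> ?R"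
    proof (rule image_subsetI)
      fix y assume "y \<in> carrier W"
      then obtain f where f: "f \<in> A" "y = V f" unfolding W_carrier by blast
      then show "ad W y \<in> ?R" using ad_eq[OF f(1)] by blast
    qed
    show "\<forall>x\<in>?R. \<forall>y\<in>?R. x \<otimes>\<^bsub>lie_of ?E\<^esub> y \<in> ?R"
    proof (intro ballI)
      fix x y assume "x \<in> ?R" "y \<in> ?R"
      then obtain c f d g where *: "x = KA c f" "y = KA d g" "f \<in> A" "g \<in> A" by blast
      then have "RD c g - RD d f + br f g \<in> A" by simp
      then show "x \<otimes>\<^bsub>lie_of ?E\<^esub> y \<in> ?R" using * KA_bracket[of f g c d] by blast
    qed
    show "\<forall>x\<in>?R. x [^]\<^bsub>?E\<^esub> p \<in> ?R"
    proof
      fix x assume "x \<in> ?R"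
      then obtain c f where x: "x = KA c f" "f \<in> A" by blast
      obtain d h where dh: "h \<in> A" "\<And>g. g \<in> A \<Longrightarrow> (KO c f ^^ p) g = KO d h g"
        using KO_p_power[OF x(2)] by blast
      have "x [^]\<^bsub>?E\<^esub> p = KA d h"
        using x dh End_pow_apply[of x "KO c f" _ p] by (intro W_ext End_pow_ext) simp_all
      then show "x [^]\<^bsub>?E\<^esub> p \<in> ?R" using dh(1) by blast
    qed
  qed
  have RH: "?R \<subseteq> H" if H: "?C H" for H
  proof
    fix x assume "x \<in> ?R"
    then obtain c f where x: "x = KA c f" "f \<in> A" by blast
    have sub: "submodule H scalars ?E" using H by (elim conjE)
    have pow: "y [^]\<^bsub>?E\<^esub> p \<in> H" if "y \<in> H" for y 
    proof -
      have "\<forall>x\<in>H. x [^]\<^bsub>?E\<^esub> p \<in> H" using H by (elim conjE)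
      then show ?thesis using that by (rule bspec)
    qed
    have ad: "KA (\<lambda>_. 0) f \<in> H" if "f \<in> A" for f
    proof -
      have "ad W ` carrier W \<subseteq> H" using H by (elim conjE)
      then have "ad W (V f) \<in> H" using W_V[OF that] by (rule subsetD[OF _ imageI])
      then show ?thesis by (simp only: ad_eq[OF that])
    qed
    have KR: "KR r \<in> H" for r
    proof (induction r)
      case 0
      have "KR 0 = KA (\<lambda>_. 0) 1" by (rule W_ext) (auto simp: KR_def kop_linear br_simps)
      then show ?case using ad by simp
    next
      case (Suc r)
      then show ?case unfolding KR_Suc by (rule pow)
    qed
    \<comment> \<open>The coefficients are switched on one exponent at a time, starting from the
      element ad (f\<partial>).\<close>
    have "KA (\<lambda>r. if r \<in> S then c r else 0) f \<in> H" if "finite S" "S \<subseteq> {1..<m}" for S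
      using that
    proof (induction S rule: finite_induct)
      case (insert s S)
      let ?c = "\<lambda>r. if r \<in> S then c r else 0" and ?d = "\<lambda>r. if r = s then 1 else (0 :: 'k)"
      have "KA ?d 0 \<in> H" using KR[of s] KR_eq_KA[of s] insert by simp
      then have "c s \<odot>\<^bsub>?E\<^esub> KA ?d 0 \<in> H" using submoduleD[OF sub E] by blast
      then have "KA ?c f \<oplus>\<^bsub>?E\<^esub> (c s \<odot>\<^bsub>?E\<^esub> KA ?d 0) \<in> H"
        using insert submoduleD[OF sub E] by blast
      also have "c s \<odot>\<^bsub>?E\<^esub> KA ?d 0 = KA (\<lambda>r. c s * ?d r) (dpC (c s) * 0)" by (rule KA_smult) simp
      also have "KA ?c f \<oplus>\<^bsub>?E\<^esub> \<dots> = KA (\<lambda>r. ?c r + c s * ?d r) (f + dpC (c s) * 0)"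
        using x by (intro KA_add) simp_all
      also have "(\<lambda>r. ?c r + c s * ?d r) = (\<lambda>r. if r \<in> insert s S then c r else 0)"
        using insert by (auto intro!: ext)
      finally show ?case by simp
    qed (use ad x in simp)
    from this[of "{1..<m}"] have "KA (\<lambda>r. if r \<in> {1..<m} then c r else 0) f \<in> H" by simp
    moreover have "KA (\<lambda>r. if r \<in> {1..<m} then c r else 0) f = KA c f"
      by (rule W_ext) (auto simp: kop_def rdd_def)
    ultimately show "x \<in> H" using x by simp
  qed
  show ?thesis unfolding car
  proof (rule antisym)
    show "\<Inter>{H. ?C H} \<subseteq> ?R" using RC by (intro Inter_lower CollectI)
    show "?R \<subseteq> \<Inter>{H. ?C H}" using RH by (intro Inter_greatest) (simp only: mem_Collect_eq)
  qed
qed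

lemma rzass_simps:
  "f \<in> A \<Longrightarrow> g \<in> A \<Longrightarrow> KA c f \<oplus>\<^bsub>rzass p m\<^esub> KA d g = KA (\<lambda>r. c r + d r) (f + g)"
  "f \<in> A \<Longrightarrow> a \<odot>\<^bsub>rzass p m\<^esub> KA c f = KA (\<lambda>r. a * c r) (dpC a * f)"
  "f \<in> A \<Longrightarrow> g \<in> A \<Longrightarrow> KA c f \<otimes>\<^bsub>rzass p m\<^esub> KA d g = KA (\<lambda>_. 0) (RD c g - RD d f + br f g)"
  using KA_add[of f g c d] KA_smult[of f a c] KA_bracket[of f g c d]
  by (simp_all add: rzass_def p_subalg_gen_def) (simp_all add: lie_of_def)

text \<open>Evaluation at 1 and x^(1), which the higher powers of \<partial> kill, recovers f' and
  then f; the constant term of the value at x^(q) with q = p ^ r isolates \<open>c r\<close>. Hence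
  the sum of W(m) and the lines through the \<partial>^q is direct.\<close>

lemma KA_inj:
  assumes "f \<in> A" "g \<in> A"
  shows "KA c f = KA d g \<longleftrightarrow> f = g \<and> (\<forall>r\<in>{1..<m}. c r = d r)"
proof
  assume eq: "KA c f = KA d g"
  have KO_eq: "KO c f h = KO d g h" if "h \<in> A" for h
  proof -
    have "KA c f (V h) = KA d g (V h)" using eq by simp
    then show ?thesis using that assms by (simp add: wv_inj)
  qed
  have 1: "dd f = dd g" using KO_eq[of 1] by (simp add: kop_def br_def)
  have 2: "f = g" using KO_eq[of "dpX (Suc 0)"] 1 by (simp add: kop_def br_def)
  have "c r = d r" if r: "r \<in> {1..<m}" for r
  proof -
    have lt: "p ^ r < N" using p_gt_2 r by simp
    have *: "dp_nth (RD c (dpX (p ^ r))) 0 = c r" for c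
    proof -
      have "dp_nth (RD c (dpX (p ^ r))) 0 = (\<Sum>s\<in>{1..<m}. if s = r then c r else 0)"
        unfolding rdd_def dp_nth_sum using p_gt_2 by (intro sum.cong) auto
      then show ?thesis using r by simp
    qed
    have "RD c (dpX (p ^ r)) = RD d (dpX (p ^ r))"
      using KO_eq[of "dpX (p ^ r)"] lt 2 by (simp add: kop_def)
    then show ?thesis using *[of c] *[of d] by simp
  qed
  then show "f = g \<and> (\<forall>r\<in>{1..<m}. c r = d r)" using 2 by simp
next
  assume "f = g \<and> (\<forall>r\<in>{1..<m}. c r = d r)"
  then show "KA c f = KA d g" by (intro W_ext) (auto simp: kop_def rdd_def)
qed

end

section \<open>Finite sums, induction over a basis of \<open>dpA n\<close>, subrings\<close>

primrec vsum :: "('k::field, 'v) module \<Rightarrow> (nat \<Rightarrow> 'k) \<Rightarrow> (nat \<Rightarrow> 'v) \<Rightarrow> nat \<Rightarrow> 'v" where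
  "vsum M a e 0 = \<zero>\<^bsub>M\<^esub>"
| "vsum M a e (Suc n) = vsum M a e n \<oplus>\<^bsub>M\<^esub> a n \<odot>\<^bsub>M\<^esub> e n"

lemma vsum_closed: "vs M \<Longrightarrow> (\<And>k. e k \<in> carrier M) \<Longrightarrow> vsum M a e n \<in> carrier M"
  by (induction n) (auto simp: vs_zero_closed vs_add vs_smult)

lemma vsum_add:
  assumes "vs M" "\<And>k. e k \<in> carrier M"
  shows "vsum M (\<lambda>k. a k + b k) e n = vsum M a e n \<oplus>\<^bsub>M\<^esub> vsum M b e n"
  by (induction n) (simp_all add: assms vs_l_zero vs_zero_closed vs_l_distr vs_4_comm vsum_closed vs_smult)

lemma vsum_smult:
  assumes "vs M" "\<And>k. e k \<in> carrier M"
  shows "vsum M (\<lambda>k. c * a k) e n = c \<odot>\<^bsub>M\<^esub> vsum M a e n"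
  by (induction n) (simp_all add: assms vs_smult_zero vs_assoc1 vs_r_distr vsum_closed vs_smult)

lemma vsum_delta:
  assumes "vs M" "\<And>k. e k \<in> carrier M"
  shows "vsum M (\<lambda>k. if k = j then 1 else 0) e n = (if j < n then e j else \<zero>\<^bsub>M\<^esub>)"
  by (induction n) (auto simp: assms vs_0 vs_1 vs_r_zero vs_l_zero vs_zero_closed less_Suc_eq)

lemma vsum_cong: "(\<And>k. k < n \<Longrightarrow> a k = b k) \<Longrightarrow> vsum M a e n = vsum M b e n"
  by (induction n) auto

lemma dpA_induct [consumes 1, case_names pos add smult dpX]:
  assumes f: "f \<in> dpA n" and n: "n > 0"
    and add: "\<And>f g. f \<in> dpA n \<Longrightarrow> g \<in> dpA n \<Longrightarrow> P f \<Longrightarrow> P g \<Longrightarrow> P (f + g)"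
    and smult: "\<And>c f. f \<in> dpA n \<Longrightarrow> P f \<Longrightarrow> P (dpC c * f)"
    and dpX: "\<And>j. j < n \<Longrightarrow> P (dpX j)"
  shows "P f"
proof -
  have P0: "P 0" using smult[of "dpX 0" 0] dpX[of 0] n by simp
  have "P (\<Sum>b<k. dpC (dp_nth f b) * dpX b)" if "k \<le> n" for k
    using that
  proof (induction k)
    case (Suc k)
    then show ?case by (simp, intro add smult dpX dpA_sum) auto
  qed (simp add: P0)
  from this[of n] show ?thesis using dpA_expand[OF f] by simp
qed

lemma subring_iff:
  assumes "vs (M :: ('k::field, 'v) module)" "submodule B scalars M"
  shows "subring B M \<longleftrightarrow> \<one>\<^bsub>M\<^esub> \<in> B \<and> (\<forall>x\<in>B. \<forall>y\<in>B. x \<otimes>\<^bsub>M\<^esub> y \<in> B)"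
  using assms submoduleD(1)[OF assms(2,1)]
  by (auto simp: subring_def submodule_def submonoid_def)

lemma base_space_simps [simp]:
  "carrier base_space = UNIV" "x \<oplus>\<^bsub>base_space\<^esub> y = x + y" "c \<odot>\<^bsub>base_space\<^esub> x = c * x" "\<zero>\<^bsub>base_space\<^esub> = 0"
  by (simp_all add: base_space_def ring.extend_def module.fields_def ring_of_type_algebra_def)

section \<open>The enveloping algebra of W(m) acting on tensor densities\<close>

context zass_ctx
begin

lemma one_less_N: "1 < N" "N - 1 < N" using N_ge_3 by linarith+

lemma N_Suc_Suc: obtains n where "N = Suc (Suc n)"
proof (rule that)
  show "N = Suc (Suc (N - 2))" using N_ge_3 by linarith
qed

abbreviation U :: "('k, 'k zenv) module" where "U \<equiv> env_alg W"
abbreviation ein :: "'k dps \<Rightarrow> 'k zenv" where "ein f \<equiv> env_in W (V f)"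

definition uact :: "'k \<Rightarrow> 'k zenv \<Rightarrow> 'k dps \<Rightarrow> 'k dps" where
  "uact \<mu> = env_act W (\<lambda>y g. dact \<mu> (winv y) g)"

lemmas uact_add = lie_rep.ract_add[OF W_rep, folded uact_def]
lemmas uact_mult = lie_rep.ract_mult[OF W_rep, folded uact_def]
lemmas uact_smult' = lie_rep.ract_smult[OF W_rep, folded uact_def]
lemmas uact_g_add' = lie_rep.ract_g_add[OF W_rep, folded uact_def]
lemmas uact_g_smult' = lie_rep.ract_g_smult[OF W_rep, folded uact_def]
lemmas uact_one = lie_rep.ract_one[OF W_rep, folded uact_def]

lemma uact_smult: "u \<in> carrier U \<Longrightarrow> uact \<mu> (c \<odot>\<^bsub>U\<^esub> u) g = dpC c * uact \<mu> u g"
  using uact_smult'[of u u] by simp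
lemma uact_g_add: "u \<in> carrier U \<Longrightarrow> uact \<mu> u (g + h) = uact \<mu> u g + uact \<mu> u h"
  using uact_g_add'[of u u] by simp
lemma uact_g_smult: "u \<in> carrier U \<Longrightarrow> uact \<mu> u (dpC c * g) = dpC c * uact \<mu> u g"
  using uact_g_smult'[of u u] by simp

lemma uact_in: "f \<in> A \<Longrightarrow> uact \<mu> (ein f) g = dact \<mu> f g"
  using lie_rep.ract_in[OF W_rep, of "V f" \<mu> g, folded uact_def] by simp

lemma ein_closed: "f \<in> A \<Longrightarrow> ein f \<in> carrier U"
  by (simp add: W.env_in_closed)

lemma ein_add: "f \<in> A \<Longrightarrow> g \<in> A \<Longrightarrow> ein (f + g) = ein f \<oplus>\<^bsub>U\<^esub> ein g"
  using W.env_in_add[of "V f" "V g"] by (simp add: W_add)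

lemma ein_smult: "f \<in> A \<Longrightarrow> ein (dpC c * f) = c \<odot>\<^bsub>U\<^esub> ein f"
  using W.env_in_smult[of "V f" c] by (simp add: W_smult)

lemma uact_zero: "uact \<mu> \<zero>\<^bsub>U\<^esub> g = 0"
  using uact_smult[OF W.U_one_closed, of \<mu> 0 g] by (simp add: vs_0[OF W.U_vs W.U_one_closed])

lemma U_env_induct [consumes 1, case_names one add smult mult]:
  assumes "u \<in> carrier U" and "P \<one>\<^bsub>U\<^esub>"
    and "\<And>u v. u \<in> carrier U \<Longrightarrow> v \<in> carrier U \<Longrightarrow> P u \<Longrightarrow> P v \<Longrightarrow> P (u \<oplus>\<^bsub>U\<^esub> v)"
    and "\<And>c u. u \<in> carrier U \<Longrightarrow> P u \<Longrightarrow> P (c \<odot>\<^bsub>U\<^esub> u)"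
    and "\<And>f u. f \<in> A \<Longrightarrow> u \<in> carrier U \<Longrightarrow> P u \<Longrightarrow> P (ein f \<otimes>\<^bsub>U\<^esub> u)"
  shows "P u"
  using assms(1)
proof (rule W.env_induct)
  fix x u assume "x \<in> carrier W" "u \<in> carrier U" "P u"
  then show "P (env_in W x \<otimes>\<^bsub>U\<^esub> u)" using assms(5) by (auto simp: W_carrier)
qed (use assms in auto)

lemma uact_A: "u \<in> carrier U \<Longrightarrow> g \<in> A \<Longrightarrow> uact \<mu> u g \<in> A"
  by (induction u rule: U_env_induct)
     (simp_all add: uact_one uact_add uact_smult uact_mult uact_in ein_closed)

definition Epow :: "nat \<Rightarrow> 'k zenv" where "Epow k = ein 1 [^]\<^bsub>U\<^esub> k"

lemma Epow_closed: "Epow k \<in> carrier U"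
  unfolding Epow_def by (induction k) (auto simp: W.U_one_closed ein_closed W.U_mult_closed)

lemma Epow_Suc: "Epow (Suc k) = ein 1 \<otimes>\<^bsub>U\<^esub> Epow k"
proof (induction k)
  case 0
  show ?case by (simp add: Epow_def W.U_one_mult ein_closed)
next
  case (Suc k)
  have "Epow (Suc (Suc k)) = Epow (Suc k) \<otimes>\<^bsub>U\<^esub> ein 1" by (simp add: Epow_def)
  also have "\<dots> = ein 1 \<otimes>\<^bsub>U\<^esub> (Epow k \<otimes>\<^bsub>U\<^esub> ein 1)"
    unfolding Suc by (intro W.U_assoc ein_closed Epow_closed) simp_all
  also have "Epow k \<otimes>\<^bsub>U\<^esub> ein 1 = Epow (Suc k)" by (simp add: Epow_def)
  finally show ?case .
qed

lemma uact_Epow: "uact \<mu> (Epow k) g = (dd ^^ k) g"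
proof (induction k)
  case 0
  show ?case by (simp add: Epow_def uact_one)
next
  case (Suc k)
  then show ?case by (simp add: Epow_Suc uact_mult ein_closed Epow_closed uact_in dact_linear)
qed

lemma zass_z_eq: "zass_z p m = Epow N"
  by (simp add: zass_z_def Epow_def zass_e_eq)

abbreviation \<tau> :: "'k dps" where "\<tau> \<equiv> dpX (N - Suc 0)"

text \<open>Closedness of \<open>A\<close> under products yields the divisibility of the binomial
  coefficient by p.\<close>

lemma dpX_times_zero:
  assumes "a < N" "b < N" "a + b \<ge> N" shows "dpX a * dpX b = (0 :: 'k dps)"
proof -
  have "dpX a * dpX b \<in> A" using assms by simp
  then have "dp_nth (dpX a * dpX b :: 'k dps) (a + b) = 0" using assms(3) by (simp add: dpA_def)
  then have "of_nat ((a + b) choose a) = (0 :: 'k)" by (simp add: dpX_mult)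
  then show ?thesis by (simp add: dpX_mult)
qed

text \<open>\<open>of_nat (N - 1)\<close> is -1 in the field, so the top vector has
  x\<partial>-weight \<mu> - 1. This is the origin of the shift \<mu> = \<lambda> + 1.\<close>

lemma dact_top_0: "dact \<mu> (dpX (Suc 0)) \<tau> = dpC (\<mu> - 1) * \<tau>"
proof -
  obtain n where n: "N = Suc (Suc n)" by (rule N_Suc_Suc)
  have "of_nat (Suc n) = (-1 :: 'k)" using of_nat_N_minus_1 n by simp
  have "dpX (Suc 0) * dpX n = dpC (of_nat ((Suc 0 + n) choose Suc 0)) * (dpX (Suc n) :: 'k dps)"
    by (simp only: dpX_mult plus_nat.simps)
  also have "\<dots> = - dpX (Suc n)" using \<open>of_nat (Suc n) = -1\<close> by (simp del: of_nat_Suc)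
  finally have "dpX (Suc 0) * dpX n = - (dpX (Suc n) :: 'k dps)" .
  then show ?thesis unfolding dact_def n by (simp add: algebra_simps)
qed

lemma dact_top_pos: "1 < k \<Longrightarrow> k < N \<Longrightarrow> dact \<mu> (dpX k) \<tau> = 0"
proof -
  assume k: "1 < k" "k < N"
  obtain n where n: "N = Suc (Suc n)" by (rule N_Suc_Suc)
  have "dpX k * dpX (N - 2) = (0 :: 'k dps)" "dpX (k - 1) * dpX (N - 1) = (0 :: 'k dps)"
    using k by (intro dpX_times_zero; simp)+
  then show ?thesis using k n by (simp add: dact_def dd_dpX mult.assoc)
qed

section \<open>The one-dimensional module over the subalgebra generated by b(m) and z\<close>

abbreviation ZO :: "'k zenv set" where "ZO \<equiv> zass_O p m"

lemma zass_b_gen: "zass_e p m ` {0..int (p ^ m) - 2} = V ` dpX ` {1..<N}"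
proof -
  have "zass_e p m ` {0..int N - 2} = (\<lambda>i. V (dpX (nat (i + 1)))) ` {0..int N - 2}"
    by (simp add: zass_e_eq)
  also have "\<dots> = V ` dpX ` (\<lambda>i. nat (i + 1)) ` {0..int N - 2}"
    by (simp add: image_image)
  also have "(\<lambda>i. nat (i + 1)) ` {0..int N - 2} = {1..<N}"
  proof -
    have "x \<in> (\<lambda>i. nat (i + 1)) ` {0..int N - 2}" if "x \<in> {1..<N}" for x
    proof -
      have "int x < int N" using that by (simp only: of_nat_less_iff atLeastLessThan_iff)
      then have "int x - 1 \<in> {0..int N - 2}"
        using that by (simp only: atLeastAtMost_iff atLeastLessThan_iff) linarith
      then show ?thesis by (intro image_eqI[of _ _ "int x - 1"]) simp_all
    qed
    moreover have "nat (i + 1) \<in> {1..<N}" if "i \<in> {0..int N - 2}" for i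
    proof -
      have "int (nat (i + 1)) < int N" using that by simp
      then have "nat (i + 1) < N" by (simp only: of_nat_less_iff)
      then show ?thesis using that by (auto simp: le_nat_iff)
    qed
    ultimately show ?thesis by blast
  qed
  finally show ?thesis by simp
qed

lemma zass_b_submodule: "submodule (zass_b p m) scalars W" "V ` dpX ` {1..<N} \<subseteq> zass_b p m"
proof -
  have "V ` dpX ` {1..<N} \<subseteq> carrier W" by auto
  from lin_span_submodule[OF W_vs this]
  show "submodule (zass_b p m) scalars W" "V ` dpX ` {1..<N} \<subseteq> zass_b p m"
    unfolding zass_b_def zass_b_gen .
qed

lemma zass_b_minimal: "submodule H scalars W \<Longrightarrow> V ` dpX ` {1..<N} \<subseteq> H \<Longrightarrow> zass_b p m \<subseteq> H"
  unfolding zass_b_def zass_b_gen by (rule lin_span_minimal)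

lemma zass_b_carrier: "zass_b p m \<subseteq> carrier W"
  using zass_b_submodule(1) submoduleD(1)[OF _ W_vs] by blast

text \<open>Identifies b(m) with the vector fields that vanish at the origin.\<close>

lemma V_in_zass_b: "f \<in> A \<Longrightarrow> dp_nth f 0 = 0 \<Longrightarrow> V f \<in> zass_b p m"
proof -
  assume f: "f \<in> A" "dp_nth f 0 = 0"
  note sm = submoduleD[OF zass_b_submodule(1) W_vs]
  have "V (\<Sum>b<k. dpC (dp_nth f b) * dpX b) \<in> zass_b p m" if "k \<le> N" for k
    using that
  proof (induction k)
    case 0
    then show ?case using sm(2) by (simp add: W_zero)
  next
    case (Suc k)
    have s: "(\<Sum>b<k. dpC (dp_nth f b) * dpX b) \<in> A" "dpC (dp_nth f k) * dpX k \<in> A"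
      using Suc by (auto intro: dpA_sum)
    have "V (dpC (dp_nth f k) * dpX k) \<in> zass_b p m"
    proof (cases "k = 0")
      case True
      then show ?thesis using f(2) sm(2) by (simp add: W_zero)
    next
      case False
      then have "V (dpX k) \<in> zass_b p m" using zass_b_submodule(2) Suc by auto
      then have "dp_nth f k \<odot>\<^bsub>W\<^esub> V (dpX k) \<in> zass_b p m" by (rule sm(4))
      then show ?thesis using Suc by (simp add: W_smult)
    qed
    then have "V (\<Sum>b<k. dpC (dp_nth f b) * dpX b) \<oplus>\<^bsub>W\<^esub> V (dpC (dp_nth f k) * dpX k) \<in> zass_b p m"
      using Suc sm(3) by simp
    then show ?case using s by (simp add: W_add)
  qed
  then show ?thesis using dpA_expand[OF f(1)] by (metis order_refl)
qed

abbreviation O_gens :: "'k zenv set" where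
  "O_gens \<equiv> env_in W ` zass_b p m \<union> {zass_z p m}"

lemma U_subalg: "submodule (carrier U) scalars U" "subring (carrier U) U"
proof -
  show s: "submodule (carrier U) scalars U"
    using module.carrier_is_submodule[OF W.U_vs] .
  show "subring (carrier U) U"
    unfolding subring_iff[OF W.U_vs s] using W.U_mult_closed W.U_one_closed by blast
qed

lemma O_gens_sub: "O_gens \<subseteq> carrier U"
  using zass_b_carrier W.env_in_closed Epow_closed by (auto simp: zass_z_eq)

lemma O_minimal: 
  assumes "submodule B scalars U" "\<one>\<^bsub>U\<^esub> \<in> B" "\<And>x y. x \<in> B \<Longrightarrow> y \<in> B \<Longrightarrow> x \<otimes>\<^bsub>U\<^esub> y \<in> B" "O_gens \<subseteq> B"
  shows "ZO \<subseteq> B"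
proof -
  have "subring B U" unfolding subring_iff[OF W.U_vs assms(1)] using assms by blast
  then show ?thesis unfolding zass_O_def subalg_gen_def using assms by blast
qed

lemma O_props:
  shows O_submodule: "submodule ZO scalars U" and O_one: "\<one>\<^bsub>U\<^esub> \<in> ZO"
    and O_mult: "x \<in> ZO \<Longrightarrow> y \<in> ZO \<Longrightarrow> x \<otimes>\<^bsub>U\<^esub> y \<in> ZO" and O_gens: "O_gens \<subseteq> ZO"
    and O_sub: "ZO \<subseteq> carrier U"
proof -
  let ?C = "\<lambda>B. submodule B scalars U \<and> subring B U \<and> O_gens \<subseteq> B"
  have ZO: "ZO = \<Inter>{B. ?C B}" by (simp add: zass_O_def subalg_gen_def)
  have C: "?C (carrier U)" using U_subalg O_gens_sub by blast
  then show sub: "ZO \<subseteq> carrier U" unfolding ZO by (intro Inter_lower CollectI)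
  have D: "\<zero>\<^bsub>U\<^esub> \<in> B" "\<one>\<^bsub>U\<^esub> \<in> B" "x \<in> B \<Longrightarrow> y \<in> B \<Longrightarrow> x \<otimes>\<^bsub>U\<^esub> y \<in> B" "x \<in> B \<Longrightarrow> y \<in> B \<Longrightarrow> x \<oplus>\<^bsub>U\<^esub> y \<in> B"
    "x \<in> B \<Longrightarrow> c \<odot>\<^bsub>U\<^esub> x \<in> B" "O_gens \<subseteq> B" if "?C B" for B x y c
    using that subring_iff[OF W.U_vs, of B] submoduleD[OF _ W.U_vs, of B] by auto
  show "\<one>\<^bsub>U\<^esub> \<in> ZO" "x \<in> ZO \<Longrightarrow> y \<in> ZO \<Longrightarrow> x \<otimes>\<^bsub>U\<^esub> y \<in> ZO" "O_gens \<subseteq> ZO"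
    unfolding ZO using D(2,3,6) by (auto simp del: Un_insert_right)
  show "submodule ZO scalars U"
    unfolding submodule_iff[OF W.U_vs] using sub unfolding ZO by (auto simp: D)
qed

text \<open>
  \<open>F\<^sub>\<lambda>\<close> is realised as the line through the top vector \<open>\<tau>\<close>, on which \<open>zass_O p m\<close> acts by scalars.
\<close>

definition sc :: "'k \<Rightarrow> 'k zenv \<Rightarrow> 'k" where
  "sc lam b = dp_nth (uact (lam + 1) b \<tau>) (N - 1)"

text \<open>The elements of U(W(m)) that preserve the line through \<open>\<tau>\<close> form a
  subalgebra. It contains b(m) by the two computations on the top vector, and z because z acts as
  \<partial>^N, which kills x^(N-1).\<close>

lemma uact_O: "b \<in> ZO \<Longrightarrow> uact (lam + 1) b \<tau> = dpC (sc lam b) * \<tau>"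
proof -
  let ?\<mu> = "lam + 1"
  let ?B = "{u \<in> carrier U. \<exists>s. uact ?\<mu> u \<tau> = dpC s * \<tau>}"
  have "ZO \<subseteq> ?B"
  proof (rule O_minimal)
    show "submodule ?B scalars U"
      unfolding submodule_iff[OF W.U_vs]
    proof (intro conjI ballI allI)
      show "\<zero>\<^bsub>U\<^esub> \<in> ?B" using uact_zero vs_zero_closed[OF W.U_vs] by (auto intro: exI[of _ 0])
    next
      fix x y assume "x \<in> ?B" "y \<in> ?B"
      then obtain s t where "x \<in> carrier U" "y \<in> carrier U" "uact ?\<mu> x \<tau> = dpC s * \<tau>" "uact ?\<mu> y \<tau> = dpC t * \<tau>" by blast
      then show "x \<oplus>\<^bsub>U\<^esub> y \<in> ?B" by (auto simp: vs_add[OF W.U_vs] uact_add distrib_right intro!: exI[of _ "s + t"])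
    next
      fix c x assume "x \<in> ?B"
      then obtain s where "x \<in> carrier U" "uact ?\<mu> x \<tau> = dpC s * \<tau>" by blast
      then show "c \<odot>\<^bsub>U\<^esub> x \<in> ?B" by (auto simp: vs_smult[OF W.U_vs] uact_smult mult.assoc intro!: exI[of _ "c * s"])
    qed auto
    show "\<one>\<^bsub>U\<^esub> \<in> ?B" by (auto simp: W.U_one_closed uact_one intro: exI[of _ 1])
    fix x y assume "x \<in> ?B" "y \<in> ?B"
    then obtain s t where "x \<in> carrier U" "y \<in> carrier U" "uact ?\<mu> x \<tau> = dpC s * \<tau>" "uact ?\<mu> y \<tau> = dpC t * \<tau>" by blast
    then show "x \<otimes>\<^bsub>U\<^esub> y \<in> ?B"
      by (auto simp: W.U_mult_closed uact_mult uact_g_smult mult.assoc intro!: exI[of _ "t * s"])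
  next
    have "zass_b p m \<subseteq> {y \<in> carrier W. \<exists>s. dact ?\<mu> (winv y) \<tau> = dpC s * \<tau>}" (is "_ \<subseteq> ?H")
    proof (rule zass_b_minimal)
      show "submodule ?H scalars W"
        unfolding submodule_iff[OF W_vs]
      proof (intro conjI ballI allI)
        show "\<zero>\<^bsub>W\<^esub> \<in> ?H" by (auto simp: W_zero dact_linear intro: exI[of _ 0])
      next
        fix x y assume "x \<in> ?H" "y \<in> ?H"
        then obtain f g s t where "f \<in> A" "g \<in> A" "x = V f" "y = V g" "dact ?\<mu> f \<tau> = dpC s * \<tau>" "dact ?\<mu> g \<tau> = dpC t * \<tau>"
          by (auto simp: W_carrier)
        then show "x \<oplus>\<^bsub>W\<^esub> y \<in> ?H" by (auto simp: W_add dact_linear distrib_right intro!: exI[of _ "s + t"])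
      next
        fix c x assume "x \<in> ?H"
        then obtain f s where "f \<in> A" "x = V f" "dact ?\<mu> f \<tau> = dpC s * \<tau>" by (auto simp: W_carrier)
        then show "c \<odot>\<^bsub>W\<^esub> x \<in> ?H" by (auto simp: W_smult dact_linear mult.assoc intro!: exI[of _ "c * s"])
      qed auto
      show "V ` dpX ` {1..<N} \<subseteq> ?H"
      proof (intro image_subsetI CollectI conjI)
        fix x :: "'k dps" assume "x \<in> dpX ` {1..<N}"
        then obtain k where k: "x = dpX k" "1 \<le> k" "k < N" by auto
        show "V x \<in> carrier W" using k by simp
        show "\<exists>s. dact ?\<mu> (winv (V x)) \<tau> = dpC s * \<tau>"
        proof (cases "k = 1")
          case True
          then show ?thesis using k dact_top_0[of ?\<mu>] by auto
        next
          case False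
          then show ?thesis using k dact_top_pos[of k ?\<mu>] by (auto intro: exI[of _ 0])
        qed
      qed
    qed
    then have "env_in W y \<in> ?B" if y: "y \<in> zass_b p m" for y
    proof -
      obtain s where "y \<in> carrier W" "dact ?\<mu> (winv y) \<tau> = dpC s * \<tau>"
        using y \<open>zass_b p m \<subseteq> ?H\<close> by blast
      then show ?thesis by (auto simp: W_carrier uact_in ein_closed)
    qed
    moreover have "zass_z p m \<in> ?B"
      by (auto simp: zass_z_eq Epow_closed uact_Epow dd_pow_dpX intro: exI[of _ 0])
    ultimately show "O_gens \<subseteq> ?B" by auto
  qed
  then show "b \<in> ZO \<Longrightarrow> uact (lam + 1) b \<tau> = dpC (sc lam b) * \<tau>"
    by (auto simp: sc_def)
qed

lemma sc_simps:
  shows sc_add: "b \<in> ZO \<Longrightarrow> c \<in> ZO \<Longrightarrow> sc lam (b \<oplus>\<^bsub>U\<^esub> c) = sc lam b + sc lam c"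
    and sc_smult: "b \<in> ZO \<Longrightarrow> sc lam (a \<odot>\<^bsub>U\<^esub> b) = a * sc lam b"
    and sc_mult: "b \<in> ZO \<Longrightarrow> c \<in> ZO \<Longrightarrow> sc lam (b \<otimes>\<^bsub>U\<^esub> c) = sc lam b * sc lam c"
    and sc_one: "sc lam \<one>\<^bsub>U\<^esub> = 1"
proof -
  show "b \<in> ZO \<Longrightarrow> c \<in> ZO \<Longrightarrow> sc lam (b \<otimes>\<^bsub>U\<^esub> c) = sc lam b * sc lam c"
    using O_sub uact_O[of b lam] uact_O[of c lam]
    by (subst sc_def) (auto simp: uact_mult uact_g_smult subset_iff mult.commute)
qed (use O_sub in \<open>auto simp: sc_def uact_add uact_smult uact_one subset_iff\<close>)

lemma sc_e0: "sc lam (ein (dpX (Suc 0))) = lam"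
  using dact_top_0[of "lam + 1"] by (simp add: sc_def uact_in)

lemma sc_ei: "1 < k \<Longrightarrow> k < N \<Longrightarrow> sc lam (ein (dpX k)) = 0"
  using dact_top_pos[of k "lam + 1"] by (simp add: sc_def uact_in)

lemma sc_z: "sc lam (zass_z p m) = 0"
  by (simp add: sc_def zass_z_eq uact_Epow dd_pow_dpX)

lemma lin_maps_base: "\<sigma> \<in> lin_maps base_space base_space \<longleftrightarrow> (\<exists>a. \<sigma> = (\<lambda>n. a * n))" for \<sigma> :: "'k \<Rightarrow> 'k"
proof
  assume s: "\<sigma> \<in> lin_maps base_space base_space"
  have "\<sigma> n = \<sigma> 1 * n" for n using lin_mapsD(3)[OF s, of 1 n] by (simp add: mult.commute)
  then show "\<exists>a. \<sigma> = (\<lambda>n. a * n)" by blast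
qed (auto simp: lin_maps_iff algebra_simps)

abbreviation UO :: "('k, 'k zenv) module" where "UO \<equiv> U\<lparr>carrier := ZO\<rparr>"

text \<open>The property under the \<open>THE\<close> in \<open>F_rep\<close>, named so that
  existence and uniqueness can be proved separately.\<close>

definition F_spec :: "'k \<Rightarrow> ('k zenv \<Rightarrow> 'k \<Rightarrow> 'k) \<Rightarrow> bool" where
  "F_spec lam \<sigma> \<longleftrightarrow> \<sigma> \<in> alg_reps UO base_space \<and>
     \<sigma> (env_in W (zass_e p m 0)) 1 = lam \<and>
     (\<forall>i\<in>{1..int (p ^ m) - 2}. \<sigma> (env_in W (zass_e p m i)) 1 = 0) \<and>
     \<sigma> (zass_z p m) 1 = 0"

lemma F_spec_exists: "F_spec lam (\<lambda>b\<in>ZO. \<lambda>n. sc lam b * n)"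
proof -
  let ?s = "\<lambda>b\<in>ZO. \<lambda>n. sc lam b * n"
  note sm = submoduleD[OF O_submodule W.U_vs]
  have mem: "(\<lambda>n. a * n) \<in> lin_maps base_space base_space" for a :: 'k
    using lin_maps_base by blast
  have "?s \<in> lin_maps UO (End_alg base_space)"
    unfolding lin_maps_iff[of _ UO]
    using sm mem by (auto simp: sc_add sc_smult fun_eq_iff distrib_right mult.assoc)
  moreover have "?s \<in> ring_hom UO (End_alg base_space)"
    unfolding ring_hom_def
    using sm mem O_mult O_one
    by (auto simp: sc_add sc_mult sc_one compose_def fun_eq_iff distrib_right mult.assoc)
  moreover have "ein (dpX k) \<in> ZO" if "1 \<le> k" "k < N" for k
    using O_gens zass_b_submodule(2) that by (auto simp: image_subset_iff)
  moreover have "nat (i + 1) < N" if "i \<in> {0..int N - 2}" for i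
  proof -
    have "int (nat (i + 1)) < int N" using that by simp
    then show ?thesis by (simp only: of_nat_less_iff)
  qed
  moreover have "zass_z p m \<in> ZO" using O_gens by blast
  ultimately show ?thesis
    unfolding F_spec_def alg_reps_def by (auto simp: zass_e_eq sc_e0 sc_ei sc_z)
qed

text \<open>Two one-dimensional representations agree on a subalgebra, so agreement on the
  generators is enough. On b(m) the prescribed values on the e_i extend by linearity.\<close>

lemma F_spec_unique:
  assumes "F_spec lam \<sigma>"
  shows "\<sigma> = (\<lambda>b\<in>ZO. \<lambda>n. sc lam b * n)"
proof -
  note sm = submoduleD[OF O_submodule W.U_vs]
  have lin: "\<sigma> \<in> lin_maps UO (End_alg base_space)" and hom: "\<sigma> \<in> ring_hom UO (End_alg base_space)"
    using assms unfolding F_spec_def alg_reps_def by auto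
  have mem: "\<sigma> b \<in> lin_maps base_space base_space" if "b \<in> ZO" for b
    using lin_mapsD(1)[OF lin] that by simp
  have s1: "\<sigma> b n = \<sigma> b 1 * n" if "b \<in> ZO" for b n
    using mem[OF that] unfolding lin_maps_base by auto
  have add: "\<sigma> (b \<oplus>\<^bsub>U\<^esub> c) 1 = \<sigma> b 1 + \<sigma> c 1" if "b \<in> ZO" "c \<in> ZO" for b c
    using lin_mapsD(2)[OF lin, of b c] that by simp
  have smult: "\<sigma> (a \<odot>\<^bsub>U\<^esub> b) 1 = a * \<sigma> b 1" if "b \<in> ZO" for a b
    using lin_mapsD(3)[OF lin, of b a] that by simp
  have mult: "\<sigma> (b \<otimes>\<^bsub>U\<^esub> c) 1 = \<sigma> b 1 * \<sigma> c 1" if "b \<in> ZO" "c \<in> ZO" for b c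
    using ring_hom_mult[OF hom, of b c] s1[OF that(1), of "\<sigma> c 1"] that by (simp add: compose_def)
  have one: "\<sigma> \<one>\<^bsub>U\<^esub> 1 = 1"
    using ring_hom_one[OF hom] by simp
  let ?B = "{b \<in> ZO. \<sigma> b 1 = sc lam b}"
  have z: "\<sigma> \<zero>\<^bsub>U\<^esub> 1 = sc lam \<zero>\<^bsub>U\<^esub>"
    using smult[OF O_one, of 0] sc_smult[OF O_one, of lam 0] by (simp add: vs_0[OF W.U_vs W.U_one_closed])
  have "ZO \<subseteq> ?B"
  proof (rule O_minimal)
    show "submodule ?B scalars U"
      unfolding submodule_iff[OF W.U_vs] using sm z by (auto simp: add smult sc_add sc_smult)
    show "\<one>\<^bsub>U\<^esub> \<in> ?B" using O_one one by (simp add: sc_one)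
    show "\<And>x y. x \<in> ?B \<Longrightarrow> y \<in> ?B \<Longrightarrow> x \<otimes>\<^bsub>U\<^esub> y \<in> ?B" using O_mult by (auto simp: mult sc_mult)
    have inO: "env_in W y \<in> ZO" if "y \<in> zass_b p m" for y using O_gens that by blast
    have "zass_b p m \<subseteq> {y \<in> zass_b p m. \<sigma> (env_in W y) 1 = sc lam (env_in W y)}" (is "_ \<subseteq> ?H")
    proof (rule zass_b_minimal)
      note smb = submoduleD[OF zass_b_submodule(1) W_vs]
      have z0: "env_in W \<zero>\<^bsub>W\<^esub> = \<zero>\<^bsub>U\<^esub>"
        using W.env_in_smult[of "\<zero>\<^bsub>W\<^esub>" 0] vs_zero_closed[OF W_vs]
        by (simp add: vs_smult_zero[OF W_vs] vs_0[OF W.U_vs W.env_in_closed])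
      show "submodule ?H scalars W"
        unfolding submodule_iff[OF W_vs]
        using smb z zass_b_carrier inO
        by (auto simp: z0 W.env_in_add W.env_in_smult add smult sc_add sc_smult subset_iff)
      show "V ` dpX ` {1..<N} \<subseteq> ?H"
      proof (intro image_subsetI CollectI conjI)
        fix x :: "'k dps" assume "x \<in> dpX ` {1..<N}"
        then obtain k where k: "x = dpX k" "1 \<le> k" "k < N" by auto
        show "V x \<in> zass_b p m" using zass_b_submodule(2) k by auto
        show "\<sigma> (env_in W (V x)) 1 = sc lam (env_in W (V x))"
        proof (cases "k = 1")
          case True
          have "\<sigma> (env_in W (zass_e p m 0)) 1 = lam" using assms unfolding F_spec_def by blast
          then show ?thesis using k True by (simp add: zass_e_eq sc_e0)
        next
          case False
          have "int k < int N" using k(3) by (simp only: of_nat_less_iff)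
          moreover have "2 \<le> int k" using False k(2) by simp
          ultimately have "int k - 1 \<in> {1..int (p ^ m) - 2}"
            by (simp only: atLeastAtMost_iff) linarith
          then have "\<sigma> (env_in W (zass_e p m (int k - 1))) 1 = 0" using assms unfolding F_spec_def by blast
          then show ?thesis using k False by (simp add: zass_e_eq sc_ei)
        qed
      qed
    qed
    moreover have "\<sigma> (zass_z p m) 1 = sc lam (zass_z p m)"
      using assms sc_z unfolding F_spec_def by simp
    moreover have "zass_z p m \<in> ZO" using O_gens by blast
    ultimately show "O_gens \<subseteq> ?B" using inO by blast
  qed
  then have "\<sigma> b n = sc lam b * n" if "b \<in> ZO" for b n using s1[OF that, of n] that by auto
  moreover have "\<sigma> \<in> extensional ZO" using lin_mapsD(4)[OF lin] by simp
  ultimately show ?thesis by (intro extensionalityI[of _ ZO]) auto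
qed

lemma F_rep_eq: "b \<in> ZO \<Longrightarrow> F_rep p m lam b n = sc lam b * n"
proof -
  have "F_rep p m lam = (THE \<sigma>. F_spec lam \<sigma>)"
    by (simp only: F_rep_def F_spec_def)
  also have "\<dots> = (\<lambda>b\<in>ZO. \<lambda>n. sc lam b * n)"
    by (rule the_equality[of "F_spec lam"]) (rule F_spec_exists, rule F_spec_unique)
  finally show "b \<in> ZO \<Longrightarrow> F_rep p m lam b n = sc lam b * n" by simp
qed

end

context zass_ctx
begin

section \<open>Baby Verma modules as modules of tensor densities\<close>

text \<open>
  A section of the map \<open>u \<mapsto> u \<tau>\<close> from the enveloping algebra to \<open>A\<close>.
\<close>

definition lift :: "'k dps \<Rightarrow> 'k zenv" where
  "lift g = vsum U (\<lambda>k. dp_nth g (N - 1 - k)) Epow N"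

lemma lift_closed: "lift g \<in> carrier U"
  unfolding lift_def by (rule vsum_closed[OF W.U_vs Epow_closed])

lemma lift_add: "lift (g + h) = lift g \<oplus>\<^bsub>U\<^esub> lift h"
  unfolding lift_def by (simp add: vsum_add[OF W.U_vs Epow_closed])

lemma lift_smult: "lift (dpC c * g) = c \<odot>\<^bsub>U\<^esub> lift g"
  unfolding lift_def by (simp add: vsum_smult[OF W.U_vs Epow_closed])

text \<open>x^(N-1-k) is the k-th derivative of \<open>\<tau>\<close>, so its natural preimage is
  the k-th power of e_{-1}.\<close>

lemma lift_dpX: "k < N \<Longrightarrow> lift (dpX (N - 1 - k)) = Epow k"
proof -
  assume k: "k < N"
  have "lift (dpX (N - 1 - k)) = vsum U (\<lambda>j. if j = k then 1 else 0) Epow N"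
    unfolding lift_def by (rule vsum_cong) (use k in auto)
  then show ?thesis using k by (simp add: vsum_delta[OF W.U_vs Epow_closed])
qed

lemma lift_top: "lift \<tau> = \<one>\<^bsub>U\<^esub>"
  using lift_dpX[of 0] by (simp add: Epow_def)

lemma lift_0: "lift 0 = \<zero>\<^bsub>U\<^esub>"
  using lift_smult[of 0 0] by (simp add: vs_0[OF W.U_vs lift_closed])

lemma uact_lift: "g \<in> A \<Longrightarrow> uact \<mu> (lift g) \<tau> = g"
proof (induction g rule: dpA_induct)
  case (dpX j)
  have "uact \<mu> (lift (dpX (N - 1 - (N - 1 - j)))) \<tau> = dpX j"
    using dpX by (subst lift_dpX) (auto simp: uact_Epow dd_pow_dpX)
  then show ?case using dpX by simp
qed (simp_all add: lift_add lift_smult uact_add uact_smult lift_closed)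

abbreviation Tn :: "('k, 'k zenv \<times> 'k \<Rightarrow> 'k) module" where
  "Tn \<equiv> free_space (carrier U \<times> carrier base_space)"

abbreviation Rl :: "'k \<Rightarrow> ('k zenv \<times> 'k \<Rightarrow> 'k) set" where
  "Rl lam \<equiv> tensor_rels U ZO base_space (F_rep p m lam)"

definition rel_set :: "'k \<Rightarrow> ('k zenv \<times> 'k \<Rightarrow> 'k) set" where
  "rel_set lam = 
      {\<delta> (a \<oplus>\<^bsub>U\<^esub> a', n) \<ominus>\<^bsub>Tn\<^esub> (\<delta> (a, n) \<oplus>\<^bsub>Tn\<^esub> \<delta> (a', n)) | a a' n.
         a \<in> carrier U \<and> a' \<in> carrier U \<and> n \<in> carrier base_space}
    \<union> {\<delta> (a, n \<oplus>\<^bsub>base_space\<^esub> n') \<ominus>\<^bsub>Tn\<^esub> (\<delta> (a, n) \<oplus>\<^bsub>Tn\<^esub> \<delta> (a, n')) | a n n'.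
         a \<in> carrier U \<and> n \<in> carrier base_space \<and> n' \<in> carrier base_space}
    \<union> {\<delta> (c \<odot>\<^bsub>U\<^esub> a, n) \<ominus>\<^bsub>Tn\<^esub> (c \<odot>\<^bsub>Tn\<^esub> \<delta> (a, n)) | c a n. a \<in> carrier U \<and> n \<in> carrier base_space}
    \<union> {\<delta> (a, c \<odot>\<^bsub>base_space\<^esub> n) \<ominus>\<^bsub>Tn\<^esub> (c \<odot>\<^bsub>Tn\<^esub> \<delta> (a, n)) | c a n. a \<in> carrier U \<and> n \<in> carrier base_space}
    \<union> {\<delta> (a \<otimes>\<^bsub>U\<^esub> b, n) \<ominus>\<^bsub>Tn\<^esub> \<delta> (a, F_rep p m lam b n) | a b n.
         a \<in> carrier U \<and> b \<in> ZO \<and> n \<in> carrier base_space}"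

lemma Rl_eq: "Rl lam = lin_span Tn (rel_set lam)"
  by (simp only: tensor_rels_def Let_def rel_set_def)

lemma Tn_delta: "u \<in> carrier U \<Longrightarrow> \<delta> (u, n) \<in> carrier Tn"
  by (rule delta_closed) simp

lemma rel_set_sub: "rel_set lam \<subseteq> carrier Tn"
proof -
  have ZO: "b \<in> ZO \<Longrightarrow> b \<in> carrier U" for b using O_sub by blast
  show ?thesis unfolding rel_set_def
    by (auto simp only: ZO intro!: vs_minus_closed[OF free_space_vs] vs_add[OF free_space_vs] vs_smult[OF free_space_vs]
      Tn_delta vs_add[OF W.U_vs] vs_smult[OF W.U_vs] W.U_mult_closed)
qed

lemma Rl_submodule: "submodule (Rl lam) scalars Tn"
  unfolding Rl_eq by (rule lin_span_submodule(1)[OF free_space_vs rel_set_sub])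

lemma rel_set_Rl: "F \<in> rel_set lam \<Longrightarrow> F \<in> Rl lam"
  unfolding Rl_eq using lin_span_submodule(2)[OF free_space_vs rel_set_sub] by blast

text \<open>On formal symbols, the map sending u \<otimes> n to n (u \<tau>); it induces the
  isomorphism from V(\<lambda>) to \<open>A\<close>.\<close>

definition Psi :: "'k \<Rightarrow> ('k zenv \<times> 'k \<Rightarrow> 'k) \<Rightarrow> 'k dps" where
  "Psi lam F = lext (\<lambda>x. dpC (snd x) * uact (lam + 1) (fst x) \<tau>) F"

lemma Psi_simps:
  shows Psi_add: "F \<in> carrier Tn \<Longrightarrow> G \<in> carrier Tn \<Longrightarrow> Psi lam (F \<oplus>\<^bsub>Tn\<^esub> G) = Psi lam F + Psi lam G"
    and Psi_smult: "F \<in> carrier Tn \<Longrightarrow> Psi lam (c \<odot>\<^bsub>Tn\<^esub> F) = dpC c * Psi lam F"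
    and Psi_delta: "Psi lam (\<delta> (u, n)) = dpC n * uact (lam + 1) u \<tau>"
    and Psi_zero: "Psi lam \<zero>\<^bsub>Tn\<^esub> = 0"
  by (simp_all add: Psi_def lext_add lext_smult)

lemma Psi_minus: "F \<in> carrier Tn \<Longrightarrow> G \<in> carrier Tn \<Longrightarrow> Psi lam (F \<ominus>\<^bsub>Tn\<^esub> G) = Psi lam F - Psi lam G"
proof -
  assume FG: "F \<in> carrier Tn" "G \<in> carrier Tn"
  have "Psi lam (F \<ominus>\<^bsub>Tn\<^esub> G) = Psi lam F + dpC (-1) * Psi lam G"
    using FG by (simp only: vs_minus[OF free_space_vs] Psi_add Psi_smult vs_smult[OF free_space_vs])
  then show ?thesis by simp
qed

lemma Psi_A: "F \<in> carrier Tn \<Longrightarrow> Psi lam F \<in> A"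
  unfolding Psi_def lext_def
  by (intro dpA_sum) (auto intro!: dpA_simps uact_A)

text \<open>The relation that moves b across the tensor sign holds because b acts on
  \<open>\<tau>\<close> by the same scalar as on 1_\<lambda>. Since \<open>Psi\<close> then descends
  to the quotient, this bounds V(\<lambda>) from below.\<close>

lemma Psi_Rl: "F \<in> Rl lam \<Longrightarrow> Psi lam F = 0"
proof -
  let ?K = "{F \<in> carrier Tn. Psi lam F = 0}"
  have "Rl lam \<subseteq> ?K"
    unfolding Rl_eq
  proof (rule lin_span_minimal)
    show "submodule ?K scalars Tn"
      unfolding submodule_iff[OF free_space_vs]
    proof (intro conjI ballI allI)
      fix F G assume "F \<in> ?K" "G \<in> ?K"
      then have "F \<in> carrier Tn" "Psi lam F = 0" "G \<in> carrier Tn" "Psi lam G = 0" by blast+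
      then show "F \<oplus>\<^bsub>Tn\<^esub> G \<in> ?K" unfolding mem_Collect_eq by (simp only: Psi_add vs_add[OF free_space_vs]) simp
    next
      fix c F assume "F \<in> ?K"
      then have "F \<in> carrier Tn" "Psi lam F = 0" by blast+
      then show "c \<odot>\<^bsub>Tn\<^esub> F \<in> ?K" unfolding mem_Collect_eq by (simp only: Psi_smult vs_smult[OF free_space_vs]) simp
    next
      show "\<zero>\<^bsub>Tn\<^esub> \<in> ?K" unfolding mem_Collect_eq using Psi_zero vs_zero_closed[OF free_space_vs] by blast
    qed blast
    show "rel_set lam \<subseteq> ?K"
    proof
      fix F assume F: "F \<in> rel_set lam"
      then have "F \<in> carrier Tn" using rel_set_sub by blast
      moreover have "Psi lam F = 0"
        using F unfolding rel_set_def
      proof (elim UnE CollectE exE conjE)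
        fix a b n assume *: "F = \<delta> (a \<otimes>\<^bsub>U\<^esub> b, n) \<ominus>\<^bsub>Tn\<^esub> \<delta> (a, F_rep p m lam b n)" "a \<in> carrier U" "b \<in> ZO"
        then have "b \<in> carrier U" using O_sub by blast
        then have "Psi lam F = dpC n * uact (lam + 1) a (uact (lam + 1) b \<tau>) - dpC (F_rep p m lam b n) * uact (lam + 1) a \<tau>"
          using * by (simp only: Psi_minus Psi_delta Tn_delta W.U_mult_closed uact_mult)
        then show ?thesis using *(2,3) by (simp add: uact_O uact_g_smult F_rep_eq mult_ac)
      next
        fix a a' n assume "F = \<delta> (a \<oplus>\<^bsub>U\<^esub> a', n) \<ominus>\<^bsub>Tn\<^esub> (\<delta> (a, n) \<oplus>\<^bsub>Tn\<^esub> \<delta> (a', n))" "a \<in> carrier U" "a' \<in> carrier U"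
        then show ?thesis
          by (simp only: Psi_minus Psi_add Psi_delta Tn_delta vs_add[OF W.U_vs] vs_add[OF free_space_vs] uact_add)
            (simp add: algebra_simps)
      next
        fix a n n' assume "F = \<delta> (a, n \<oplus>\<^bsub>base_space\<^esub> n') \<ominus>\<^bsub>Tn\<^esub> (\<delta> (a, n) \<oplus>\<^bsub>Tn\<^esub> \<delta> (a, n'))" "a \<in> carrier U"
        then show ?thesis
          by (simp only: Psi_minus Psi_add Psi_delta Tn_delta vs_add[OF free_space_vs])
            (simp add: algebra_simps)
      next
        fix c a n assume "F = \<delta> (c \<odot>\<^bsub>U\<^esub> a, n) \<ominus>\<^bsub>Tn\<^esub> (c \<odot>\<^bsub>Tn\<^esub> \<delta> (a, n))" "a \<in> carrier U"
        then show ?thesis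
          by (simp only: Psi_minus Psi_smult Psi_delta Tn_delta vs_smult[OF W.U_vs] vs_smult[OF free_space_vs] uact_smult)
            (simp add: algebra_simps)
      next
        fix c a n assume "F = \<delta> (a, c \<odot>\<^bsub>base_space\<^esub> n) \<ominus>\<^bsub>Tn\<^esub> (c \<odot>\<^bsub>Tn\<^esub> \<delta> (a, n))" "a \<in> carrier U"
        then show ?thesis
          by (simp only: Psi_minus Psi_smult Psi_delta Tn_delta vs_smult[OF free_space_vs])
            (simp add: algebra_simps)
      qed
      ultimately show "F \<in> ?K" by blast
    qed
  qed
  then show "F \<in> Rl lam \<Longrightarrow> Psi lam F = 0" by blast
qed

lemma tq: "vs_quot Tn (Rl lam)"
  by (intro vs_quot.intro free_space_vs Rl_submodule)

abbreviation BV :: "'k \<Rightarrow> ('k, ('k zenv \<times> 'k \<Rightarrow> 'k) set) module" where "BV lam \<equiv> baby_verma p m lam"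

lemma BV_eq: "BV lam = quot_module Tn (Rl lam)"
  by (simp add: baby_verma_def tensor_space_def)

lemma BV_vs: "vs (BV lam)"
  unfolding BV_eq by (rule vs_quot.quot_vs[OF tq])

definition tcoset :: "'k \<Rightarrow> ('k zenv \<times> 'k \<Rightarrow> 'k) \<Rightarrow> ('k zenv \<times> 'k \<Rightarrow> 'k) set" where
  "tcoset lam F = Rl lam +>\<^bsub>Tn\<^esub> F"

definition tens1 :: "'k \<Rightarrow> 'k zenv \<Rightarrow> ('k zenv \<times> 'k \<Rightarrow> 'k) set" where
  "tens1 lam u = tcoset lam (\<delta> (u, 1))"

lemma tcoset_simps:
  shows tcoset_add: "F \<in> carrier Tn \<Longrightarrow> G \<in> carrier Tn \<Longrightarrow> tcoset lam (F \<oplus>\<^bsub>Tn\<^esub> G) = tcoset lam F \<oplus>\<^bsub>BV lam\<^esub> tcoset lam G"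
    and tcoset_smult: "F \<in> carrier Tn \<Longrightarrow> tcoset lam (c \<odot>\<^bsub>Tn\<^esub> F) = c \<odot>\<^bsub>BV lam\<^esub> tcoset lam F"
    and tcoset_zero: "tcoset lam \<zero>\<^bsub>Tn\<^esub> = \<zero>\<^bsub>BV lam\<^esub>"
    and tcoset_carrier: "carrier (BV lam) = tcoset lam ` carrier Tn"
    and tcoset_eq_iff: "F \<in> carrier Tn \<Longrightarrow> G \<in> carrier Tn \<Longrightarrow> tcoset lam F = tcoset lam G \<longleftrightarrow> F \<ominus>\<^bsub>Tn\<^esub> G \<in> Rl lam"
  unfolding tcoset_def BV_eq
  by (simp_all only: vs_quot.quot_add[OF tq] vs_quot.quot_smult[OF tq] vs_quot.quot_zero[OF tq]
     vs_quot.quot_carrier[OF tq] vs_quot.cs_eq_iff[OF tq])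

lemma tens1_simps:
  assumes "u \<in> carrier U" 
  shows tens1_add: "v \<in> carrier U \<Longrightarrow> tens1 lam (u \<oplus>\<^bsub>U\<^esub> v) = tens1 lam u \<oplus>\<^bsub>BV lam\<^esub> tens1 lam v"
    and tens1_smult: "tens1 lam (c \<odot>\<^bsub>U\<^esub> u) = c \<odot>\<^bsub>BV lam\<^esub> tens1 lam u"
    and tens1_n: "tcoset lam (\<delta> (u, n)) = n \<odot>\<^bsub>BV lam\<^esub> tens1 lam u"
    and tens1_O: "b \<in> ZO \<Longrightarrow> tens1 lam (u \<otimes>\<^bsub>U\<^esub> b) = sc lam b \<odot>\<^bsub>BV lam\<^esub> tens1 lam u"
proof -
  note d = Tn_delta[OF assms]
  show n: "tcoset lam (\<delta> (u, n)) = n \<odot>\<^bsub>BV lam\<^esub> tens1 lam u" for n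
  proof -
    have "\<delta> (u, n \<odot>\<^bsub>base_space\<^esub> 1) \<ominus>\<^bsub>Tn\<^esub> (n \<odot>\<^bsub>Tn\<^esub> \<delta> (u, 1)) \<in> rel_set lam"
      unfolding rel_set_def using assms base_space_simps(1) by blast
    then have "tcoset lam (\<delta> (u, n)) = tcoset lam (n \<odot>\<^bsub>Tn\<^esub> \<delta> (u, 1))"
      using d by (simp only: tcoset_eq_iff vs_smult[OF free_space_vs] rel_set_Rl base_space_simps mult_1_right)
    then show ?thesis unfolding tens1_def using d by (simp only: tcoset_smult)
  qed
  show "tens1 lam (u \<oplus>\<^bsub>U\<^esub> v) = tens1 lam u \<oplus>\<^bsub>BV lam\<^esub> tens1 lam v" if v: "v \<in> carrier U"
  proof -
    have "\<delta> (u \<oplus>\<^bsub>U\<^esub> v, 1) \<ominus>\<^bsub>Tn\<^esub> (\<delta> (u, 1) \<oplus>\<^bsub>Tn\<^esub> \<delta> (v, 1)) \<in> rel_set lam"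
      unfolding rel_set_def using assms v base_space_simps(1) by blast
    then have "tcoset lam (\<delta> (u \<oplus>\<^bsub>U\<^esub> v, 1)) = tcoset lam (\<delta> (u, 1) \<oplus>\<^bsub>Tn\<^esub> \<delta> (v, 1))"
      using d Tn_delta[OF v] Tn_delta[OF vs_add[OF W.U_vs assms v]]
      by (simp only: tcoset_eq_iff vs_add[OF free_space_vs] rel_set_Rl)
    then show ?thesis unfolding tens1_def using d Tn_delta[OF v] by (simp only: tcoset_add)
  qed
  show "tens1 lam (c \<odot>\<^bsub>U\<^esub> u) = c \<odot>\<^bsub>BV lam\<^esub> tens1 lam u"
  proof -
    have "\<delta> (c \<odot>\<^bsub>U\<^esub> u, 1) \<ominus>\<^bsub>Tn\<^esub> (c \<odot>\<^bsub>Tn\<^esub> \<delta> (u, 1)) \<in> rel_set lam"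
      unfolding rel_set_def using assms base_space_simps(1) by blast
    then have "tcoset lam (\<delta> (c \<odot>\<^bsub>U\<^esub> u, 1)) = tcoset lam (c \<odot>\<^bsub>Tn\<^esub> \<delta> (u, 1))"
      using d Tn_delta[OF vs_smult[OF W.U_vs assms]]
      by (simp only: tcoset_eq_iff vs_smult[OF free_space_vs] rel_set_Rl)
    then show ?thesis unfolding tens1_def using d by (simp only: tcoset_smult)
  qed
  show "tens1 lam (u \<otimes>\<^bsub>U\<^esub> b) = sc lam b \<odot>\<^bsub>BV lam\<^esub> tens1 lam u" if b: "b \<in> ZO"
  proof -
    have bU: "b \<in> carrier U" using b O_sub by blast
    have "\<delta> (u \<otimes>\<^bsub>U\<^esub> b, 1) \<ominus>\<^bsub>Tn\<^esub> \<delta> (u, F_rep p m lam b 1) \<in> rel_set lam"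
      unfolding rel_set_def using assms b base_space_simps(1) by blast
    then have "tcoset lam (\<delta> (u \<otimes>\<^bsub>U\<^esub> b, 1)) = tcoset lam (\<delta> (u, F_rep p m lam b 1))"
      using d Tn_delta[OF W.U_mult_closed[OF assms bU]] by (simp only: tcoset_eq_iff rel_set_Rl)
    also have "F_rep p m lam b 1 = sc lam b" using b by (simp add: F_rep_eq)
    finally show ?thesis unfolding n by (simp only: tens1_def)
  qed
qed

lemma tens1_closed: "u \<in> carrier U \<Longrightarrow> tens1 lam u \<in> carrier (BV lam)"
  unfolding tens1_def tcoset_carrier by (intro imageI Tn_delta)

lemma tens1_zero: "tens1 lam \<zero>\<^bsub>U\<^esub> = \<zero>\<^bsub>BV lam\<^esub>"
  using tens1_smult[OF W.U_one_closed, of lam 0] tens1_closed[OF W.U_one_closed]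
  by (simp add: vs_0[OF W.U_vs W.U_one_closed] vs_0[OF BV_vs])

lemma tens1_mult_linear:
  assumes "w \<in> carrier U" "u \<in> carrier U" 
  shows "v \<in> carrier U \<Longrightarrow> tens1 lam (w \<otimes>\<^bsub>U\<^esub> (u \<oplus>\<^bsub>U\<^esub> v)) = tens1 lam (w \<otimes>\<^bsub>U\<^esub> u) \<oplus>\<^bsub>BV lam\<^esub> tens1 lam (w \<otimes>\<^bsub>U\<^esub> v)"
    and "tens1 lam (w \<otimes>\<^bsub>U\<^esub> (c \<odot>\<^bsub>U\<^esub> u)) = c \<odot>\<^bsub>BV lam\<^esub> tens1 lam (w \<otimes>\<^bsub>U\<^esub> u)"
  using assms W.U_distr[OF assms(1,2)] by (simp_all add: tens1_add tens1_smult W.U_mult_closed)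

text \<open>On x^(j) with j > 0 both arguments are the same element of U(W(m)). For j = 0 the left
  one ends in e_{-1}^N = z, which acts on 1_\<lambda> by zero, in agreement with the derivative of
  1.\<close>

lemma tens1_E: "h \<in> A \<Longrightarrow> w \<in> carrier U \<Longrightarrow> tens1 lam (w \<otimes>\<^bsub>U\<^esub> (ein 1 \<otimes>\<^bsub>U\<^esub> lift h)) = tens1 lam (w \<otimes>\<^bsub>U\<^esub> lift (dd h))"
proof (induction h arbitrary: w rule: dpA_induct)
  case (add f g)
  then show ?case
    by (simp add: lift_add W.U_distr ein_closed lift_closed W.U_mult_closed tens1_mult_linear tens1_add)
next
  case (smult c f)
  have "dd (dpC c * f) = dpC c * dd f" by simp
  then show ?case using smult W.U_distr(3)[OF ein_closed[of 1] lift_closed lift_closed]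
    by (simp only: lift_smult tens1_mult_linear ein_closed lift_closed W.U_mult_closed A_1)
next
  case (dpX j)
  define k where "k = N - 1 - j"
  have k: "j = N - 1 - k" "k < N" using dpX k_def by auto
  have 1: "ein 1 \<otimes>\<^bsub>U\<^esub> lift (dpX j) = Epow (Suc k)"
    unfolding k(1) lift_dpX[OF k(2)] by (simp add: Epow_Suc)
  show ?case
  proof (cases "j = 0")
    case True
    then have "Suc k = N" using k_def N_ge_3 by linarith
    then have "ein 1 \<otimes>\<^bsub>U\<^esub> lift (dpX j) = zass_z p m" using 1 by (simp add: zass_z_eq)
    moreover have "zass_z p m \<in> ZO" using O_gens by blast
    ultimately have "tens1 lam (w \<otimes>\<^bsub>U\<^esub> (ein 1 \<otimes>\<^bsub>U\<^esub> lift (dpX j))) = \<zero>\<^bsub>BV lam\<^esub>"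
      using dpX by (simp add: tens1_O sc_z vs_0[OF BV_vs] tens1_closed)
    moreover have "tens1 lam (w \<otimes>\<^bsub>U\<^esub> \<zero>\<^bsub>U\<^esub>) = \<zero>\<^bsub>BV lam\<^esub>"
      using tens1_mult_linear(2)[OF dpX(2) W.U_one_closed, of lam 0] dpX(2)
      by (simp add: vs_0[OF W.U_vs W.U_one_closed] vs_0[OF BV_vs] tens1_closed W.U_mult_closed W.U_one_closed)
    ultimately show ?thesis using True by (simp add: lift_0)
  next
    case False
    then have "dd (dpX j) = (dpX (N - 1 - Suc k) :: 'k dps)" "Suc k < N"
      using k dpX by (auto simp: dd_dpX)
    then show ?thesis using 1 by (simp only: lift_dpX)
  qed
qed simp

lemma ein_split: "f \<in> A \<Longrightarrow> ein f = dp_nth f 0 \<odot>\<^bsub>U\<^esub> ein 1 \<oplus>\<^bsub>U\<^esub> ein (f - dpC (dp_nth f 0))"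
proof -
  assume f: "f \<in> A"
  have "ein f = ein (dpC (dp_nth f 0) * 1 + (f - dpC (dp_nth f 0)))" by simp
  also have "\<dots> = ein (dpC (dp_nth f 0) * 1) \<oplus>\<^bsub>U\<^esub> ein (f - dpC (dp_nth f 0))"
    using f by (intro ein_add) simp_all
  also have "ein (dpC (dp_nth f 0) * 1) = dp_nth f 0 \<odot>\<^bsub>U\<^esub> ein 1"
    by (rule ein_smult) simp
  finally show ?thesis .
qed

text \<open>f\<partial> is moved to the right past the powers of e_{-1} with
  [\<partial>, f\<partial>] = f'\<partial>, by induction on the power. The left factor
  \<open>w\<close> has to be arbitrary, since the induction hypothesis is also applied with w e_{-1}
  in its place.\<close>

lemma tens1_ein_Epow:
  "k < N \<Longrightarrow> f \<in> A \<Longrightarrow> w \<in> carrier U \<Longrightarrow>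
    tens1 lam (w \<otimes>\<^bsub>U\<^esub> (ein f \<otimes>\<^bsub>U\<^esub> Epow k)) = tens1 lam (w \<otimes>\<^bsub>U\<^esub> lift (dact (lam + 1) f (dpX (N - 1 - k))))"
proof (induction k arbitrary: f w)
  case 0
  \<comment> \<open>Without its constant term f\<partial> lies in b(m) and acts on 1_\<lambda> by a
    scalar; the constant term contributes a multiple of e_{-1}.\<close>
  let ?g = "f - dpC (dp_nth f 0)"
  have g: "?g \<in> A" "dp_nth ?g 0 = 0" using 0 by simp_all
  have gO: "ein ?g \<in> ZO" using O_gens V_in_zass_b[OF g] by blast
  have s: "dact (lam + 1) ?g \<tau> = dpC (sc lam (ein ?g)) * \<tau>"
    using uact_O[OF gO] g by (simp add: uact_in)
  have "tens1 lam (w \<otimes>\<^bsub>U\<^esub> ein ?g) = tens1 lam (w \<otimes>\<^bsub>U\<^esub> lift (dact (lam + 1) ?g \<tau>))"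
    unfolding s lift_smult lift_top using 0 gO
    by (simp add: tens1_O tens1_mult_linear W.U_one_closed W.U_one_mult)
  moreover have "tens1 lam (w \<otimes>\<^bsub>U\<^esub> ein 1) = tens1 lam (w \<otimes>\<^bsub>U\<^esub> lift (dd \<tau>))"
    using tens1_E[of \<tau> w lam] 0 by (simp add: lift_top W.U_one_mult ein_closed)
  moreover have "dact (lam + 1) f \<tau> = dpC (dp_nth f 0) * dd \<tau> + dact (lam + 1) ?g \<tau>"
    by (simp add: dact_def algebra_simps)
  moreover have "Epow 0 = \<one>\<^bsub>U\<^esub>" by (simp add: Epow_def)
  ultimately show ?case
    using 0 g by (subst ein_split[OF 0(2)])
      (simp add: lift_add lift_smult tens1_mult_linear W.U_one_mult ein_closed vs_add[OF W.U_vs] vs_smult[OF W.U_vs] lift_closed)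
next
  case (Suc k)
  let ?\<mu> = "lam + 1" and ?Y = "dpX (N - 1 - k) :: 'k dps" and ?Z = "dpX (N - 1 - Suc k) :: 'k dps"
  have k: "k < N" using Suc by simp
  have Y: "?Y \<in> A" "?Z \<in> A" by auto
  have dY: "dd ?Y = ?Z" using Suc by (simp add: dd_dpX)
  have f: "ein f \<in> carrier U" "ein 1 \<in> carrier U" "ein (dd f) \<in> carrier U"
    using Suc by (auto intro: ein_closed)
  have "ein (dd f) = ein (br 1 f)" by (simp add: br_simps)
  also have "\<dots> = ein 1 \<otimes>\<^bsub>U\<^esub> ein f \<oplus>\<^bsub>U\<^esub> (-1) \<odot>\<^bsub>U\<^esub> (ein f \<otimes>\<^bsub>U\<^esub> ein 1)"
    using W.env_in_bracket[of "V 1" "V f"] Suc by (simp add: W_mult)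
  finally have comm: "ein (dd f) = ein 1 \<otimes>\<^bsub>U\<^esub> ein f \<oplus>\<^bsub>U\<^esub> (-1) \<odot>\<^bsub>U\<^esub> (ein f \<otimes>\<^bsub>U\<^esub> ein 1)" .
  let ?E = "Epow k"
  note cl = f Epow_closed[of k] W.U_mult_closed Suc.prems(3) lift_closed
  have "tens1 lam (w \<otimes>\<^bsub>U\<^esub> (ein (dd f) \<otimes>\<^bsub>U\<^esub> ?E)) =
      tens1 lam (w \<otimes>\<^bsub>U\<^esub> (ein 1 \<otimes>\<^bsub>U\<^esub> (ein f \<otimes>\<^bsub>U\<^esub> ?E))) \<oplus>\<^bsub>BV lam\<^esub>
      (-1) \<odot>\<^bsub>BV lam\<^esub> tens1 lam (w \<otimes>\<^bsub>U\<^esub> (ein f \<otimes>\<^bsub>U\<^esub> (ein 1 \<otimes>\<^bsub>U\<^esub> ?E)))"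
    unfolding comm using cl
    by (simp add: W.U_distr vs_smult[OF W.U_vs] tens1_mult_linear tens1_add tens1_smult W.U_assoc)
  moreover have "tens1 lam (w \<otimes>\<^bsub>U\<^esub> (ein 1 \<otimes>\<^bsub>U\<^esub> (ein f \<otimes>\<^bsub>U\<^esub> ?E))) = tens1 lam (w \<otimes>\<^bsub>U\<^esub> lift (dd (dact ?\<mu> f ?Y)))"
  proof -
    have "tens1 lam (w \<otimes>\<^bsub>U\<^esub> (ein 1 \<otimes>\<^bsub>U\<^esub> (ein f \<otimes>\<^bsub>U\<^esub> ?E))) = tens1 lam ((w \<otimes>\<^bsub>U\<^esub> ein 1) \<otimes>\<^bsub>U\<^esub> (ein f \<otimes>\<^bsub>U\<^esub> ?E))"
      using cl by (simp add: W.U_assoc)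
    also have "\<dots> = tens1 lam ((w \<otimes>\<^bsub>U\<^esub> ein 1) \<otimes>\<^bsub>U\<^esub> lift (dact ?\<mu> f ?Y))"
      using Suc.IH[OF k Suc.prems(2), of "w \<otimes>\<^bsub>U\<^esub> ein 1"] cl by simp
    also have "\<dots> = tens1 lam (w \<otimes>\<^bsub>U\<^esub> (ein 1 \<otimes>\<^bsub>U\<^esub> lift (dact ?\<mu> f ?Y)))"
      using cl by (simp add: W.U_assoc)
    also have "\<dots> = tens1 lam (w \<otimes>\<^bsub>U\<^esub> lift (dd (dact ?\<mu> f ?Y)))"
      using Suc.prems Y by (intro tens1_E) auto
    finally show ?thesis .
  qed
  moreover have "tens1 lam (w \<otimes>\<^bsub>U\<^esub> (ein (dd f) \<otimes>\<^bsub>U\<^esub> ?E)) = tens1 lam (w \<otimes>\<^bsub>U\<^esub> lift (dact ?\<mu> (dd f) ?Y))"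
    using Suc.prems k by (intro Suc.IH) auto
  moreover have "dd (dact ?\<mu> f ?Y) = dact ?\<mu> (dd f) ?Y + dact ?\<mu> f ?Z"
    using dY by (simp add: dact_def algebra_simps)
  \<comment> \<open>The Leibniz rule for \<partial> on densities produces the term with f' on both
    sides; cancelling it leaves the claim for the next power.\<close>
  ultimately have eq: "tens1 lam (w \<otimes>\<^bsub>U\<^esub> lift (dact ?\<mu> (dd f) ?Y)) = 
      (tens1 lam (w \<otimes>\<^bsub>U\<^esub> lift (dact ?\<mu> (dd f) ?Y)) \<oplus>\<^bsub>BV lam\<^esub> tens1 lam (w \<otimes>\<^bsub>U\<^esub> lift (dact ?\<mu> f ?Z))) \<oplus>\<^bsub>BV lam\<^esub>
      (-1) \<odot>\<^bsub>BV lam\<^esub> tens1 lam (w \<otimes>\<^bsub>U\<^esub> (ein f \<otimes>\<^bsub>U\<^esub> (ein 1 \<otimes>\<^bsub>U\<^esub> ?E)))" (is "?a = (?a \<oplus>\<^bsub>BV lam\<^esub> ?b) \<oplus>\<^bsub>BV lam\<^esub> _ \<odot>\<^bsub>BV lam\<^esub> ?c")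
    using cl by (simp add: lift_add tens1_mult_linear)
  have abc: "?a \<in> carrier (BV lam)" "?b \<in> carrier (BV lam)" "?c \<in> carrier (BV lam)"
    using cl by (auto intro!: tens1_closed)
  have "?b = ?c"
  proof -
    interpret BVm: module scalars "BV lam" by (rule BV_vs)
    have "?a \<oplus>\<^bsub>BV lam\<^esub> \<zero>\<^bsub>BV lam\<^esub> = ?a \<oplus>\<^bsub>BV lam\<^esub> (?b \<ominus>\<^bsub>BV lam\<^esub> ?c)"
      using eq abc by (simp add: vs_minus[OF BV_vs] vs_assoc[OF BV_vs] vs_smult[OF BV_vs])
    then have "?b \<ominus>\<^bsub>BV lam\<^esub> ?c = \<zero>\<^bsub>BV lam\<^esub>"
      using abc by (simp add: vs_minus_closed[OF BV_vs] del: BVm.r_zero)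
    then show ?thesis using abc by (simp add: vs_minus_eq_zero[OF BV_vs])
  qed
  then show ?case by (simp add: Epow_Suc)
qed

lemma tens1_ein_lift:
  assumes "h \<in> A" "f \<in> A"
  shows "w \<in> carrier U \<Longrightarrow> tens1 lam (w \<otimes>\<^bsub>U\<^esub> (ein f \<otimes>\<^bsub>U\<^esub> lift h)) = tens1 lam (w \<otimes>\<^bsub>U\<^esub> lift (dact (lam + 1) f h))"
  using assms(1)
proof (induction h arbitrary: w rule: dpA_induct)
  case (add g h)
  then show ?case using assms(2)
    by (simp add: lift_add dact_linear W.U_distr ein_closed lift_closed W.U_mult_closed tens1_mult_linear tens1_add)
next
  case (smult c h)
  then show ?case using assms(2) W.U_distr(3)[OF ein_closed[of f] lift_closed lift_closed]
    by (simp only: lift_smult dact_linear tens1_mult_linear ein_closed lift_closed W.U_mult_closed)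
next
  case (dpX j)
  define k where "k = N - 1 - j"
  have k: "j = N - 1 - k" "k < N" using dpX k_def by auto
  show ?case unfolding k(1) lift_dpX[OF k(2)] by (rule tens1_ein_Epow[OF k(2) assms(2) dpX(2)])
qed simp

text \<open>
  This is the upper bound on the dimension of \<open>V(\<lambda>)\<close>: a tensor \<open>u \<otimes> 1\<close> depends only on \<open>u \<tau>\<close>.
  Quantifying over \<open>w\<close> makes the statement invariant under left multiplication.
\<close>

lemma tens1_uact:
  assumes "u \<in> carrier U"
  shows "w \<in> carrier U \<Longrightarrow> tens1 lam (w \<otimes>\<^bsub>U\<^esub> u) = tens1 lam (w \<otimes>\<^bsub>U\<^esub> lift (uact (lam + 1) u \<tau>))"
  using assms
proof (induction u arbitrary: w rule: U_env_induct)
  case one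
  then show ?case by (simp add: uact_one lift_top)
next
  case (add u v)
  then show ?case by (simp add: uact_add lift_add tens1_mult_linear lift_closed)
next
  case (smult c u)
  then show ?case by (simp add: uact_smult lift_smult tens1_mult_linear lift_closed)
next
  case (mult f u)
  let ?g = "uact (lam + 1) u \<tau>"
  have g: "?g \<in> A" using mult by (intro uact_A) auto
  have "tens1 lam (w \<otimes>\<^bsub>U\<^esub> (ein f \<otimes>\<^bsub>U\<^esub> u)) = tens1 lam ((w \<otimes>\<^bsub>U\<^esub> ein f) \<otimes>\<^bsub>U\<^esub> lift ?g)"
    using mult by (simp add: W.U_assoc[symmetric] ein_closed W.U_mult_closed)
  also have "\<dots> = tens1 lam (w \<otimes>\<^bsub>U\<^esub> (ein f \<otimes>\<^bsub>U\<^esub> lift ?g))"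
    using mult by (simp add: W.U_assoc ein_closed lift_closed)
  also have "\<dots> = tens1 lam (w \<otimes>\<^bsub>U\<^esub> lift (dact (lam + 1) f ?g))"
    using mult g by (intro tens1_ein_lift) auto
  finally show ?case using mult by (simp add: uact_mult uact_in ein_closed)
qed

text \<open>The inverse of the isomorphism from \<open>V(\<lambda>)\<close> to \<open>A\<close>.\<close>

definition vb :: "'k \<Rightarrow> 'k dps \<Rightarrow> ('k zenv \<times> 'k \<Rightarrow> 'k) set" where
  "vb lam g = tens1 lam (lift g)"

lemma vb_simps:
  shows vb_add: "vb lam g \<oplus>\<^bsub>BV lam\<^esub> vb lam h = vb lam (g + h)"
    and vb_smult: "c \<odot>\<^bsub>BV lam\<^esub> vb lam g = vb lam (dpC c * g)"
    and vb_zero: "\<zero>\<^bsub>BV lam\<^esub> = vb lam 0"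
  by (simp_all add: vb_def lift_add lift_smult lift_0 tens1_add tens1_smult tens1_zero lift_closed)

text \<open>With \<open>Psi_Rl\<close> this makes \<open>vb\<close> and the map induced by
  \<open>Psi\<close> mutually inverse: every class is \<open>vb\<close> of its image in
  \<open>A\<close>.\<close>

lemma tcoset_eq_vb: "F \<in> carrier Tn \<Longrightarrow> tcoset lam F = vb lam (Psi lam F)"
proof (induction F rule: free_space_induct)
  case zero
  then show ?case using tcoset_zero[of lam] Psi_zero[of lam] vb_zero[of lam] by simp
next
  case (add F c x)
  obtain u n where x: "x = (u, n)" "u \<in> carrier U" using add by auto
  have d: "\<delta> x \<in> carrier Tn" using x Tn_delta by simp
  have "tcoset lam (F \<oplus>\<^bsub>Tn\<^esub> c \<odot>\<^bsub>Tn\<^esub> \<delta> x) = tcoset lam F \<oplus>\<^bsub>BV lam\<^esub> c \<odot>\<^bsub>BV lam\<^esub> tcoset lam (\<delta> x)"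
    using add d by (simp only: tcoset_add tcoset_smult vs_smult[OF free_space_vs])
  also have "tcoset lam (\<delta> x) = vb lam (Psi lam (\<delta> x))"
    using tens1_uact[OF x(2) W.U_one_closed, of lam] x
    by (simp add: tens1_n Psi_delta vb_smult[symmetric] W.U_one_mult lift_closed) (simp add: vb_def)
  also have "tcoset lam F \<oplus>\<^bsub>BV lam\<^esub> c \<odot>\<^bsub>BV lam\<^esub> vb lam (Psi lam (\<delta> x)) = vb lam (Psi lam F + dpC c * Psi lam (\<delta> x))"
    using add by (simp only: vb_smult vb_add)
  also have "Psi lam F + dpC c * Psi lam (\<delta> x) = Psi lam (F \<oplus>\<^bsub>Tn\<^esub> c \<odot>\<^bsub>Tn\<^esub> \<delta> x)"
    using add d by (simp only: Psi_add Psi_smult vs_smult[OF free_space_vs])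
  finally show ?case by simp
qed

lemma Psi_lift: "g \<in> A \<Longrightarrow> Psi lam (\<delta> (lift g, 1)) = g"
  by (simp add: Psi_delta uact_lift)

lemma vb_inj: "g \<in> A \<Longrightarrow> h \<in> A \<Longrightarrow> vb lam g = vb lam h \<longleftrightarrow> g = h"
proof
  assume gh: "g \<in> A" "h \<in> A" "vb lam g = vb lam h"
  note d = Tn_delta[OF lift_closed, of _ 1]
  have "\<delta> (lift g, 1) \<ominus>\<^bsub>Tn\<^esub> \<delta> (lift h, 1) \<in> Rl lam"
    using gh(3) d[of g] d[of h] by (simp only: vb_def tens1_def tcoset_eq_iff)
  then have "Psi lam (\<delta> (lift g, 1) \<ominus>\<^bsub>Tn\<^esub> \<delta> (lift h, 1)) = 0" by (rule Psi_Rl)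
  then show "g = h" using gh d[of g] d[of h] by (simp only: Psi_minus Psi_lift) simp
qed simp

lemma BV_carrier: "carrier (BV lam) = vb lam ` A"
proof -
  have "vb lam g \<in> carrier (BV lam)" for g unfolding vb_def by (intro tens1_closed lift_closed)
  moreover have "tcoset lam F \<in> vb lam ` A" if "F \<in> carrier Tn" for F
    using tcoset_eq_vb[OF that] Psi_A[OF that] by blast
  ultimately show ?thesis unfolding tcoset_carrier using tcoset_carrier by blast
qed

text \<open>\<open>tensor_rep\<close> is a union over all representatives f of the class. Each
  contributes the same coset, because \<open>Psi\<close> intertwines left multiplication with the
  action on \<open>A\<close>, and \<open>Psi lam f\<close> is g for every representative.\<close>

lemma BV_rep:
  assumes u: "u \<in> carrier U" and g: "g \<in> A"
  shows "baby_verma_rep p m lam u (vb lam g) = vb lam (uact (lam + 1) u g)"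
proof -
  let ?l = "\<lambda>f. \<Oplus>\<^bsub>Tn\<^esub>x\<in>{x. f x \<noteq> 0}. f x \<odot>\<^bsub>Tn\<^esub> \<delta> (u \<otimes>\<^bsub>U\<^esub> fst x, snd x)"
  interpret Tm: module scalars Tn by (rule free_space_vs)
  \<comment> \<open>Stated for arbitrary finite sets and coefficients, so that the induction does
    not have to follow the support of f.\<close>
  have sum: "(\<Oplus>\<^bsub>Tn\<^esub>x\<in>S. a x \<odot>\<^bsub>Tn\<^esub> \<delta> (u \<otimes>\<^bsub>U\<^esub> fst x, snd x)) \<in> carrier Tn \<and>
     Psi lam (\<Oplus>\<^bsub>Tn\<^esub>x\<in>S. a x \<odot>\<^bsub>Tn\<^esub> \<delta> (u \<otimes>\<^bsub>U\<^esub> fst x, snd x)) =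
       uact (lam + 1) u (\<Sum>x\<in>S. dpC (a x) * (dpC (snd x) * uact (lam + 1) (fst x) \<tau>))"
    if "finite S" "S \<subseteq> carrier U \<times> UNIV" for S and a :: "'k zenv \<times> 'k \<Rightarrow> 'k"
    using that
  proof (induction S rule: finite_induct)
    case empty
    have "uact (lam + 1) u 0 = 0" using uact_g_smult[OF u, of "lam + 1" 0 0] by simp
    then show ?case using vs_zero_closed[OF free_space_vs] Psi_zero[of lam]
      by (simp only: Tm.M.finsum_empty sum.empty simp_thms)
  next
    case (insert x S)
    have t: "a y \<odot>\<^bsub>Tn\<^esub> \<delta> (u \<otimes>\<^bsub>U\<^esub> fst y, snd y) \<in> carrier Tn" if "y \<in> insert x S" for y
      using that insert.prems u by (intro vs_smult[OF free_space_vs] Tn_delta W.U_mult_closed) auto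
    have d: "\<delta> (u \<otimes>\<^bsub>U\<^esub> fst x, snd x) \<in> carrier Tn"
      using insert.prems u by (intro Tn_delta W.U_mult_closed) auto
    have fx: "fst x \<in> carrier U" using insert.prems by auto
    have i: "(\<Oplus>\<^bsub>Tn\<^esub>y\<in>insert x S. a y \<odot>\<^bsub>Tn\<^esub> \<delta> (u \<otimes>\<^bsub>U\<^esub> fst y, snd y)) =
       a x \<odot>\<^bsub>Tn\<^esub> \<delta> (u \<otimes>\<^bsub>U\<^esub> fst x, snd x) \<oplus>\<^bsub>Tn\<^esub> (\<Oplus>\<^bsub>Tn\<^esub>y\<in>S. a y \<odot>\<^bsub>Tn\<^esub> \<delta> (u \<otimes>\<^bsub>U\<^esub> fst y, snd y))"
      using insert.hyps t by (intro Tm.M.finsum_insert) blast+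
    have IH: "(\<Oplus>\<^bsub>Tn\<^esub>x\<in>S. a x \<odot>\<^bsub>Tn\<^esub> \<delta> (u \<otimes>\<^bsub>U\<^esub> fst x, snd x)) \<in> carrier Tn"
       "Psi lam (\<Oplus>\<^bsub>Tn\<^esub>x\<in>S. a x \<odot>\<^bsub>Tn\<^esub> \<delta> (u \<otimes>\<^bsub>U\<^esub> fst x, snd x)) =
       uact (lam + 1) u (\<Sum>x\<in>S. dpC (a x) * (dpC (snd x) * uact (lam + 1) (fst x) \<tau>))"
      using insert by blast+
    show ?case
    proof
      show "(\<Oplus>\<^bsub>Tn\<^esub>y\<in>insert x S. a y \<odot>\<^bsub>Tn\<^esub> \<delta> (u \<otimes>\<^bsub>U\<^esub> fst y, snd y)) \<in> carrier Tn"
        unfolding i by (intro vs_add[OF free_space_vs] IH(1) t) blast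
      have "Psi lam (\<Oplus>\<^bsub>Tn\<^esub>y\<in>insert x S. a y \<odot>\<^bsub>Tn\<^esub> \<delta> (u \<otimes>\<^bsub>U\<^esub> fst y, snd y)) =
        dpC (a x) * (dpC (snd x) * uact (lam + 1) (u \<otimes>\<^bsub>U\<^esub> fst x) \<tau>) + 
        uact (lam + 1) u (\<Sum>x\<in>S. dpC (a x) * (dpC (snd x) * uact (lam + 1) (fst x) \<tau>))"
        unfolding i using IH d by (simp only: Psi_add Psi_smult Psi_delta vs_smult[OF free_space_vs])
      then show "Psi lam (\<Oplus>\<^bsub>Tn\<^esub>y\<in>insert x S. a y \<odot>\<^bsub>Tn\<^esub> \<delta> (u \<otimes>\<^bsub>U\<^esub> fst y, snd y)) =
        uact (lam + 1) u (\<Sum>x\<in>insert x S. dpC (a x) * (dpC (snd x) * uact (lam + 1) (fst x) \<tau>))"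
        using insert.hyps u fx by (simp add: uact_g_add uact_g_smult uact_mult)
    qed
  qed
  have l: "?l f \<in> carrier Tn" "Psi lam (?l f) = uact (lam + 1) u (Psi lam f)" if "f \<in> carrier Tn" for f
    using sum[of "{x. f x \<noteq> 0}" f] that unfolding Psi_def lext_def by (auto simp del: free_space_simps(2-4))
  have "vb lam g \<in> carrier (BV lam)" using g unfolding BV_carrier by blast
  then have "baby_verma_rep p m lam u (vb lam g) = (\<Union>f\<in>vb lam g. tcoset lam (?l f))"
    using u by (simp add: baby_verma_rep_def tensor_rep_def baby_verma_def tcoset_def Let_def del: free_space_simps)
  also have "\<dots> = (\<Union>f\<in>vb lam g. vb lam (uact (lam + 1) u g))"
  proof (rule SUP_cong[OF refl])
    fix f assume "f \<in> vb lam g"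
    then have f: "f \<in> carrier Tn" "tcoset lam f = vb lam g"
      using vs_quot.cs_mem_iff[OF tq Tn_delta[OF lift_closed], of f lam g 1]
      unfolding vb_def tens1_def tcoset_def by blast+
    then have "Psi lam f = g" using tcoset_eq_vb[OF f(1)] g Psi_A[OF f(1)] by (simp only: vb_inj)
    then show "tcoset lam (?l f) = vb lam (uact (lam + 1) u g)"
      using tcoset_eq_vb[OF l(1)[OF f(1)], of lam] l(2)[OF f(1)] by (simp only:)
  qed
  also have "\<dots> = vb lam (uact (lam + 1) u g)"
  proof -
    have "\<delta> (lift g, 1) \<in> vb lam g"
      unfolding vb_def tens1_def tcoset_def by (rule vs_quot.cs_self[OF tq Tn_delta[OF lift_closed]])
    then show ?thesis by blast
  qed
  finally show ?thesis .
qed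

end

text \<open>The functionals live on \<open>M\<close> and have \<open>R\<close> as their common
  kernel; they descend to the quotient, where \<open>has_dimI\<close> applies.\<close>

lemma has_dim_quotI:
  fixes M :: "('k::field, 'v) module" and \<kappa> :: "'i \<Rightarrow> 'v \<Rightarrow> 'k"
  assumes vsM: "vs M" and sub: "submodule R scalars M" and fin: "finite I"
    and z: "\<And>i. i \<in> I \<Longrightarrow> z i \<in> carrier M"
    and add: "\<And>i x y. i \<in> I \<Longrightarrow> x \<in> carrier M \<Longrightarrow> y \<in> carrier M \<Longrightarrow> \<kappa> i (x \<oplus>\<^bsub>M\<^esub> y) = \<kappa> i x + \<kappa> i y"
    and smult: "\<And>i c x. i \<in> I \<Longrightarrow> x \<in> carrier M \<Longrightarrow> \<kappa> i (c \<odot>\<^bsub>M\<^esub> x) = c * \<kappa> i x"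
    and dual: "\<And>i j. i \<in> I \<Longrightarrow> j \<in> I \<Longrightarrow> \<kappa> i (z j) = (if i = j then 1 else 0)"
    and zero: "\<And>i x. i \<in> I \<Longrightarrow> x \<in> R \<Longrightarrow> \<kappa> i x = 0"
    and inj: "\<And>x. x \<in> carrier M \<Longrightarrow> (\<And>i. i \<in> I \<Longrightarrow> \<kappa> i x = 0) \<Longrightarrow> x \<in> R"
  shows "has_dim (quot_module M R) (card I)"
proof -
  interpret q: vs_quot M R by (intro vs_quot.intro vsM sub)
  define K where "K i S = \<kappa> i (SOME x. x \<in> carrier M \<and> S = q.cs x)" for i S
  have K: "K i (q.cs x) = \<kappa> i x" if i: "i \<in> I" and x: "x \<in> carrier M" for i x
  proof -
    define y where "y = (SOME y. y \<in> carrier M \<and> q.cs x = q.cs y)"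
    have y: "y \<in> carrier M" "q.cs x = q.cs y"
      using someI[of "\<lambda>y. y \<in> carrier M \<and> q.cs x = q.cs y" x] x unfolding y_def by blast+
    then have "\<kappa> i (x \<ominus>\<^bsub>M\<^esub> y) = 0" using i x by (intro zero) (simp_all add: q.cs_eq_iff)
    moreover have "\<kappa> i (x \<ominus>\<^bsub>M\<^esub> y) = \<kappa> i x - \<kappa> i y"
      using i x y by (simp add: vs_minus[OF vsM] add smult vs_smult[OF vsM])
    ultimately show ?thesis by (simp add: K_def y_def)
  qed
  have cz: "q.cs x = \<zero>\<^bsub>quot_module M R\<^esub>" if "x \<in> R" for x
    using that submoduleD[OF sub vsM] vs_zero_closed[OF vsM] q.R_sub
    by (simp add: q.quot_zero q.cs_eq_iff subset_iff)
  show ?thesis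
  proof (rule has_dimI[where \<kappa> = K and z = "\<lambda>i. q.cs (z i)", OF q.quot_vs fin])
    fix x assume x: "x \<in> carrier (quot_module M R)" and k: "\<And>i. i \<in> I \<Longrightarrow> K i x = 0"
    then obtain y where y: "y \<in> carrier M" "x = q.cs y" by (auto simp only: q.quot_carrier)
    then have "y \<in> R" using k K by (intro inj) auto
    then show "x = \<zero>\<^bsub>quot_module M R\<^esub>" using cz y by simp
  next
    fix i x y assume "i \<in> I" "x \<in> carrier (quot_module M R)" "y \<in> carrier (quot_module M R)"
    then obtain x' y' where "i \<in> I" "x' \<in> carrier M" "x = q.cs x'" "y' \<in> carrier M" "y = q.cs y'"
      by (auto simp only: q.quot_carrier)
    then show "K i (x \<oplus>\<^bsub>quot_module M R\<^esub> y) = K i x + K i y"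
      by (simp add: q.quot_add K add vs_add[OF vsM])
  next
    fix i c x assume "i \<in> I" "x \<in> carrier (quot_module M R)"
    then obtain x' where "i \<in> I" "x' \<in> carrier M" "x = q.cs x'" by (auto simp only: q.quot_carrier)
    then show "K i (c \<odot>\<^bsub>quot_module M R\<^esub> x) = c * K i x"
      by (simp add: q.quot_smult K smult vs_smult[OF vsM])
  qed (use z in \<open>simp_all add: K dual q.quot_carrier\<close>)
qed

context zass_ctx
begin

section \<open>Primitivity of the universal p-envelope\<close>

abbreviation HW :: "('k, 'k zenv) module" where "HW \<equiv> zass_hat p m"

text \<open>
  Primitive elements act compatibly with the multiplication of densities, and they act on densities of
  weight 1 by total derivatives.  Both properties survive \<open>p\<close>-th powers, which forces a central
  difference between \<open>\<phi> (\<partial>\<^sup>q)\<close> and \<open>\<partial>\<^sup>q\<close> to act as zero if \<open>\<mu>\<close> is in the prime field.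
\<close>

definition primitive :: "'k zenv \<Rightarrow> bool" where
  "primitive u \<longleftrightarrow> (\<forall>a b g h. uact (a + b) u (g * h) = uact a u g * h + g * uact b u h) \<and>
     (\<forall>g\<in>A. dp_nth (uact 1 u g) (N - 1) = 0)"

lemma uact_pow: "u \<in> carrier U \<Longrightarrow> u [^]\<^bsub>U\<^esub> (n::nat) \<in> carrier U \<and> uact \<mu> (u [^]\<^bsub>U\<^esub> n) g = (uact \<mu> u ^^ n) g"
  by (induction n arbitrary: g) (auto simp: W.U_one_closed uact_one W.U_mult_closed uact_mult funpow_swap1)

lemma U_bracket: "u \<in> carrier U \<Longrightarrow> v \<in> carrier U \<Longrightarrow>
    u \<otimes>\<^bsub>lie_of U\<^esub> v = u \<otimes>\<^bsub>U\<^esub> v \<oplus>\<^bsub>U\<^esub> (-1) \<odot>\<^bsub>U\<^esub> (v \<otimes>\<^bsub>U\<^esub> u)"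
  using vs_minus[OF W.U_vs W.U_mult_closed W.U_mult_closed] by (simp add: lie_of_def)

lemma uact_bracket: "u \<in> carrier U \<Longrightarrow> v \<in> carrier U \<Longrightarrow>
    uact \<mu> (u \<otimes>\<^bsub>lie_of U\<^esub> v) g = uact \<mu> u (uact \<mu> v g) - uact \<mu> v (uact \<mu> u g)"
  by (simp add: U_bracket uact_add uact_smult uact_mult vs_smult[OF W.U_vs] W.U_mult_closed)

text \<open>The primitive elements form a p-subalgebra containing W(m). The Leibniz rule survives
  p-th powers by \<open>leibniz_pow_char\<close>, with the weights a, b and a + b on the three
  operators. In weight 1 the field f\<partial> sends g to (f g)', whose coefficient at N - 1 is the
  coefficient of f g at N, hence 0.\<close>

lemma HW_primitive:
  assumes "u \<in> carrier HW"
  shows "u \<in> carrier U" "primitive u"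
proof -
  let ?P = "{u \<in> carrier U. primitive u}"
  have "carrier HW \<subseteq> ?P"
    unfolding zass_hat_def p_subalg_gen_def
  proof (simp, rule Inter_lower, rule CollectI, intro conjI)
    show "submodule ?P scalars U"
      unfolding submodule_iff[OF W.U_vs]
      by (auto simp: primitive_def vs_zero_closed[OF W.U_vs] vs_add[OF W.U_vs] vs_smult[OF W.U_vs]
          uact_add uact_smult uact_zero algebra_simps)
    show "env_in W ` carrier W \<subseteq> ?P"
    proof (rule image_subsetI)
      fix y assume "y \<in> carrier W"
      then obtain f where f: "f \<in> A" "y = V f" by (auto simp: W_carrier)
      have "dp_nth (dact 1 f g) (N - 1) = 0" if "g \<in> A" for g
      proof -
        have "dact 1 f g = dd (f * g)" by (simp add: dact_def)
        moreover have "dp_nth (f * g) (Suc (N - 1)) = 0" using A_times[OF f(1) that] by (simp add: dpA_def)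
        ultimately show ?thesis by (simp only: dp_nth_dd)
      qed
      moreover have "dact (a + b) f (g * h) = dact a f g * h + g * dact b f h" for a b g h
        by (simp add: dact_def algebra_simps)
      ultimately show "env_in W y \<in> ?P" using f by (simp add: primitive_def uact_in ein_closed)
    qed
    show "\<forall>x\<in>?P. \<forall>y\<in>?P. x \<otimes>\<^bsub>lie_of U\<^esub> y \<in> ?P"
    proof (intro ballI CollectI conjI)
      fix x y assume xy: "x \<in> ?P" "y \<in> ?P"
      then have U: "x \<in> carrier U" "y \<in> carrier U" by auto
      then show "x \<otimes>\<^bsub>lie_of U\<^esub> y \<in> carrier U"
        by (simp add: U_bracket vs_add[OF W.U_vs] vs_smult[OF W.U_vs] W.U_mult_closed)
      show "primitive (x \<otimes>\<^bsub>lie_of U\<^esub> y)"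
        unfolding primitive_def
      proof (intro conjI allI ballI)
        fix a b g h
        have lx: "\<And>a b g h. uact (a + b) x (g * h) = uact a x g * h + g * uact b x h"
          and ly: "\<And>a b g h. uact (a + b) y (g * h) = uact a y g * h + g * uact b y h"
          using xy unfolding primitive_def by blast+
        show "uact (a + b) (x \<otimes>\<^bsub>lie_of U\<^esub> y) (g * h) =
            uact a (x \<otimes>\<^bsub>lie_of U\<^esub> y) g * h + g * uact b (x \<otimes>\<^bsub>lie_of U\<^esub> y) h"
          using U by (simp only: uact_bracket lx ly uact_g_add) (simp only: algebra_simps)
      next
        fix g assume "g \<in> A"
        then show "dp_nth (uact 1 (x \<otimes>\<^bsub>lie_of U\<^esub> y) g) (N - 1) = 0"
          using xy U by (simp add: primitive_def uact_bracket uact_A)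
      qed
    qed
    show "\<forall>x\<in>?P. x [^]\<^bsub>U\<^esub> p \<in> ?P"
    proof (intro ballI CollectI conjI)
      fix x assume "x \<in> ?P"
      then have x: "x \<in> carrier U" "primitive x" by auto
      show "x [^]\<^bsub>U\<^esub> p \<in> carrier U" using uact_pow[OF x(1)] by blast
      have ch: "of_nat p = (0 :: 'k dps)"
        using of_nat_dps_char[where 'a='k] char_p by simp
      have "(uact (a + b) x ^^ p) (g * h) = (uact a x ^^ p) g * h + g * (uact b x ^^ p) h" for a b g h
        by (rule leibniz_pow_char[where B = "(*)", OF prime_p ch])
          (use x in \<open>simp_all add: uact_g_add primitive_def\<close>)
      moreover have "dp_nth ((uact 1 x ^^ p) g) (N - 1) = 0" if "g \<in> A" for g
      proof -
        have "(uact 1 x ^^ q) g \<in> A" for q using that x by (induction q) (auto simp: uact_A)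
        \<comment> \<open>The outermost of the Suc q applications already removes the top
          coefficient; p is positive, so this covers the p-th power.\<close>
        then have "dp_nth ((uact 1 x ^^ Suc q) g) (N - 1) = 0" for q using x by (simp add: primitive_def)
        from this[of "p - 1"] show ?thesis using N_facts(1) by (simp only: Suc_diff_1)
      qed
      ultimately show "primitive (x [^]\<^bsub>U\<^esub> p)" using uact_pow[OF x(1)] by (simp add: primitive_def)
    qed
  qed
  then show "u \<in> carrier U" "primitive u" using assms by auto
qed

lemma HW_simps: "x \<oplus>\<^bsub>HW\<^esub> y = x \<oplus>\<^bsub>U\<^esub> y" "c \<odot>\<^bsub>HW\<^esub> x = c \<odot>\<^bsub>U\<^esub> x" "x \<otimes>\<^bsub>HW\<^esub> y = x \<otimes>\<^bsub>lie_of U\<^esub> y"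
  by (simp_all add: zass_hat_def p_subalg_gen_def) (simp_all add: lie_of_def)

end

section \<open>Comparison of \<phi> with the powers of \<partial>\<close>

locale zass_phi = zass_ctx p m "TYPE('k::field)" for p m :: nat +
  fixes \<phi> :: "(((nat \<Rightarrow> 'k::field) \<Rightarrow> nat \<Rightarrow> 'k) \<Rightarrow> (nat \<Rightarrow> 'k) \<Rightarrow> nat \<Rightarrow> 'k) \<Rightarrow> 'k zenv"
  assumes phi: "\<phi> \<in> envelope_homs p m"
begin

abbreviation L where "L \<equiv> rzass p m :: ('k, _) module"

lemma KA_L [simp]: "f \<in> A \<Longrightarrow> KA c f \<in> carrier L"
  unfolding rzass_carrier by blast

lemma phi_lin: "\<phi> \<in> lin_maps L HW"
  using phi by (simp add: envelope_homs_def lie_homs_def)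

lemma phi_closed: "x \<in> carrier L \<Longrightarrow> \<phi> x \<in> carrier HW"
  using lin_mapsD(1)[OF phi_lin] .

lemma phi_U: "f \<in> A \<Longrightarrow> \<phi> (KA c f) \<in> carrier U"
  by (intro HW_primitive(1) phi_closed KA_L)

lemma phi_bracket: "x \<in> carrier L \<Longrightarrow> y \<in> carrier L \<Longrightarrow> \<phi> (x \<otimes>\<^bsub>L\<^esub> y) = \<phi> x \<otimes>\<^bsub>lie_of U\<^esub> \<phi> y"
  using phi by (simp add: envelope_homs_def lie_homs_def HW_simps)

lemma phi_ad: "f \<in> A \<Longrightarrow> \<phi> (KA (\<lambda>_. 0) f) = ein f"
  using phi by (simp add: envelope_homs_def ad_eq[symmetric])

lemma phi_split: "f \<in> A \<Longrightarrow> \<phi> (KA c f) = \<phi> (KA c 0) \<oplus>\<^bsub>U\<^esub> ein f"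
  using lin_mapsD(2)[OF phi_lin, of "KA c 0" "KA (\<lambda>_. 0) f"]
  by (simp add: rzass_simps HW_simps phi_ad)

text \<open>
  The difference between the actions of \<open>\<phi> x\<close> and \<open>x\<close> on densities, for \<open>x\<close> in the span of the
  \<open>\<partial>\<^sup>q\<close> with \<open>q = p ^ r\<close>.
\<close>

definition defect :: "(nat \<Rightarrow> 'k) \<Rightarrow> 'k \<Rightarrow> 'k dps \<Rightarrow> 'k dps" where
  "defect c \<mu> y = uact \<mu> (\<phi> (KA c 0)) y - RD c y"

lemma defect_leibniz: "defect c (a + b) (g * h) = defect c a g * h + g * defect c b h"
proof -
  have "primitive (\<phi> (KA c 0))" by (intro HW_primitive(2) phi_closed KA_L) simp
  then have "uact (a + b) (\<phi> (KA c 0)) (g * h) = uact a (\<phi> (KA c 0)) g * h + g * uact b (\<phi> (KA c 0)) h"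
    by (simp add: primitive_def)
  then show ?thesis by (simp add: defect_def RD_times algebra_simps)
qed

text \<open>Both \<phi>(x) and x have the same bracket with f\<partial>, the former because \<phi>
  is a homomorphism fixing W(m). Their difference therefore commutes with W(m).\<close>

lemma defect_commute: "f \<in> A \<Longrightarrow> defect c \<mu> (dact \<mu> f y) = dact \<mu> f (defect c \<mu> y)"
proof -
  assume f: "f \<in> A"
  have "KA c 0 \<otimes>\<^bsub>L\<^esub> KA (\<lambda>_. 0) f = KA (\<lambda>_. 0) (RD c f)"
    using f by (simp add: rzass_simps rdd_linear br_simps)
  then have "\<phi> (KA c 0) \<otimes>\<^bsub>lie_of U\<^esub> ein f = ein (RD c f)"
    using phi_bracket[of "KA c 0" "KA (\<lambda>_. 0) f"] f by (simp add: phi_ad)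
  then have "uact \<mu> (ein (RD c f)) y = uact \<mu> (\<phi> (KA c 0)) (uact \<mu> (ein f) y) - uact \<mu> (ein f) (uact \<mu> (\<phi> (KA c 0)) y)"
    using uact_bracket[of "\<phi> (KA c 0)" "ein f" \<mu> y] f by (simp add: phi_U ein_closed)
  then have "dact \<mu> (RD c f) y = uact \<mu> (\<phi> (KA c 0)) (dact \<mu> f y) - dact \<mu> f (uact \<mu> (\<phi> (KA c 0)) y)"
    using f by (simp add: uact_in)
  then show ?thesis by (simp add: defect_def dact_linear RD_dact algebra_simps)
qed

lemma defect_0: "defect c \<mu> 0 = 0"
  using uact_g_smult[of "\<phi> (KA c 0)" \<mu> 0 0] by (simp add: defect_def rdd_linear phi_U)

text \<open>In weight 0 the defect is a derivation, so it kills 1; then its value on x is killed by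
  \<partial>, and x = (x\<partial>) x forces that value to be 0. Every g equals (g\<partial>) x, so
  the defect vanishes throughout.\<close>

lemma defect_zero:
  assumes g: "g \<in> A"
  shows "defect c 0 g = 0"
proof -
  have 1: "defect c 0 1 = 0" using defect_leibniz[of c 0 0 1 1] by simp
  have x: "dact 0 (dpX (Suc 0)) (dpX (Suc 0)) = (dpX (Suc 0) :: 'k dps)" by (simp add: dact_def)
  have "dd (defect c 0 (dpX (Suc 0))) = 0"
    using defect_commute[of 1 c 0 "dpX (Suc 0)"] 1 by (simp add: dact_linear)
  then have "defect c 0 (dpX (Suc 0)) = 0"
    using defect_commute[of "dpX (Suc 0)" c 0 "dpX (Suc 0)"] x by (simp add: dact_def)
  moreover have "dact 0 g (dpX (Suc 0)) = g" by (simp add: dact_def)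
  ultimately show ?thesis using defect_commute[OF g, of c 0 "dpX (Suc 0)"] by (simp add: dact_linear)
qed

definition defect_scalar :: "(nat \<Rightarrow> 'k) \<Rightarrow> 'k \<Rightarrow> 'k" where
  "defect_scalar c \<mu> = dp_nth (defect c \<mu> 1) 0"

lemma defect_one: "defect c \<mu> 1 = dpC (defect_scalar c \<mu>)"
proof -
  have "dd (defect c \<mu> 1) = 0" using defect_commute[of 1 c \<mu> 1] by (simp add: dact_linear defect_0)
  then show ?thesis unfolding defect_scalar_def by (rule dd_eq_0)
qed

text \<open>A density g of weight \<mu> is the function g, of weight 0, times the density 1 of
  weight \<mu>; the first factor has no defect.\<close>

lemma defect_eq_scalar: "g \<in> A \<Longrightarrow> defect c \<mu> g = dpC (defect_scalar c \<mu>) * g"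
  using defect_leibniz[of c 0 \<mu> g 1] defect_zero[of g c] by (simp add: defect_one mult.commute)

lemma defect_scalar_add: "defect_scalar c (a + b) = defect_scalar c a + defect_scalar c b"
proof -
  have "dpC (defect_scalar c (a + b)) = dpC (defect_scalar c a + defect_scalar c b)"
    using defect_leibniz[of c a b 1 1] by (simp add: defect_one)
  then show ?thesis by (simp only: dpC_eq_iff)
qed

text \<open>\<open>RD c\<close> lowers degrees, so the top coefficient of the action of \<phi>(x) on
  \<open>\<tau>\<close> is the scalar itself. Primitive elements act on weight 1 by total
  derivatives, which have no top coefficient.\<close>

lemma defect_scalar_1: "defect_scalar c 1 = 0"
proof -
  have "primitive (\<phi> (KA c 0))" by (intro HW_primitive(2) phi_closed KA_L) simp
  then have "dp_nth (uact 1 (\<phi> (KA c 0)) \<tau>) (N - 1) = 0" by (simp add: primitive_def)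
  moreover have "uact 1 (\<phi> (KA c 0)) \<tau> = RD c \<tau> + dpC (defect_scalar c 1) * \<tau>"
    using defect_eq_scalar[of \<tau> c 1] by (simp add: defect_def algebra_simps)
  moreover have "dp_nth (RD c \<tau>) (N - 1) = 0"
    by (auto simp: rdd_def intro!: sum.neutral)
  ultimately show ?thesis by simp
qed

text \<open>Additivity in the weight, together with the value 0 at the weights 0 and 1. These four
  weights are the ones occurring in \<open>special\<close>.\<close>

lemma defect_scalar_prime_field: "\<mu> \<in> {0, 1, 2, -1} \<Longrightarrow> defect_scalar c \<mu> = 0"
proof -
  have 0: "defect_scalar c 0 = 0" using defect_zero[OF A_1(1), of c] by (simp add: defect_scalar_def)
  have "defect_scalar c 2 = 0" using defect_scalar_add[of c 1 1] defect_scalar_1[of c] by simp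
  moreover have "defect_scalar c (-1) = 0" using defect_scalar_add[of c 1 "-1"] defect_scalar_1[of c] 0 by simp
  ultimately show "\<mu> \<in> {0, 1, 2, -1} \<Longrightarrow> defect_scalar c \<mu> = 0" using 0 defect_scalar_1[of c] by auto
qed

definition R :: "'k \<Rightarrow> (nat \<Rightarrow> 'k) \<Rightarrow> 'k dps \<Rightarrow> 'k dps \<Rightarrow> 'k dps" where
  "R \<mu> c f y = uact \<mu> (\<phi> (KA c f)) y"

text \<open>The choice of \<phi> enters the module structure only through a scalar.\<close>

lemma R_eq: "f \<in> A \<Longrightarrow> y \<in> A \<Longrightarrow> R \<mu> c f y = RD c y + dpC (defect_scalar c \<mu>) * y + dact \<mu> f y"
  unfolding R_def phi_split
  using defect_eq_scalar[of y c \<mu>] by (simp add: uact_add phi_U ein_closed uact_in defect_def algebra_simps)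

lemma R_A: "f \<in> A \<Longrightarrow> y \<in> A \<Longrightarrow> R \<mu> c f y \<in> A"
  unfolding R_def by (intro uact_A phi_U)

lemma R_eq_special: "\<mu> \<in> {0, 1, 2, -1} \<Longrightarrow> f \<in> A \<Longrightarrow> y \<in> A \<Longrightarrow> R \<mu> c f y = RD c y + dact \<mu> f y"
  by (simp add: R_eq defect_scalar_prime_field)

end

context zass_ctx
begin

section \<open>The first cohomology space\<close>

lemma special_pos: "special \<mu> k \<Longrightarrow> k \<ge> 1"
  unfolding special_def by (auto simp: Suc_le_eq)

lemma special_1: "special \<mu> 1 \<Longrightarrow> \<mu> = 0"
proof -
  have "1 \<noteq> p ^ r" if "r \<ge> 1" for r using p_pow_gt_1[OF that] by simp
  then show "special \<mu> 1 \<Longrightarrow> \<mu> = 0" unfolding special_def by auto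
qed

lemma special_mu: "special \<mu> k \<Longrightarrow> \<mu> \<in> {0, 1, 2, -1}"
  unfolding special_def by auto

text \<open>f', f'' dx and f''' (dx)^2 are the classical cocycles of vector fields on the line, the
  last one the infinitesimal Schwarzian. In weight -1 the statement is that \<partial>^q is a
  derivation of the bracket.\<close>

lemma special_cocycle:
  assumes "special \<mu> k"
  shows "(dd ^^ k) (br f g) = dact \<mu> f ((dd ^^ k) g) - dact \<mu> g ((dd ^^ k) f)"
  using assms unfolding special_def
proof (elim disjE exE conjE)
  assume "k = 1" "\<mu> = 0"
  then show ?thesis by (simp add: br_def dact_def algebra_simps)
next
  assume "k = 2" "\<mu> = 1"
  then show ?thesis by (simp add: br_def dact_def algebra_simps numeral_2_eq_2)
next
  assume k: "k = 3" "\<mu> = 2"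
  have "dpC (2 :: 'k) = 1 + 1" using dpC_simps(3)[of "1 :: 'k" 1] by simp
  then show ?thesis using k by (simp add: br_def dact_def algebra_simps numeral_3_eq_3)
next
  fix r assume "k = p ^ r" "\<mu> = -1"
  then show ?thesis
    by (simp add: dact_neg_1) (simp add: br_def dd_pow_prime_pow_times[OF prime_p char_p] dd_dd_pow algebra_simps)
qed

lemma RD_dd_pow: "RD c ((dd ^^ k) g) = (dd ^^ k) (RD c g)"
  by (simp add: rdd_def dd_pow_commute[of _ k])

lemma RD_dact_commutator:
  "(RD c (RD d x + dact \<mu> g x) + dact \<mu> f (RD d x + dact \<mu> g x)) - (RD d (RD c x + dact \<mu> f x) + dact \<mu> g (RD c x + dact \<mu> f x))
    = dact \<mu> (RD c g - RD d f + br f g) x"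
  by (simp add: rdd_linear RD_dact dact_linear dact_br rdd_commute[of p m c d] algebra_simps)

text \<open>Each \<partial>^q moves x^(N) into \<open>A\<close>, so the coboundary of x^(N) has
  values in \<open>A\<close> on the whole restricted algebra in weight 0.\<close>

lemma RD_dpX_N: "RD c (dpX N) \<in> A"
proof -
  have "(dd ^^ (p ^ r)) (dpX N) \<in> A" if "r \<in> {1..<m}" for r
  proof -
    have "N - p ^ r < N" by (rule diff_less) simp_all
    then show ?thesis by (simp add: dd_pow_dpX)
  qed
  then show ?thesis unfolding rdd_def by (intro dpA_sum) auto
qed

lemma ddX_N: "dd (dpX N) = (\<tau> :: 'k dps)"
  by (simp add: dd_dpX)

definition unit_vec :: "nat \<Rightarrow> nat \<Rightarrow> 'k" where "unit_vec r = (\<lambda>s. if s = r then 1 else 0)"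

lemma RD_unit_vec: "r \<in> {1..<m} \<Longrightarrow> RD (unit_vec r) g = (dd ^^ (p ^ r)) g"
proof -
  assume r: "r \<in> {1..<m}"
  have "RD (unit_vec r) g = (\<Sum>s\<in>{1..<m}. if s = r then (dd ^^ (p ^ r)) g else 0)"
    unfolding rdd_def unit_vec_def by (intro sum.cong) auto
  then show ?thesis using r by simp
qed

text \<open>A functional of the family c that sees only the entries 1, ..., m - 1 is determined by
  its values on the \<partial>^q.\<close>

lemma linear_on_unit_vec:
  fixes w :: "(nat \<Rightarrow> 'k) \<Rightarrow> 'k"
  assumes add: "\<And>c d. w (\<lambda>r. c r + d r) = w c + w d" and smult: "\<And>a c. w (\<lambda>r. a * c r) = a * w c"
    and unit_vec: "\<And>r. r \<in> {1..<m} \<Longrightarrow> w (unit_vec r) = 0"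
    and cong: "\<And>c d. (\<And>r. r \<in> {1..<m} \<Longrightarrow> c r = d r) \<Longrightarrow> w c = w d"
  shows "w c = 0"
proof -
  have "w (\<lambda>r. if r \<in> S then c r else 0) = 0" if "finite S" "S \<subseteq> {1..<m}" for S
    using that
  proof (induction S rule: finite_induct)
    case empty
    show ?case using smult[of 0 "\<lambda>_. 0"] by simp
  next
    case (insert s S)
    have "(\<lambda>r. if r \<in> insert s S then c r else 0) = (\<lambda>r. (if r \<in> S then c r else 0) + c s * unit_vec s r)"
      using insert.hyps by (auto simp: unit_vec_def)
    then show ?case using insert by (simp add: add smult unit_vec del: insert_iff)
  qed
  from this[of "{1..<m}"] have "w (\<lambda>r. if r \<in> {1..<m} then c r else 0) = 0" by simp
  moreover have "w c = w (\<lambda>r. if r \<in> {1..<m} then c r else 0)" by (rule cong) simp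
  ultimately show ?thesis by simp
qed

definition vinv :: "'k \<Rightarrow> ('k zenv \<times> 'k \<Rightarrow> 'k) set \<Rightarrow> 'k dps" where
  "vinv lam = the_inv_into A (vb lam)"

lemma vinv_vb [simp]: "g \<in> A \<Longrightarrow> vinv lam (vb lam g) = g"
  unfolding vinv_def by (rule the_inv_into_f_f) (auto simp: inj_on_def vb_inj)

lemma vb_vinv: "v \<in> carrier (BV lam) \<Longrightarrow> vb lam (vinv lam v) = v" "v \<in> carrier (BV lam) \<Longrightarrow> vinv lam v \<in> A"
  by (auto simp: BV_carrier)

lemma vb_closed: "g \<in> A \<Longrightarrow> vb lam g \<in> carrier (BV lam)"
  by (simp add: BV_carrier)

lemma vb_minus: "g \<in> A \<Longrightarrow> h \<in> A \<Longrightarrow> vb lam g \<ominus>\<^bsub>BV lam\<^esub> vb lam h = vb lam (g - h)"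
  by (simp add: vs_minus[OF BV_vs] vb_closed vb_smult vb_add)

end

section \<open>Cochains on the restricted algebra, written with values in \<open>A\<close>\<close>

context zass_phi
begin

lemma L_ops: "x \<in> carrier L \<Longrightarrow> y \<in> carrier L \<Longrightarrow> x \<oplus>\<^bsub>L\<^esub> y \<in> carrier L"
  "x \<in> carrier L \<Longrightarrow> a \<odot>\<^bsub>L\<^esub> x \<in> carrier L"
  unfolding rzass_carrier[of] by (auto simp: rzass_simps) (metis dpA_simps(2), metis dpA_simps(5))

lemma L_cases:
  assumes "x \<in> carrier L" obtains c f where "f \<in> A" "x = KA c f"
  using assms unfolding rzass_carrier by blast

abbreviation rho where "rho lam \<equiv> \<lambda>x. baby_verma_rep p m lam (\<phi> x)"
abbreviation HS where "HS lam \<equiv> hom_space L (BV lam)"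

definition cocycles :: "'k \<Rightarrow> (_ \<Rightarrow> ('k zenv \<times> 'k \<Rightarrow> 'k) set) set" where
  "cocycles lam = {f \<in> lin_maps L (BV lam). \<forall>x\<in>carrier L. \<forall>y\<in>carrier L. ce_d1 L (BV lam) (rho lam) f x y = \<zero>\<^bsub>BV lam\<^esub>}"

definition coboundaries :: "'k \<Rightarrow> (_ \<Rightarrow> ('k zenv \<times> 'k \<Rightarrow> 'k) set) set" where
  "coboundaries lam = ce_d0 L (BV lam) (rho lam) ` carrier (BV lam)"

abbreviation cocycle_space where "cocycle_space lam \<equiv> (HS lam)\<lparr>carrier := cocycles lam\<rparr>"

lemma H1_eq: "H1 L (BV lam) (rho lam) = quot_module (cocycle_space lam) (coboundaries lam)"
  by (simp only: H1_def cocycles_def coboundaries_def)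

text \<open>The value of a cochain on the derivation \<open>KA c f\<close>, transported to
  \<open>A\<close>; this turns the cocycle condition into an identity between divided power
  series.\<close>

definition cval :: "'k \<Rightarrow> (_ \<Rightarrow> ('k zenv \<times> 'k \<Rightarrow> 'k) set) \<Rightarrow> (nat \<Rightarrow> 'k) \<Rightarrow> 'k dps \<Rightarrow> 'k dps" where
  "cval lam \<psi> c f = vinv lam (\<psi> (KA c f))"

lemma rho_vb: "f \<in> A \<Longrightarrow> g \<in> A \<Longrightarrow> rho lam (KA c f) (vb lam g) = vb lam (R (lam + 1) c f g)"
  unfolding R_def by (rule BV_rep[OF phi_U])

lemma d1_vb:
  assumes "f \<in> A" "g \<in> A" and \<psi>: "\<And>c f. f \<in> A \<Longrightarrow> \<psi> (KA c f) = vb lam (F c f)" "\<And>c f. f \<in> A \<Longrightarrow> F c f \<in> A"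
  shows "ce_d1 L (BV lam) (rho lam) \<psi> (KA c f) (KA d g) =
    vb lam (R (lam + 1) c f (F d g) - R (lam + 1) d g (F c f) - F (\<lambda>_. 0) (RD c g - RD d f + br f g))"
proof -
  have b: "RD c g - RD d f + br f g \<in> A" by (intro dpA_simps A_RD A_br assms(1,2))
  have 1: "\<psi> (KA c f) = vb lam (F c f)" "\<psi> (KA d g) = vb lam (F d g)" using assms(1,2) by (simp_all only: \<psi>(1))
  have 2: "\<psi> (KA c f \<otimes>\<^bsub>L\<^esub> KA d g) = vb lam (F (\<lambda>_. 0) (RD c g - RD d f + br f g))"
    unfolding rzass_simps(3)[OF assms(1,2)] by (rule \<psi>(1)[OF b])
  have 3: "F c f \<in> A" "F d g \<in> A" "F (\<lambda>_. 0) (RD c g - RD d f + br f g) \<in> A"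
    by (intro \<psi>(2) assms(1,2) b)+
  have "ce_d1 L (BV lam) (rho lam) \<psi> (KA c f) (KA d g) =
    rho lam (KA c f) (vb lam (F d g)) \<ominus>\<^bsub>BV lam\<^esub> rho lam (KA d g) (vb lam (F c f))
      \<ominus>\<^bsub>BV lam\<^esub> vb lam (F (\<lambda>_. 0) (RD c g - RD d f + br f g))"
    unfolding ce_d1_def using KA_L[OF assms(1)] KA_L[OF assms(2)] by (simp only: restrict_apply' 1 2)
  also have "\<dots> = vb lam (R (lam + 1) c f (F d g) - R (lam + 1) d g (F c f) - F (\<lambda>_. 0) (RD c g - RD d f + br f g))"
    using assms(1,2) 3 by (simp only: rho_vb vb_minus R_A dpA_simps)
  finally show ?thesis .
qed

lemma cval_closed: "\<psi> \<in> lin_maps L (BV lam) \<Longrightarrow> f \<in> A \<Longrightarrow> cval lam \<psi> c f \<in> A"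
  unfolding cval_def by (rule vb_vinv(2)[OF lin_mapsD(1)[OF _ KA_L]])

lemma cval_vb: "\<psi> \<in> lin_maps L (BV lam) \<Longrightarrow> f \<in> A \<Longrightarrow> \<psi> (KA c f) = vb lam (cval lam \<psi> c f)"
  unfolding cval_def by (rule vb_vinv(1)[symmetric, OF lin_mapsD(1)[OF _ KA_L]])

lemma cval_add: "\<psi> \<in> lin_maps L (BV lam) \<Longrightarrow> f \<in> A \<Longrightarrow> g \<in> A \<Longrightarrow>
    cval lam \<psi> (\<lambda>r. c r + d r) (f + g) = cval lam \<psi> c f + cval lam \<psi> d g"
  using lin_mapsD(2)[of \<psi> L "BV lam" "KA c f" "KA d g"]
  by (simp add: rzass_simps cval_vb vb_add cval_closed vb_inj)

lemma cval_smult: "\<psi> \<in> lin_maps L (BV lam) \<Longrightarrow> f \<in> A \<Longrightarrow>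
    cval lam \<psi> (\<lambda>r. a * c r) (dpC a * f) = dpC a * cval lam \<psi> c f"
  using lin_mapsD(3)[of \<psi> L "BV lam" "KA c f" a]
  by (simp add: rzass_simps cval_vb vb_smult cval_closed vb_inj)

lemma cval_cong: "(\<And>r. r \<in> {1..<m} \<Longrightarrow> c r = d r) \<Longrightarrow> f \<in> A \<Longrightarrow> cval lam \<psi> c f = cval lam \<psi> d f"
  using KA_inj[of f f c d] by (simp add: cval_def)

lemma cocycles_cval:
  assumes "\<psi> \<in> cocycles lam" "f \<in> A" "g \<in> A"
  shows "cval lam \<psi> (\<lambda>_. 0) (RD c g - RD d f + br f g) = R (lam + 1) c f (cval lam \<psi> d g) - R (lam + 1) d g (cval lam \<psi> c f)"
proof -
  have lin: "\<psi> \<in> lin_maps L (BV lam)" using assms by (simp add: cocycles_def)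
  have "ce_d1 L (BV lam) (rho lam) \<psi> (KA c f) (KA d g) = \<zero>\<^bsub>BV lam\<^esub>"
    using assms unfolding cocycles_def by simp
  then have "vb lam (R (lam + 1) c f (cval lam \<psi> d g) - R (lam + 1) d g (cval lam \<psi> c f)
      - cval lam \<psi> (\<lambda>_. 0) (RD c g - RD d f + br f g)) = vb lam 0"
    using d1_vb[OF assms(2,3), of \<psi> lam "cval lam \<psi>" c d] cval_vb[OF lin] cval_closed[OF lin] by (simp add: vb_zero)
  then show ?thesis using assms cval_closed[OF lin] by (subst (asm) vb_inj) (simp_all add: R_A)
qed

lemma HS_vs: "vs (HS lam)"
  by (rule hom_space_vs[OF L_ops BV_vs])

text \<open>The pair \<open>(c, f)\<close> is determined by \<open>KA c f\<close> only up to the values of \<open>c\<close> outside \<open>{1..<m}\<close>.\<close>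

definition top_indep :: "((nat \<Rightarrow> 'k) \<Rightarrow> 'k dps \<Rightarrow> 'k dps) \<Rightarrow> bool" where
  "top_indep F \<longleftrightarrow> (\<forall>c d f. (\<forall>r\<in>{1..<m}. c r = d r) \<longrightarrow> F c f = F d f)"

text \<open>The inverse passage: \<open>F\<close> is evaluated at a chosen pair representing x, and
  \<open>top_indep\<close> makes the choice irrelevant.\<close>

definition cochain :: "'k \<Rightarrow> ((nat \<Rightarrow> 'k) \<Rightarrow> 'k dps \<Rightarrow> 'k dps) \<Rightarrow> _ \<Rightarrow> ('k zenv \<times> 'k \<Rightarrow> 'k) set" where
  "cochain lam F = (\<lambda>x\<in>carrier L. vb lam (case (SOME cf. snd cf \<in> A \<and> x = KA (fst cf) (snd cf)) of (c, f) \<Rightarrow> F c f))"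

lemma cochain_apply:
  assumes cong: "top_indep F" and f: "f \<in> A"
  shows "cochain lam F (KA c f) = vb lam (F c f)"
proof -
  define cf where "cf = (SOME cf. snd cf \<in> A \<and> KA c f = KA (fst cf) (snd cf))"
  have "snd cf \<in> A \<and> KA c f = KA (fst cf) (snd cf)"
    unfolding cf_def by (rule someI[of _ "(c, f)"]) (simp add: f)
  then have cf: "snd cf = f" "\<And>r. r \<in> {1..<m} \<Longrightarrow> c r = fst cf r"
    using KA_inj[of f "snd cf" c "fst cf"] f by auto
  have "F c f = F (fst cf) (snd cf)" using cong cf unfolding top_indep_def by auto
  then show ?thesis using f by (simp add: cochain_def cf_def[symmetric] split_beta)
qed

lemma cval_cochain: 
  assumes cong: "top_indep F" and "f \<in> A" "F c f \<in> A"
  shows "cval lam (cochain lam F) c f = F c f"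
  using cochain_apply[OF cong assms(2)] assms(3) by (simp add: cval_def)

lemma cocyclesI:
  assumes lin: "\<psi> \<in> lin_maps L (BV lam)"
    and coc: "\<And>c d f g. f \<in> A \<Longrightarrow> g \<in> A \<Longrightarrow>
      cval lam \<psi> (\<lambda>_. 0) (RD c g - RD d f + br f g) = R (lam + 1) c f (cval lam \<psi> d g) - R (lam + 1) d g (cval lam \<psi> c f)"
  shows "\<psi> \<in> cocycles lam"
proof -
  have "ce_d1 L (BV lam) (rho lam) \<psi> x y = \<zero>\<^bsub>BV lam\<^esub>" if xy: "x \<in> carrier L" "y \<in> carrier L" for x y
  proof -
    obtain c f where cf: "f \<in> A" "x = KA c f" using xy(1) by (rule L_cases)
    obtain d g where dg: "g \<in> A" "y = KA d g" using xy(2) by (rule L_cases)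
    show ?thesis unfolding cf(2) dg(2)
      using d1_vb[OF cf(1) dg(1), of \<psi> lam "cval lam \<psi>" c d] cval_vb[OF lin] cval_closed[OF lin] coc[OF cf(1) dg(1), of c d]
      by (simp add: vb_zero)
  qed
  then show ?thesis using lin by (simp add: cocycles_def)
qed

lemma cochain_cocycle:
  assumes cong: "top_indep F"
    and closed: "\<And>c f. f \<in> A \<Longrightarrow> F c f \<in> A"
    and add: "\<And>c d f g. F (\<lambda>r. c r + d r) (f + g) = F c f + F d g"
    and smult: "\<And>a c f. F (\<lambda>r. a * c r) (dpC a * f) = dpC a * F c f"
    and coc: "\<And>c d f g. f \<in> A \<Longrightarrow> g \<in> A \<Longrightarrow>
      F (\<lambda>_. 0) (RD c g - RD d f + br f g) = R (lam + 1) c f (F d g) - R (lam + 1) d g (F c f)"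
  shows "cochain lam F \<in> cocycles lam"
proof -
  note ap = cochain_apply[OF cong]
  have cl: "cochain lam F x \<in> carrier (BV lam)" if x: "x \<in> carrier L" for x
  proof -
    obtain c f where "f \<in> A" "x = KA c f" using x by (rule L_cases)
    then show ?thesis using ap[of f lam c] closed by (simp add: vb_closed)
  qed
  show ?thesis
  proof (rule cocyclesI)
    fix c d f g assume fg: "f \<in> A" "g \<in> A"
    then have b: "RD c g - RD d f + br f g \<in> A" by simp
    have Y: "cval lam (cochain lam F) c f = F c f" if "f \<in> A" for c f
      by (rule cval_cochain[OF cong that closed[OF that]])
    show "cval lam (cochain lam F) (\<lambda>_. 0) (RD c g - RD d f + br f g) =
       R (lam + 1) c f (cval lam (cochain lam F) d g) - R (lam + 1) d g (cval lam (cochain lam F) c f)"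
      unfolding Y[OF fg(1)] Y[OF fg(2)] Y[OF b] by (rule coc[OF fg])
  next
  show "cochain lam F \<in> lin_maps L (BV lam)"
    unfolding lin_maps_iff PiE_def
  proof (intro conjI ballI allI IntI Pi_I)
    show "cochain lam F \<in> extensional (carrier L)" by (simp add: cochain_def)
    fix x assume x: "x \<in> carrier L"
    then obtain c f where cf: "f \<in> A" "x = KA c f" by (rule L_cases)
    show "cochain lam F x \<in> carrier (BV lam)" by (rule cl[OF x])
    show "cochain lam F (a \<odot>\<^bsub>L\<^esub> x) = a \<odot>\<^bsub>BV lam\<^esub> cochain lam F x" for a
      using cf by (simp add: rzass_simps ap smult vb_smult)
    fix y assume "y \<in> carrier L"
    then obtain d g where dg: "g \<in> A" "y = KA d g" by (rule L_cases)
    show "cochain lam F (x \<oplus>\<^bsub>L\<^esub> y) = cochain lam F x \<oplus>\<^bsub>BV lam\<^esub> cochain lam F y"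
      using cf dg by (simp add: rzass_simps ap add vb_add)
  qed
  qed
qed

lemma R_lin:
  assumes "f \<in> A"
  shows "R \<mu> c f (x + y) = R \<mu> c f x + R \<mu> c f y" "R \<mu> c f (dpC a * x) = dpC a * R \<mu> c f x" "R \<mu> c f 0 = 0"
  using assms uact_g_smult[OF phi_U[OF assms], of \<mu> c 0 0]
  by (simp_all add: R_def uact_g_add uact_g_smult phi_U)

lemma cocycles_submodule: "submodule (cocycles lam) scalars (HS lam)"
proof -
  show ?thesis
    unfolding submodule_iff[OF HS_vs]
  proof (intro conjI ballI allI)
    show "cocycles lam \<subseteq> carrier (HS lam)" by (auto simp: cocycles_def)
    have z: "\<zero>\<^bsub>HS lam\<^esub> \<in> lin_maps L (BV lam)" using vs_zero_closed[OF HS_vs, of lam] by simp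
    have Yz: "cval lam \<zero>\<^bsub>HS lam\<^esub> c f = 0" if "f \<in> A" for c f
      using that vinv_vb[OF dpA_simps(1), of lam] by (simp add: cval_def vb_zero)
    show "\<zero>\<^bsub>HS lam\<^esub> \<in> cocycles lam"
      by (rule cocyclesI[OF z]) (simp only: Yz R_lin A_RD A_br dpA_simps diff_self)
  next
    fix \<psi> \<chi> assume *: "\<psi> \<in> cocycles lam" "\<chi> \<in> cocycles lam"
    then have lin: "\<psi> \<in> lin_maps L (BV lam)" "\<chi> \<in> lin_maps L (BV lam)" by (simp_all add: cocycles_def)
    have l: "\<psi> \<oplus>\<^bsub>HS lam\<^esub> \<chi> \<in> lin_maps L (BV lam)" using vs_add[OF HS_vs, of \<psi> lam \<chi>] lin by simp
    have Y: "cval lam (\<psi> \<oplus>\<^bsub>HS lam\<^esub> \<chi>) c f = cval lam \<psi> c f + cval lam \<chi> c f" if "f \<in> A" for c f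
      using that lin cval_closed[OF lin(1) that] cval_closed[OF lin(2) that]
      by (subst cval_def) (simp add: cval_vb vb_add)
    from l show "\<psi> \<oplus>\<^bsub>HS lam\<^esub> \<chi> \<in> cocycles lam"
    proof (rule cocyclesI)
      fix c d f g assume fg: "f \<in> A" "g \<in> A"
      then have "RD c g - RD d f + br f g \<in> A" by simp
      then show "cval lam (\<psi> \<oplus>\<^bsub>HS lam\<^esub> \<chi>) (\<lambda>_. 0) (RD c g - RD d f + br f g) =
         R (lam + 1) c f (cval lam (\<psi> \<oplus>\<^bsub>HS lam\<^esub> \<chi>) d g) - R (lam + 1) d g (cval lam (\<psi> \<oplus>\<^bsub>HS lam\<^esub> \<chi>) c f)"
        using fg cocycles_cval[OF *(1) fg, of c d] cocycles_cval[OF *(2) fg, of c d]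
        by (simp add: Y R_lin del: hom_space_simps)
    qed
  next
    fix a \<psi> assume *: "\<psi> \<in> cocycles lam"
    then have lin: "\<psi> \<in> lin_maps L (BV lam)" by (simp add: cocycles_def)
    have l: "a \<odot>\<^bsub>HS lam\<^esub> \<psi> \<in> lin_maps L (BV lam)" using vs_smult[OF HS_vs, of \<psi> lam a] lin by simp
    have Y: "cval lam (a \<odot>\<^bsub>HS lam\<^esub> \<psi>) c f = dpC a * cval lam \<psi> c f" if "f \<in> A" for c f
      using that lin cval_closed[OF lin that] by (subst cval_def) (simp add: cval_vb vb_smult)
    from l show "a \<odot>\<^bsub>HS lam\<^esub> \<psi> \<in> cocycles lam"
    proof (rule cocyclesI)
      fix c d f g assume fg: "f \<in> A" "g \<in> A"
      then have "RD c g - RD d f + br f g \<in> A" by simp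
      then show "cval lam (a \<odot>\<^bsub>HS lam\<^esub> \<psi>) (\<lambda>_. 0) (RD c g - RD d f + br f g) =
         R (lam + 1) c f (cval lam (a \<odot>\<^bsub>HS lam\<^esub> \<psi>) d g) - R (lam + 1) d g (cval lam (a \<odot>\<^bsub>HS lam\<^esub> \<psi>) c f)"
        using fg cocycles_cval[OF * fg, of c d]
        by (simp add: Y R_lin right_diff_distrib del: hom_space_simps)
    qed
  qed
qed

lemma cocycle_space_vs: "vs (cocycle_space lam)"
  using submodule.submodule_is_module[OF cocycles_submodule HS_vs] .

lemma cval_cocycle_space:
  assumes "\<psi> \<in> cocycles lam" "\<chi> \<in> cocycles lam" "f \<in> A"
  shows "cval lam (\<psi> \<oplus>\<^bsub>cocycle_space lam\<^esub> \<chi>) c f = cval lam \<psi> c f + cval lam \<chi> c f"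
    and "cval lam (a \<odot>\<^bsub>cocycle_space lam\<^esub> \<psi>) c f = dpC a * cval lam \<psi> c f"
proof -
  have lin: "\<psi> \<in> lin_maps L (BV lam)" "\<chi> \<in> lin_maps L (BV lam)" using assms by (simp_all add: cocycles_def)
  note cl = cval_closed[OF lin(1) assms(3), of c] cval_closed[OF lin(2) assms(3), of c]
  show "cval lam (\<psi> \<oplus>\<^bsub>cocycle_space lam\<^esub> \<chi>) c f = cval lam \<psi> c f + cval lam \<chi> c f"
    using assms lin cl by (subst cval_def) (simp add: cval_vb vb_add)
  show "cval lam (a \<odot>\<^bsub>cocycle_space lam\<^esub> \<psi>) c f = dpC a * cval lam \<psi> c f"
    using assms lin cl by (subst cval_def) (simp add: cval_vb vb_smult)
qed

lemma ce_d0_apply: "f \<in> A \<Longrightarrow> g \<in> A \<Longrightarrow> ce_d0 L (BV lam) (rho lam) (vb lam g) (KA c f) = vb lam (R (lam + 1) c f g)"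
  by (simp add: ce_d0_def rho_vb)

lemma cval_d0: "f \<in> A \<Longrightarrow> g \<in> A \<Longrightarrow> cval lam (ce_d0 L (BV lam) (rho lam) (vb lam g)) c f = R (lam + 1) c f g"
  by (simp add: cval_def ce_d0_apply R_A)

lemma L_ext: "x \<in> extensional (carrier L) \<Longrightarrow> y \<in> extensional (carrier L) \<Longrightarrow>
    (\<And>c f. f \<in> A \<Longrightarrow> x (KA c f) = y (KA c f)) \<Longrightarrow> x = y"
  by (rule extensionalityI[of _ "carrier L"]) (auto elim: L_cases)

lemma R_lin_args:
  assumes "f \<in> A" "g \<in> A"
  shows "R \<mu> (\<lambda>r. c r + d r) (f + g) y = R \<mu> c f y + R \<mu> d g y"
    and "R \<mu> (\<lambda>r. a * c r) (dpC a * f) y = dpC a * R \<mu> c f y"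
proof -
  have "\<phi> (KA c f \<oplus>\<^bsub>L\<^esub> KA d g) = \<phi> (KA c f) \<oplus>\<^bsub>U\<^esub> \<phi> (KA d g)"
    using lin_mapsD(2)[OF phi_lin, of "KA c f" "KA d g"] assms by (simp add: HW_simps)
  then show "R \<mu> (\<lambda>r. c r + d r) (f + g) y = R \<mu> c f y + R \<mu> d g y"
    using assms by (simp add: R_def rzass_simps uact_add phi_U)
  have "\<phi> (a \<odot>\<^bsub>L\<^esub> KA c f) = a \<odot>\<^bsub>U\<^esub> \<phi> (KA c f)"
    using lin_mapsD(3)[OF phi_lin, of "KA c f" a] assms by (simp add: HW_simps)
  then show "R \<mu> (\<lambda>r. a * c r) (dpC a * f) y = dpC a * R \<mu> c f y"
    using assms by (simp add: R_def rzass_simps uact_smult phi_U)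
qed

lemma R_commutator:
  assumes "f \<in> A" "g \<in> A"
  shows "R \<mu> (\<lambda>_. 0) (RD c g - RD d f + br f g) y = R \<mu> c f (R \<mu> d g y) - R \<mu> d g (R \<mu> c f y)"
proof -
  have "\<phi> (KA c f \<otimes>\<^bsub>L\<^esub> KA d g) = \<phi> (KA c f) \<otimes>\<^bsub>lie_of U\<^esub> \<phi> (KA d g)"
    using assms by (intro phi_bracket) simp_all
  then show ?thesis using assms by (simp add: R_def rzass_simps uact_bracket phi_U)
qed

lemma R_cong: "(\<And>r. r \<in> {1..<m} \<Longrightarrow> c r = d r) \<Longrightarrow> f \<in> A \<Longrightarrow> R \<mu> c f y = R \<mu> d f y"
  using KA_inj[of f f c d] by (simp add: R_def)

lemma coboundaries_eq: "coboundaries lam = (\<lambda>g. ce_d0 L (BV lam) (rho lam) (vb lam g)) ` A"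
  by (simp add: coboundaries_def BV_carrier image_image)

lemma d0_ext: "ce_d0 L (BV lam) (rho lam) v \<in> extensional (carrier L)"
  by (simp add: ce_d0_def)

lemma d0_cocycle:
  assumes g: "g \<in> A"
  shows "ce_d0 L (BV lam) (rho lam) (vb lam g) \<in> cocycles lam" (is "?d \<in> _")
proof (rule cocyclesI)
  show "?d \<in> lin_maps L (BV lam)"
    unfolding lin_maps_iff PiE_def
  proof (intro conjI ballI allI IntI Pi_I d0_ext)
    fix x assume x: "x \<in> carrier L"
    then obtain c f where cf: "f \<in> A" "x = KA c f" by (rule L_cases)
    show "?d x \<in> carrier (BV lam)" using cf g by (simp add: ce_d0_apply vb_closed R_A)
    show "?d (a \<odot>\<^bsub>L\<^esub> x) = a \<odot>\<^bsub>BV lam\<^esub> ?d x" for a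
      using cf g by (simp add: rzass_simps ce_d0_apply R_lin_args vb_smult)
    fix y assume "y \<in> carrier L"
    then obtain d h where dh: "h \<in> A" "y = KA d h" by (rule L_cases)
    show "?d (x \<oplus>\<^bsub>L\<^esub> y) = ?d x \<oplus>\<^bsub>BV lam\<^esub> ?d y"
      using cf dh g by (simp add: rzass_simps ce_d0_apply R_lin_args vb_add)
  qed
  fix c d f h assume fh: "f \<in> A" "h \<in> A"
  then have "RD c h - RD d f + br f h \<in> A" by simp
  then show "cval lam ?d (\<lambda>_. 0) (RD c h - RD d f + br f h) =
      R (lam + 1) c f (cval lam ?d d h) - R (lam + 1) d h (cval lam ?d c f)"
    using fh g by (simp add: cval_d0 R_commutator)
qed

lemma coboundaries_submodule: "submodule (coboundaries lam) scalars (cocycle_space lam)"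
  unfolding submodule_iff[OF cocycle_space_vs] coboundaries_eq
proof (intro conjI ballI allI)
  let ?d = "\<lambda>g. ce_d0 L (BV lam) (rho lam) (vb lam g)"
  show "?d ` A \<subseteq> carrier (cocycle_space lam)" using d0_cocycle by auto
  have "\<zero>\<^bsub>cocycle_space lam\<^esub> = ?d 0"
    by (rule L_ext) (auto simp: d0_ext ce_d0_apply R_lin vb_zero)
  then show "\<zero>\<^bsub>cocycle_space lam\<^esub> \<in> ?d ` A" using dpA_simps(1) by blast
  fix x assume "x \<in> ?d ` A"
  then obtain g where g: "g \<in> A" "x = ?d g" by blast
  show "a \<odot>\<^bsub>cocycle_space lam\<^esub> x \<in> ?d ` A" for a
  proof -
    have "a \<odot>\<^bsub>cocycle_space lam\<^esub> x = ?d (dpC a * g)"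
      unfolding g(2) using g(1) by (intro L_ext) (auto simp: d0_ext ce_d0_apply R_lin vb_smult)
    then show ?thesis using g(1) dpA_simps(5) by blast
  qed
  fix y assume "y \<in> ?d ` A"
  then obtain h where h: "h \<in> A" "y = ?d h" by blast
  have "x \<oplus>\<^bsub>cocycle_space lam\<^esub> y = ?d (g + h)"
    unfolding g(2) h(2) using g(1) h(1) by (intro L_ext) (auto simp: d0_ext ce_d0_apply R_lin vb_add)
  then show "x \<oplus>\<^bsub>cocycle_space lam\<^esub> y \<in> ?d ` A" using g(1) h(1) dpA_simps(2) by blast
qed

end

section \<open>Counting the special exponents\<close>

context zass_ctx
begin

definition special_set :: "'k \<Rightarrow> nat set" where
  "special_set \<mu> = {k. k < N \<and> special \<mu> k}"

lemma p_pow_less: "p ^ r < N \<longleftrightarrow> r < m"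
  using p_gt_2 by simp

lemma card_p_powers: "card {k. k < N \<and> (\<exists>r\<ge>1. k = p ^ r)} = m - 1"
proof -
  have "{k. k < N \<and> (\<exists>r\<ge>1. k = p ^ r)} = (\<lambda>r. p ^ r) ` {1..<m}"
  proof (intro Set.set_eqI iffI)
    fix k assume "k \<in> {k. k < N \<and> (\<exists>r\<ge>1. k = p ^ r)}"
    then obtain r where "k = p ^ r" "r \<ge> 1" "k < N" by blast
    then show "k \<in> (\<lambda>r. p ^ r) ` {1..<m}" by (intro image_eqI[of _ _ r]) (simp_all only: p_pow_less atLeastLessThan_iff simp_thms)
  next
    fix k assume "k \<in> (\<lambda>r. p ^ r) ` {1..<m}"
    then obtain r where "k = p ^ r" "1 \<le> r" "r < m" by auto
    then show "k \<in> {k. k < N \<and> (\<exists>r\<ge>1. k = p ^ r)}" using p_pow_less[of r] by blast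
  qed
  moreover have "inj_on (\<lambda>r. p ^ r) {1..<m}"
    using p_gt_2 by (intro inj_onI) simp
  ultimately show ?thesis by (simp add: card_image)
qed

lemma small_ne: "n > 0 \<Longrightarrow> n < p \<Longrightarrow> (of_nat n :: 'k) \<noteq> 0"
  using of_nat_eq_0[of n] by (auto dest: dvd_imp_le)

lemma of_nat_p_minus: "j \<le> p \<Longrightarrow> (of_nat (p - j) :: 'k) = - of_nat j"
  using of_nat_eq_0[of p] by (simp add: of_nat_diff)

lemma two_ne: "(2 :: 'k) \<noteq> 0" "(1 :: 'k) \<noteq> -1" "(-1 :: 'k) \<noteq> 1" "(2 :: 'k) \<noteq> 1" "(1 :: 'k) \<noteq> 2"
proof -
  show t: "(2 :: 'k) \<noteq> 0" using small_ne[of 2] p_gt_2 by simp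
  show "(1 :: 'k) \<noteq> -1" "(-1 :: 'k) \<noteq> 1" using t by (auto simp: eq_neg_iff_add_eq_0 neg_eq_iff_add_eq_0)
  have "(2 :: 'k) - 1 \<noteq> 0" by simp
  then show "(2 :: 'k) \<noteq> 1" "(1 :: 'k) \<noteq> 2" by (metis diff_self)+
qed

lemma card_special_0: "card (special_set 0) = 1"
proof -
  have "special_set 0 = {1}"
    using two_ne(1) one_less_N(1) by (auto simp: special_set_def special_def)
  then show ?thesis by simp
qed

lemma card_special_1: "card (special_set 1) = 1"
proof -
  have "special_set 1 = {2}"
    using two_ne N_ge_3 by (auto simp: special_set_def special_def)
  then show ?thesis by simp
qed

text \<open>Weights 2 and -1 coincide exactly in characteristic 3; this separates the two cases of
  the theorem.\<close>

lemma three: "(2 :: 'k) = -1 \<longleftrightarrow> p = 3" "(-1 :: 'k) = 2 \<longleftrightarrow> p = 3"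
proof -
  have "(2 :: 'k) = -1 \<longleftrightarrow> (of_nat 3 :: 'k) = 0" by (simp add: eq_neg_iff_add_eq_0)
  also have "\<dots> \<longleftrightarrow> p dvd 3" by (rule of_nat_eq_0)
  also have "\<dots> \<longleftrightarrow> p = 3" using p_gt_2 by (auto dest: dvd_imp_le)
  finally show "(2 :: 'k) = -1 \<longleftrightarrow> p = 3" .
  then show "(-1 :: 'k) = 2 \<longleftrightarrow> p = 3" by metis
qed

lemma card_special_2: "p > 3 \<Longrightarrow> card (special_set 2) = 1"
proof -
  assume p: "p > 3"
  have "p ^ 1 \<le> p ^ m" using m_pos p_gt_2 by (intro power_increasing) (auto simp: Suc_le_eq)
  then have "3 < N" using p by simp
  then have "special_set 2 = {3}"
    using two_ne p three by (auto simp: special_set_def special_def)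
  then show ?thesis by simp
qed

text \<open>Holds for p = 3 as well: the exponent 3 then also qualifies through weight 2, but it is
  already counted as p^1.\<close>

lemma card_special_minus_1: "card (special_set (-1)) = m - 1"
proof -
  have "special_set (-1) = {k. k < N \<and> (\<exists>r\<ge>1. k = p ^ r)}"
    using two_ne three by (auto simp: special_set_def special_def intro: exI[of _ 1])
  then show ?thesis using card_p_powers by simp
qed

lemma card_special_other: "\<mu> \<notin> {0, 1, 2, -1} \<Longrightarrow> special_set \<mu> = {}"
  using special_mu[of \<mu>] by (auto simp: special_set_def)

end

section \<open>A dual basis of the cohomology\<close>

context zass_phi
begin

text \<open>
  Coordinates on cohomology classes: the coefficient of \<open>dd ^^ k\<close> (\<open>Inl k\<close>), the coefficient of the
  coboundary of \<open>dpX N\<close> (\<open>Inr 0\<close>), and the invariant added to the value on \<open>\<partial>\<^sup>q\<close> with \<open>q = p ^ r\<close>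
  (\<open>Inr r\<close>); the subtracted term makes the last one vanish on coboundaries.
\<close>

definition coord :: "'k \<Rightarrow> nat + nat \<Rightarrow> (_ \<Rightarrow> ('k zenv \<times> 'k \<Rightarrow> 'k) set) \<Rightarrow> 'k" where
  "coord lam i \<psi> = (case i of
     Inl k \<Rightarrow> dp_nth (cval lam \<psi> (\<lambda>_. 0) (dpX k)) 0
   | Inr r \<Rightarrow> if r = 0 then dp_nth (cval lam \<psi> (\<lambda>_. 0) 1) (N - 1)
       else dp_nth (cval lam \<psi> (unit_vec r) 0) 0 - dp_nth (cval lam \<psi> (\<lambda>_. 0) 1) (p ^ r - 1))"

text \<open>The operator \<partial>^k, extended by 0 to the elements \<partial>^q; the coboundary of
  x^(N); and the cochain that is 0 on W(m) and 1 on a single \<partial>^q. The last one is a cocycle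
  in weight 0 because brackets lie in W(m) and 1 is invariant there.\<close>

definition basis_cocycle :: "nat + nat \<Rightarrow> (nat \<Rightarrow> 'k) \<Rightarrow> 'k dps \<Rightarrow> 'k dps" where
  "basis_cocycle i c f = (case i of Inl k \<Rightarrow> (dd ^^ k) f
     | Inr r \<Rightarrow> if r = 0 then RD c (dpX N) + dact 0 f (dpX N) else dpC (c r))"

definition coord_index :: "'k \<Rightarrow> (nat + nat) set" where
  "coord_index \<mu> = Inl ` special_set \<mu> \<union> (if \<mu> = 0 then Inr ` {..<m} else {})"

lemma coord_index_cases:
  assumes "i \<in> coord_index \<mu>"
  obtains (Inl) k where "i = Inl k" "k < N" "special \<mu> k" | (zero) "i = Inr 0" "\<mu> = 0"
    | (Inr) r where "i = Inr r" "r \<ge> 1" "r < m" "\<mu> = 0"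
proof -
  consider k where "i = Inl k" "k < N" "special \<mu> k" | r where "i = Inr r" "r < m" "\<mu> = 0"
    using assms by (auto simp: coord_index_def special_set_def split: if_splits)
  then show thesis
  proof cases
    case (2 r)
    then show thesis using zero Inr[of r] by (cases "r = 0") auto
  qed (rule Inl)
qed

lemma coord_index_special: "i \<in> coord_index \<mu> \<Longrightarrow> \<mu> \<in> {0, 1, 2, -1}"
  by (erule coord_index_cases) (auto dest: special_mu)

lemma unit_vec_apply: "unit_vec r s = (if s = r then 1 else 0)"
  by (simp add: unit_vec_def)

lemma dact_0_dpX_N: "dact 0 f (dpX N) = f * \<tau>"
  by (simp add: dact_def ddX_N)

lemma basis_cocycle_mem:
  assumes i: "i \<in> coord_index (lam + 1)"
  shows "top_indep (basis_cocycle i)" and "f \<in> A \<Longrightarrow> basis_cocycle i c f \<in> A"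
    and "cochain lam (basis_cocycle i) \<in> cocycles lam"
proof -
  have 1: "basis_cocycle i c f = basis_cocycle i d f" if "\<And>r. r \<in> {1..<m} \<Longrightarrow> c r = d r" for c d f
    using i
  proof (cases rule: coord_index_cases)
    case zero
    have "RD c (dpX N) = RD d (dpX N)" unfolding rdd_def using that by (intro sum.cong) auto
    then show ?thesis using zero by (simp add: basis_cocycle_def)
  qed (use that in \<open>auto simp: basis_cocycle_def\<close>)
  then show ti: "top_indep (basis_cocycle i)" unfolding top_indep_def by blast
  have 2: "basis_cocycle i c f \<in> A" if "f \<in> A" for c f
    using i by (cases rule: coord_index_cases) (use that in \<open>auto simp: basis_cocycle_def dact_0_dpX_N RD_dpX_N\<close>)
  show "f \<in> A \<Longrightarrow> basis_cocycle i c f \<in> A" by (rule 2)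
  note Rs = R_eq_special[OF coord_index_special[OF i]]
  show "cochain lam (basis_cocycle i) \<in> cocycles lam"
  proof (rule cochain_cocycle)
    show "top_indep (basis_cocycle i)" by (rule ti)
    show "basis_cocycle i c f \<in> A" if "f \<in> A" for c f by (rule 2[OF that])
    show "basis_cocycle i (\<lambda>r. c r + d r) (f + g) = basis_cocycle i c f + basis_cocycle i d g" for c d f g
      by (auto simp: basis_cocycle_def rdd_linear dact_linear split: sum.splits)
    show "basis_cocycle i (\<lambda>r. a * c r) (dpC a * f) = dpC a * basis_cocycle i c f" for a c f
      by (auto simp: basis_cocycle_def rdd_linear dact_linear distrib_left split: sum.splits)
    fix c d f g assume fg: "f \<in> A" "g \<in> A"
    have "basis_cocycle i (\<lambda>_. 0) (RD c g - RD d f + br f g) =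
        (RD c (basis_cocycle i d g) + dact (lam + 1) f (basis_cocycle i d g)) - (RD d (basis_cocycle i c f) + dact (lam + 1) g (basis_cocycle i c f))"
      using i
    proof (cases rule: coord_index_cases)
      case (Inl k)
      then show ?thesis
        by (simp add: basis_cocycle_def special_cocycle[OF Inl(3)] RD_dd_pow)
    next
      \<comment> \<open>The computation is that of a coboundary; \<open>RD_dact_commutator\<close>
        holds on all of \<open>'k dps\<close>, so it applies to x^(N) although this element lies
        outside \<open>A\<close>.\<close>
      case zero
      then show ?thesis
        using RD_dact_commutator[of c d "dpX N" 0 g f] by (simp add: basis_cocycle_def rdd_linear)
    next
      case (Inr r)
      then show ?thesis by (simp add: basis_cocycle_def dact_def)
    qed
    then show "basis_cocycle i (\<lambda>_. 0) (RD c g - RD d f + br f g) = R (lam + 1) c f (basis_cocycle i d g) - R (lam + 1) d g (basis_cocycle i c f)"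
      unfolding Rs[OF fg(1) 2[OF fg(2)]] Rs[OF fg(2) 2[OF fg(1)]] .
  qed
qed

lemma coord_dual:
  assumes i: "i \<in> coord_index (lam + 1)" and j: "j \<in> coord_index (lam + 1)"
  shows "coord lam i (cochain lam (basis_cocycle j)) = (if i = j then 1 else 0)"
proof -
  have Y: "cval lam (cochain lam (basis_cocycle j)) c f = basis_cocycle j c f" if "f \<in> A" for c f
    by (rule cval_cochain[OF basis_cocycle_mem(1)[OF j] that basis_cocycle_mem(2)[OF j that]])
  have N1: "N - Suc 0 \<noteq> 0" using N_ge_3 by linarith
  \<comment> \<open>The coefficients read by the coordinates sit at 0, N - 1 and p ^ r - 1; these
    facts keep the coboundary of x^(N) from contributing to the coordinates
    \<open>Inr r\<close>.\<close>
  have pr: "p ^ r \<noteq> N" "p ^ r - Suc 0 \<noteq> N - Suc 0" "p ^ r - Suc 0 \<noteq> 0" if "1 \<le> r" "r < m" for r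
  proof -
    have "p ^ r < N" "p ^ r > 1" using that p_pow_less p_pow_gt_1 by auto
    then show "p ^ r \<noteq> N" "p ^ r - Suc 0 \<noteq> N - Suc 0" "p ^ r - Suc 0 \<noteq> 0" by linarith+
  qed
  from i show ?thesis
  proof (cases rule: coord_index_cases)
    case (Inl k)
    have "dpX k \<in> A" using Inl by simp
    then have *: "coord lam i (cochain lam (basis_cocycle j)) = dp_nth (basis_cocycle j (\<lambda>_. 0) (dpX k)) 0"
      by (simp add: Inl(1) coord_def Y)
    from j show ?thesis
      unfolding * by (cases rule: coord_index_cases) (use Inl N1 in \<open>auto simp: basis_cocycle_def dact_0_dpX_N rdd_linear\<close>)
  next
    case zero
    have *: "coord lam i (cochain lam (basis_cocycle j)) = dp_nth (basis_cocycle j (\<lambda>_. 0) 1) (N - 1)"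
      by (simp add: zero(1) coord_def Y)
    from j show ?thesis
      unfolding * by (cases rule: coord_index_cases) (use zero N1 in \<open>auto simp: basis_cocycle_def dact_0_dpX_N rdd_linear dest: special_pos\<close>)
  next
    case (Inr r)
    then have r: "r \<in> {1..<m}" "r \<noteq> 0" by auto
    then have *: "coord lam i (cochain lam (basis_cocycle j)) = dp_nth (basis_cocycle j (unit_vec r) 0) 0 - dp_nth (basis_cocycle j (\<lambda>_. 0) 1) (p ^ r - 1)"
      by (simp add: Inr(1) coord_def Y)
    from j show ?thesis
      unfolding * by (cases rule: coord_index_cases)
        (use Inr r(2) pr[of r] in \<open>auto simp: basis_cocycle_def dact_0_dpX_N RD_unit_vec[OF r(1)] rdd_linear unit_vec_apply\<close>)
  qed
qed

text \<open>For \<open>Inl k\<close> the constant term of the action of x^(k) on u is 0, since k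
  \<ge> 2 or else k = 1 and the weight is 0. For \<open>Inr 0\<close> the coefficient read is that
  of u at N. For \<open>Inr r\<close> both terms equal the coefficient of u at p ^ r and
  cancel.\<close>

lemma coord_d0:
  assumes i: "i \<in> coord_index (lam + 1)" and u: "u \<in> A"
  shows "coord lam i (ce_d0 L (BV lam) (rho lam) (vb lam u)) = 0"
proof -
  have Y: "cval lam (ce_d0 L (BV lam) (rho lam) (vb lam u)) c f = RD c u + dact (lam + 1) f u" if "f \<in> A" for c f
    using R_eq_special[OF coord_index_special[OF i] that u] cval_d0[OF that u] by simp
  from i show ?thesis
  proof (cases rule: coord_index_cases)
    case (Inl k)
    have "dp_nth (dact (lam + 1) (dpX k) u) 0 = 0"
      using special_pos[OF Inl(3)] special_1[of "lam + 1"] Inl(3)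
      by (cases "k = 1") (auto simp: dact_def dd_dpX)
    then show ?thesis using Inl by (simp add: coord_def Y rdd_linear)
  next
    case zero
    have "dp_nth u N = 0" using u by (simp add: dpA_def)
    then show ?thesis using zero by (simp add: coord_def Y rdd_linear dact_linear)
  next
    case (Inr r)
    then have r: "r \<in> {1..<m}" by simp
    then show ?thesis using Inr by (simp add: coord_def Y rdd_linear dact_linear RD_unit_vec[OF r])
  qed
qed

text \<open>The coordinates \<open>Inl k\<close> and \<open>Inr 0\<close> reduce the restriction to
  W(m) to a coboundary of some \<open>w\<close>; subtracting it leaves invariants as values on the
  \<partial>^q, and the coordinates \<open>Inr r\<close> remove those.\<close>

lemma coord_kernel:
  assumes \<psi>: "\<psi> \<in> cocycles lam" and k0: "\<And>i. i \<in> coord_index (lam + 1) \<Longrightarrow> coord lam i \<psi> = 0"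
  shows "\<psi> \<in> coboundaries lam"
proof -
  let ?\<mu> = "lam + 1" and ?Y = "cval lam \<psi>" and ?o = "\<lambda>_::nat. 0 :: 'k"
  have lin: "\<psi> \<in> lin_maps L (BV lam)" using \<psi> by (simp add: cocycles_def)
  have Ro: "R \<mu> ?o f y = dact \<mu> f y" if "f \<in> A" for \<mu> f y
    using that by (simp add: R_def phi_ad uact_in)
  have Yadd: "?Y ?o (f + g) = ?Y ?o f + ?Y ?o g" if "f \<in> A" "g \<in> A" for f g
    using cval_add[OF lin that, of ?o ?o] by simp
  have Ysm: "?Y ?o (dpC a * f) = dpC a * ?Y ?o f" if "f \<in> A" for a f
    using cval_smult[OF lin that, of a ?o] by simp
  have Ycoc: "?Y ?o (br f g) = dact ?\<mu> f (?Y ?o g) - dact ?\<mu> g (?Y ?o f)" if "f \<in> A" "g \<in> A" for f g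
    using cocycles_cval[OF \<psi> that, of ?o ?o] that by (simp add: rdd_linear Ro)
  obtain u e a where uea: "u \<in> A" "?\<mu> * e = 0" "a 0 = 0"
    "\<And>k. k < N \<Longrightarrow> a k \<noteq> 0 \<Longrightarrow> k \<noteq> 1 \<Longrightarrow> special ?\<mu> k"
    "\<And>f. f \<in> A \<Longrightarrow> ?Y ?o f = dact ?\<mu> f (u + dpC e * dpX N) + (\<Sum>k<N. dpC (a k) * (dd ^^ k) f)"
    using cocycle_classification[of "?Y ?o" ?\<mu>] cval_closed[OF lin] Yadd Ysm Ycoc by blast
  \<comment> \<open>In weight 0 the coefficient of \<psi>(\<partial>) at N - 1 is \<open>e\<close>,
    because u has no coefficient at N; in other weights the classification already gives e =
    0.\<close>
  have e0: "e = 0"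
  proof (cases "?\<mu> = 0")
    case True
    then have "Inr 0 \<in> coord_index ?\<mu>" by (simp add: coord_index_def)
    from k0[OF this] have "dp_nth (?Y ?o 1) (N - 1) = 0" by (simp add: coord_def)
    moreover have "(\<Sum>k<N. a k * (if N - 1 + k = 0 then 1 else 0)) = 0"
      using N_ge_3 by (intro sum.neutral) auto
    moreover have "dp_nth u N = 0" using uea(1) by (simp add: dpA_def)
    ultimately show ?thesis using uea(5)[of 1] by (simp add: dact_linear ddX_N)
  qed (use uea(2) in auto)
  have a_sp: "a k = 0" if k: "k < N" "special ?\<mu> k" for k
  proof -
    have "Inl k \<in> coord_index ?\<mu>" using k by (simp add: coord_index_def special_set_def)
    from k0[OF this] have "dp_nth (?Y ?o (dpX k)) 0 = 0" by (simp add: coord_def)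
    moreover have "dp_nth (dact ?\<mu> (dpX k) u) 0 = 0"
      using special_pos[OF k(2)] special_1[of ?\<mu>] k(2) by (cases "k = 1") (auto simp: dact_def dd_dpX)
    moreover have "(\<Sum>j<N. a j * (if j = k then 1 else 0)) = (\<Sum>j<N. if j = k then a k else 0)"
      by (intro sum.cong) auto
    ultimately show ?thesis using uea(5)[of "dpX k"] e0 k(1) by simp
  qed
  have ak: "a k = 0" if "k < N" "k \<noteq> 1" for k
    using a_sp uea(4) that by blast
  have sum1: "(\<Sum>k<N. dpC (a k) * (dd ^^ k) f) = dpC (a 1) * dd f" for f
  proof -
    have "(\<Sum>k<N. dpC (a k) * (dd ^^ k) f) = (\<Sum>k<N. if k = 1 then dpC (a 1) * dd f else 0)"
      by (intro sum.cong) (auto simp: ak)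
    then show ?thesis using one_less_N by simp
  qed
  have a1: "?\<mu> = 0 \<Longrightarrow> a 1 = 0"
    using a_sp[of 1] one_less_N by (simp add: special_def)
  \<comment> \<open>For nonzero weight f' is the coboundary of the constant 1/\<mu>, which absorbs
    the term of order one. For \<mu> = 0 the quotient has the default value 0, consistent with
    \<open>a 1\<close> being 0 there.\<close>
  define w where "w = u + dpC (a 1 / ?\<mu>)"
  have w: "w \<in> A" using uea(1) by (simp add: w_def)
  have Y0: "?Y ?o f = dact ?\<mu> f w" if f: "f \<in> A" for f
  proof -
    have "?Y ?o f = dact ?\<mu> f u + dpC (a 1) * dd f" using uea(5)[OF f] e0 sum1 by simp
    also have "dpC (a 1) * dd f = dact ?\<mu> f (dpC (a 1 / ?\<mu>))"
    proof (cases "?\<mu> = 0")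
      case True
      then show ?thesis using a1 by (simp add: dact_linear dact_def)
    next
      case False
      have "dact ?\<mu> f (dpC (a 1 / ?\<mu>)) = dpC (?\<mu> * (a 1 / ?\<mu>)) * dd f"
        unfolding dpC_simps dact_def by (simp add: mult_ac)
      then show ?thesis using False by simp
    qed
    finally show ?thesis by (simp add: w_def dact_linear)
  qed
  \<comment> \<open>The discrepancy between \<psi> and the coboundary of \<open>w\<close> on the
    element given by c. Both agree on W(m), so the cocycle identity with g\<partial> shows that W(m)
    annihilates it.\<close>
  define v where "v c = ?Y c 0 - R ?\<mu> c 0 w" for c
  have v_act: "dact ?\<mu> g (v c) = 0" if g: "g \<in> A" for g c
  proof -
    have "?Y ?o (RD c g) = R ?\<mu> c 0 (?Y ?o g) - dact ?\<mu> g (?Y c 0)"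
      using cocycles_cval[OF \<psi> dpA_simps(1) g, of c ?o] g by (simp add: rdd_linear br_simps Ro)
    moreover have "dact ?\<mu> (RD c g) w = R ?\<mu> c 0 (dact ?\<mu> g w) - dact ?\<mu> g (R ?\<mu> c 0 w)"
      using R_commutator[OF dpA_simps(1) g, of ?\<mu> c ?o w] g by (simp add: rdd_linear br_simps Ro)
    ultimately show ?thesis using g by (simp add: v_def dact_linear Y0)
  qed
  have vC: "v c = dpC (dp_nth (v c) 0)" for c
    using v_act[of 1 c] by (intro dd_eq_0) (simp add: dact_linear)
  \<comment> \<open>An invariant is constant, being killed by \<partial>, and x\<partial> multiplies
    a constant by \<mu>; so it can be nonzero only for \<mu> = 0.\<close>
  have v0: "v c = 0" for c
  proof (cases "?\<mu> = 0")
    case False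
    have "dact \<mu> (dpX (Suc 0)) (dpC x) = dpC (\<mu> * x)" for \<mu> x :: 'k by (simp add: dact_def)
    moreover have "dact ?\<mu> (dpX (Suc 0)) (dpC (dp_nth (v c) 0)) = 0"
      using v_act[of "dpX (Suc 0)" c] vC[of c] by simp
    ultimately have "?\<mu> * dp_nth (v c) 0 = 0" by (simp only: dpC_eq_0_iff)
    then have "dp_nth (v c) 0 = 0" using False by (simp only: mult_eq_0_iff) blast
    then show ?thesis using vC[of c] by simp
  next
    case True
    have "dp_nth (v c) 0 = 0"
    proof (rule linear_on_unit_vec[of "\<lambda>c. dp_nth (v c) 0"])
      fix c d :: "nat \<Rightarrow> 'k"
      show "dp_nth (v (\<lambda>r. c r + d r)) 0 = dp_nth (v c) 0 + dp_nth (v d) 0"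
        using cval_add[OF lin dpA_simps(1) dpA_simps(1), of c d] R_lin_args(1)[OF dpA_simps(1) dpA_simps(1), of ?\<mu> c d w]
        by (simp add: v_def)
    next
      fix c :: "nat \<Rightarrow> 'k" and b :: 'k
      show "dp_nth (v (\<lambda>r. b * c r)) 0 = b * dp_nth (v c) 0"
        using cval_smult[OF lin dpA_simps(1), of b c] R_lin_args(2)[OF dpA_simps(1) dpA_simps(1), of ?\<mu> b c w]
        by (simp add: v_def right_diff_distrib)
    next
      \<comment> \<open>With q = p ^ r, the vanishing coordinate equates the constant term of
        \<psi>(\<partial>^q) with coefficient q - 1 of \<psi>(\<partial>) = w'. That is coefficient
        q of \<open>w\<close>, hence the constant term of \<partial>^q w.\<close>
      fix r assume r: "r \<in> {1..<m}"
      then have "Inr r \<in> coord_index ?\<mu>" using True by (auto simp: coord_index_def)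
      then have "dp_nth (?Y (unit_vec r) 0) 0 = dp_nth (?Y ?o 1) (p ^ r - 1)"
        using k0[of "Inr r"] r by (simp add: coord_def)
      also have "\<dots> = dp_nth w (p ^ r)" by (simp add: Y0 dact_linear)
      also have "\<dots> = dp_nth (R ?\<mu> (unit_vec r) 0 w) 0"
        using R_eq_special[of ?\<mu> 0 w "unit_vec r"] True w RD_unit_vec[OF r, of w] by (simp add: dact_linear)
      finally show "dp_nth (v (unit_vec r)) 0 = 0" by (simp add: v_def)
    next
      fix c d :: "nat \<Rightarrow> 'k" assume cd: "\<And>r. r \<in> {1..<m} \<Longrightarrow> c r = d r"
      have "?Y c 0 = ?Y d 0" by (rule cval_cong[OF cd]) simp_all
      moreover have "R ?\<mu> c 0 w = R ?\<mu> d 0 w" by (rule R_cong[OF cd]) simp_all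
      ultimately show "dp_nth (v c) 0 = dp_nth (v d) 0" by (simp add: v_def)
    qed
    then show ?thesis using vC[of c] by simp
  qed
  have Yall: "?Y c f = R ?\<mu> c f w" if f: "f \<in> A" for c f
  proof -
    have "?Y c f = ?Y c 0 + ?Y ?o f" using cval_add[OF lin dpA_simps(1) f, of c ?o] by simp
    also have "\<dots> = R ?\<mu> c 0 w + R ?\<mu> ?o f w" using v0[of c] f by (simp add: v_def Y0 Ro)
    also have "\<dots> = R ?\<mu> c f w" using R_lin_args(1)[OF dpA_simps(1) f, of ?\<mu> c ?o w] by simp
    finally show ?thesis .
  qed
  have "\<psi> = ce_d0 L (BV lam) (rho lam) (vb lam w)"
    using w by (intro L_ext) (simp_all add: lin_mapsD(4)[OF lin] d0_ext cval_vb[OF lin] Yall ce_d0_apply)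
  then show ?thesis unfolding coboundaries_eq using w by blast
qed

lemma card_coord_index: "card (coord_index \<mu>) = card (special_set \<mu>) + (if \<mu> = 0 then m else 0)"
proof -
  have f: "finite (special_set \<mu>)" unfolding special_set_def by simp
  have "card (Inl ` special_set \<mu> \<union> Inr ` {..<m}) = card (special_set \<mu>) + m"
    using f by (subst card_Un_disjoint) (auto simp: card_image)
  then show ?thesis using f by (cases "\<mu> = 0") (simp_all add: coord_index_def card_image)
qed

theorem H1_dim:
  "has_dim (H1 L (BV lam) (rho lam)) (card (special_set (lam + 1)) + (if lam + 1 = 0 then m else 0))"
  unfolding H1_eq card_coord_index[symmetric]
proof (rule has_dim_quotI[where \<kappa> = "coord lam" and z = "\<lambda>i. cochain lam (basis_cocycle i)", OF cocycle_space_vs coboundaries_submodule])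
  show "finite (coord_index (lam + 1))" by (simp add: coord_index_def special_set_def)
  show "cochain lam (basis_cocycle i) \<in> carrier (cocycle_space lam)" if "i \<in> coord_index (lam + 1)" for i
    using basis_cocycle_mem(3)[OF that] by simp
  fix i assume i: "i \<in> coord_index (lam + 1)"
  have X: "dpX k \<in> A" if "i = Inl k" for k using i that by (auto simp: coord_index_def special_set_def split: if_splits)
  show "coord lam i (x \<oplus>\<^bsub>cocycle_space lam\<^esub> y) = coord lam i x + coord lam i y"
    if xy: "x \<in> carrier (cocycle_space lam)" "y \<in> carrier (cocycle_space lam)" for x y
  proof -
    have Z: "x \<in> cocycles lam" "y \<in> cocycles lam" using xy by simp_all
    show ?thesis
    proof (cases i)
      case (Inl k)
      show ?thesis unfolding coord_def Inl sum.case cval_cocycle_space(1)[OF Z X[OF Inl]] by simp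
    next
      case (Inr r)
      show ?thesis unfolding coord_def Inr sum.case cval_cocycle_space(1)[OF Z A_1(1)] cval_cocycle_space(1)[OF Z dpA_simps(1)] by simp
    qed
  qed
  show "coord lam i (b \<odot>\<^bsub>cocycle_space lam\<^esub> x) = b * coord lam i x" if x: "x \<in> carrier (cocycle_space lam)" for b x
  proof -
    have Z: "x \<in> cocycles lam" "x \<in> cocycles lam" using x by simp_all
    show ?thesis
    proof (cases i)
      case (Inl k)
      show ?thesis unfolding coord_def Inl sum.case cval_cocycle_space(2)[OF Z X[OF Inl]] by simp
    next
      case (Inr r)
      show ?thesis unfolding coord_def Inr sum.case cval_cocycle_space(2)[OF Z A_1(1)] cval_cocycle_space(2)[OF Z dpA_simps(1)]
        by (simp add: right_diff_distrib)
    qed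
  qed
  show "coord lam i (cochain lam (basis_cocycle j)) = (if i = j then 1 else 0)" if "j \<in> coord_index (lam + 1)" for j
    by (rule coord_dual[OF i that])
  show "coord lam i x = 0" if "x \<in> coboundaries lam" for x
    using that coord_d0[OF i] unfolding coboundaries_eq by blast
next
  show "x \<in> coboundaries lam" if "x \<in> carrier (cocycle_space lam)" "\<And>i. i \<in> coord_index (lam + 1) \<Longrightarrow> coord lam i x = 0" for x
    using that by (intro coord_kernel) auto
qed

end

theorem theorem5p4:
  fixes p m :: nat and lam :: "'k::field"
    and \<phi> :: "(((nat \<Rightarrow> 'k) \<Rightarrow> nat \<Rightarrow> 'k) \<Rightarrow> (nat \<Rightarrow> 'k) \<Rightarrow> nat \<Rightarrow> 'k) \<Rightarrow> 'k zenv"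
  assumes "prime p" and "CHAR('k) = p" and "p > 2" and "m > 0"
    and "\<phi> \<in> envelope_homs p m"
  defines "H \<equiv> H1 (rzass p m) (baby_verma p m lam) (\<lambda>x. baby_verma_rep p m lam (\<phi> x))"
  shows "(p = 3 \<longrightarrow> has_dim H
           (if lam = 0 then 1 else if lam = 1 then m - 1 else if lam = 2 then m + 1 else 0)) \<and>
         (p > 3 \<longrightarrow> has_dim H
           (if lam = 0 \<or> lam = 1 then 1 else if lam = of_nat (p - 2) then m - 1
            else if lam = of_nat (p - 1) then m + 1 else 0))"
proof -
  interpret zass_phi p m \<phi>
    by unfold_locales (use assms in auto)
  define n where "n = card (special_set (lam + 1)) + (if lam + 1 = 0 then m else 0)"
  have H: "has_dim H n" unfolding H_def n_def by (rule H1_dim)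
  \<comment> \<open>Translation between the weight \<lambda> + 1 and \<lambda>; -1 and -2 are the
    field elements written p - 1 and p - 2 in the statement.\<close>
  have m1: "lam + 1 = 0 \<longleftrightarrow> lam = -1" "lam + 1 = 1 \<longleftrightarrow> lam = 0" "lam + 1 = 2 \<longleftrightarrow> lam = 1"
    "lam + 1 = -1 \<longleftrightarrow> lam = -2"
    by (auto simp: eq_neg_iff_add_eq_0 add.assoc)
  have n: "lam = -1 \<Longrightarrow> n = m + 1" "lam = 0 \<Longrightarrow> n = 1" "p > 3 \<Longrightarrow> lam = 1 \<Longrightarrow> n = 1" 
    "lam = -2 \<Longrightarrow> n = m - 1" "lam \<notin> {-1, 0, 1, -2} \<Longrightarrow> n = 0"
    using card_special_0 card_special_1 card_special_2 card_special_minus_1 card_special_other[of "lam + 1"] m1 two_ne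
    by (auto simp: n_def)
  have ne: "(-1 :: 'k) \<noteq> 0" "(1 :: 'k) \<noteq> 0" "(-2 :: 'k) \<noteq> 0" "(-1 :: 'k) \<noteq> -2"
    using two_ne by auto
  show ?thesis
  proof (intro conjI impI)
    \<comment> \<open>Here -2 = 1 and -1 = 2, so \<lambda> = 1 falls under weight -1; the separate
      count for weight 2 requires p > 3.\<close>
    assume p: "p = 3"
    then have two: "(2 :: 'k) = -1" using three by simp
    then have one: "(-2 :: 'k) = 1" by simp
    have "n = (if lam = 0 then 1 else if lam = 1 then m - 1 else if lam = 2 then m + 1 else 0)"
      using n(1,2,4,5) ne two_ne(2) unfolding two one by (cases "lam = 0"; cases "lam = 1"; cases "lam = -1") auto
    then show "has_dim H (if lam = 0 then 1 else if lam = 1 then m - 1 else if lam = 2 then m + 1 else 0)"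
      using H by (simp only:)
  next
    assume p: "p > 3"
    have n2: "(of_nat (p - 2) :: 'k) = -2" "(of_nat (p - 1) :: 'k) = -1"
      using of_nat_p_minus[of 2] of_nat_p_minus[of 1] p by simp_all
    have "(1 :: 'k) \<noteq> -2"
    proof
      assume "(1 :: 'k) = -2"
      then have "(2 :: 'k) = -1" by (metis minus_minus)
      then show False using three p by simp
    qed
    then have "n = (if lam = 0 \<or> lam = 1 then 1 else if lam = -2 then m - 1 else if lam = -1 then m + 1 else 0)"
      using n(1,2,4,5) n(3)[OF p] ne by (cases "lam = 0"; cases "lam = 1"; cases "lam = -2"; cases "lam = -1") auto
    then show "has_dim H (if lam = 0 \<or> lam = 1 then 1 else if lam = of_nat (p - 2) then m - 1
            else if lam = of_nat (p - 1) then m + 1 else 0)"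
      unfolding n2 using H by (simp only:)
  qed
qed

end
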